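(* Let $1/4<H<1$, $T>0$, let $b,\sigma$ satisfy the standing assumption (A) of the context, and let $\bar X$ solve $\bar X_t'=b_t(\bar X_t)$, $\bar X_0=x_0$ on $[0,T]$. Let $\mathcal A$ be either the fixed-endpoint space $\mathcal H^{\sigma,T}_{H;x_0,x_T}$ with $x_T=\bar X_T$, or the free-endpoint space $x_0+\mathcal H_H^\sigma([0,T];\mathbb R^n)$. Then there exists $C>0$, independent of $\epsilon$, such that every global minimizer $\phi^\epsilon$ of $J_\epsilon$ over $\mathcal A$ satisfies $$\|\phi^\epsilon-\bar X\|_\infty\le C\epsilon .$$
   Context: Standing assumption (A): $b\in C_b^{1,3}([0,T]\times\mathbb R^n;\mathbb R^n)$ (bounded, with bounded continuous derivatives up to order one in $t$ and order three in $x$); $\sigma_t=\operatorname{diag}(\sigma_t^1,\dots,\sigma_t^n)$ with $\sigma^i\in C^1([0,T])$ and $0<m_i\le\sigma_t^i\le M_i$. $\nabla\cdot$ acts in the space variable. The noise intensity $\epsilon$ ranges over $(0,\infty)$; $\|\cdot\|_\infty$ is the supremum norm on $[0,T]$. Kernel, for $0<s<t$: $K_H(t,s)=c_H\left[(t/s)^{H-\frac12}(t-s)^{H-\frac12}-(H-\frac12)s^{\frac12-H}\int_s^tu^{H-\frac32}(u-s)^{H-\frac12}du\right]$, $c_H=\sqrt{\frac{2H\Gamma(3/2-H)}{\Gamma(H+1/2)\Gamma(2-2H)}}$. For $u\in L^2([0,T];\mathbb R^n)$: $(K_Hu)(t)=\int_0^tK_H(t,s)u(s)ds$, $(K_H^\sigma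 u)(t)=\int_0^t\sigma_s\,d(K_Hu)(s)$ (Young integral). $K_H^\sigma$ is injective; $\mathcal H_H^\sigma([0,T];\mathbb R^n):=K_H^\sigma(L^2)$. $d_H=\sqrt{2H\Gamma(H+\frac12)\Gamma(\frac32-H)/\Gamma(2-2H)}$. For $\phi\in x_0+\mathcal H_H^\sigma([0,T];\mathbb R^n)$, $$J_\epsilon(\phi)=\frac1{2\epsilon}\int_0^T\left|(K_H^\sigma)^{-1}\left(\phi_\cdot-x_0-\int_0^\cdot b_s(\phi_s)ds\right)(t)\right|^2dt+\frac{d_H}2\int_0^T\nabla\cdot b_t(\phi_t)\,dt .$$ $\mathcal H^{\sigma,T}_{H;x_0,x_T}=\{\phi\in x_0+\mathcal H_H^\sigma([0,T];\mathbb R^n):\phi_T=x_T\}$. *)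

theory Defs
  imports "HOL-Analysis.Analysis"
begin

text \<open>Functions on \<open>[0,T]\<close> are represented by total functions on \<^typ>\<open>real\<close>; only their values on
  \<open>{0..T}\<close> matter. An element of \<open>L\<^sup>2([0,T])\<close> is represented by any of its representatives.\<close>

definition bounded_continuous :: "real \<Rightarrow> (real \<Rightarrow> 'a::real_normed_vector \<Rightarrow> 'b::real_normed_vector) \<Rightarrow> bool" where
  "bounded_continuous T f \<longleftrightarrow>
     continuous_on ({0..T} \<times> UNIV) (\<lambda>(t, x). f t x) \<and>
     bounded ((\<lambda>(t, x). f t x) ` ({0..T} \<times> UNIV))"

text \<open>The class \<open>C\<^sub>b\<close> of order \<open>1\<close> in time and \<open>3\<close> in space: \<open>\<partial>\<^sub>t b\<close> (one-sided at the end points)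
  and the spatial Frechet derivatives \<open>D\<^sub>x b\<close>, \<open>D\<^sub>x\<^sup>2 b\<close>, \<open>D\<^sub>x\<^sup>3 b\<close> exist, and together with \<open>b\<close> they
  are bounded and jointly continuous. No mixed time-space derivatives are required.\<close>

definition Cb13 :: "real \<Rightarrow> (real \<Rightarrow> 'a::euclidean_space \<Rightarrow> 'a) \<Rightarrow> bool" where
  "Cb13 T b \<longleftrightarrow>
     (\<exists>(bt :: real \<Rightarrow> 'a \<Rightarrow> 'a)
       (D1 :: real \<Rightarrow> 'a \<Rightarrow> ('a \<Rightarrow>\<^sub>L 'a))
       (D2 :: real \<Rightarrow> 'a \<Rightarrow> ('a \<Rightarrow>\<^sub>L ('a \<Rightarrow>\<^sub>L 'a)))
       (D3 :: real \<Rightarrow> 'a \<Rightarrow> ('a \<Rightarrow>\<^sub>L ('a \<Rightarrow>\<^sub>L ('a \<Rightarrow>\<^sub>L 'a)))).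
        (\<forall>t\<in>{0..T}. \<forall>x.
           ((\<lambda>s. b s x) has_vector_derivative bt t x) (at t within {0..T}) \<and>
           (b t has_derivative blinfun_apply (D1 t x)) (at x) \<and>
           (D1 t has_derivative blinfun_apply (D2 t x)) (at x) \<and>
           (D2 t has_derivative blinfun_apply (D3 t x)) (at x)) \<and>
        bounded_continuous T b \<and> bounded_continuous T bt \<and>
        bounded_continuous T D1 \<and> bounded_continuous T D2 \<and> bounded_continuous T D3)"

definition C1_on_interval :: "real \<Rightarrow> (real \<Rightarrow> real) \<Rightarrow> bool" where
  "C1_on_interval T f \<longleftrightarrow>
     (\<exists>f'. continuous_on {0..T} f' \<and>
           (\<forall>t\<in>{0..T}. (f has_real_derivative f' t) (at t within {0..T})))"

definition admissible_sigma :: "real \<Rightarrow> (real \<Rightarrow> real^'n^'n) \<Rightarrow> bool" where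
  "admissible_sigma T \<sigma> \<longleftrightarrow>
     (\<forall>t\<in>{0..T}. \<forall>i j. i \<noteq> j \<longrightarrow> \<sigma> t $ i $ j = 0) \<and>
     (\<forall>i. C1_on_interval T (\<lambda>t. \<sigma> t $ i $ i)) \<and>
     (\<forall>i. \<exists>m M. 0 < m \<and> (\<forall>t\<in>{0..T}. m \<le> \<sigma> t $ i $ i \<and> \<sigma> t $ i $ i \<le> M))"

definition divergence :: "(real^'n \<Rightarrow> real^'n) \<Rightarrow> real^'n \<Rightarrow> real" where
  "divergence f x = (\<Sum>i\<in>UNIV. frechet_derivative f (at x) (axis i 1) $ i)"

definition c_const :: "real \<Rightarrow> real" where
  "c_const H = sqrt (2 * H * Gamma (3/2 - H) / (Gamma (H + 1/2) * Gamma (2 - 2 * H)))"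

definition d_const :: "real \<Rightarrow> real" where
  "d_const H = sqrt (2 * H * Gamma (H + 1/2) * Gamma (3/2 - H) / Gamma (2 - 2 * H))"

text \<open>Only meaningful for \<open>0 < s < t\<close>; the remaining \<open>s \<in> [0,t]\<close> form a null set.\<close>

definition kernel :: "real \<Rightarrow> real \<Rightarrow> real \<Rightarrow> real" where
  "kernel H t s = c_const H *
     ((t / s) powr (H - 1/2) * (t - s) powr (H - 1/2)
      - (H - 1/2) * s powr (1/2 - H) *
          integral {s..t} (\<lambda>u. u powr (H - 3/2) * (u - s) powr (H - 1/2)))"

definition L2 :: "real \<Rightarrow> (real \<Rightarrow> real^'n) set" where
  "L2 T = {u. u \<in> borel_measurable (lebesgue_on {0..T}) \<and>
              integrable (lebesgue_on {0..T}) (\<lambda>t. (norm (u t))\<^sup>2)}"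

definition K_op :: "real \<Rightarrow> (real \<Rightarrow> real^'n) \<Rightarrow> real \<Rightarrow> real^'n" where
  "K_op H u t = integral {0..t} (\<lambda>s. kernel H t s *\<^sub>R u s)"

text \<open>The Young integral \<open>\<integral>\<^sub>a\<^sup>b f dg\<close> is the limit of the Riemann--Stieltjes sums as the mesh tends
  to \<open>0\<close>; it is the gauge formulation with gauges restricted to balls of constant radius.\<close>

definition has_young_integral ::
  "(real \<Rightarrow> real^'n^'m) \<Rightarrow> (real \<Rightarrow> real^'n) \<Rightarrow> real^'m \<Rightarrow> real \<Rightarrow> real \<Rightarrow> bool" where
  "has_young_integral f g I a b \<longleftrightarrow>
     (\<forall>e>0. \<exists>\<delta>>0. \<forall>p. p tagged_division_of {a..b} \<and> (\<lambda>x. ball x \<delta>) fine p \<longrightarrow>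
        norm ((\<Sum>(x, k)\<in>p. f x *v (g (Sup k) - g (Inf k))) - I) < e)"

definition young_integral ::
  "(real \<Rightarrow> real^'n^'m) \<Rightarrow> (real \<Rightarrow> real^'n) \<Rightarrow> real \<Rightarrow> real \<Rightarrow> real^'m" where
  "young_integral f g a b = (THE I. has_young_integral f g I a b)"

definition K_sigma :: "real \<Rightarrow> (real \<Rightarrow> real^'n^'n) \<Rightarrow> (real \<Rightarrow> real^'n) \<Rightarrow> real \<Rightarrow> real^'n" where
  "K_sigma H \<sigma> u t = young_integral \<sigma> (K_op H u) 0 t"

definition H_space :: "real \<Rightarrow> real \<Rightarrow> (real \<Rightarrow> real^'n^'n) \<Rightarrow> (real \<Rightarrow> real^'n) set" where
  "H_space T H \<sigma> = {h. \<exists>u\<in>L2 T. \<forall>t\<in>{0..T}. h t = K_sigma H \<sigma> u t}"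

text \<open>\<^const>\<open>K_sigma\<close> is injective up to null sets, so for \<open>h\<close> in \<^const>\<open>H_space\<close> this picks some
  representative of the unique preimage class.\<close>

definition K_sigma_inv ::
  "real \<Rightarrow> real \<Rightarrow> (real \<Rightarrow> real^'n^'n) \<Rightarrow> (real \<Rightarrow> real^'n) \<Rightarrow> real \<Rightarrow> real^'n" where
  "K_sigma_inv T H \<sigma> h = (SOME u. u \<in> L2 T \<and> (\<forall>t\<in>{0..T}. K_sigma H \<sigma> u t = h t))"

definition J_functional ::
  "real \<Rightarrow> real \<Rightarrow> (real \<Rightarrow> real^'n \<Rightarrow> real^'n) \<Rightarrow> (real \<Rightarrow> real^'n^'n) \<Rightarrow> real^'n \<Rightarrow>
   real \<Rightarrow> (real \<Rightarrow> real^'n) \<Rightarrow> real" where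
  "J_functional T H b \<sigma> x0 \<epsilon> \<phi> =
     1 / (2 * \<epsilon>) *
       integral {0..T} (\<lambda>t. (norm (K_sigma_inv T H \<sigma>
         (\<lambda>r. \<phi> r - x0 - integral {0..r} (\<lambda>s. b s (\<phi> s))) t))\<^sup>2)
     + d_const H / 2 * integral {0..T} (\<lambda>t. divergence (b t) (\<phi> t))"

definition free_endpoint_space ::
  "real \<Rightarrow> real \<Rightarrow> (real \<Rightarrow> real^'n^'n) \<Rightarrow> real^'n \<Rightarrow> (real \<Rightarrow> real^'n) set" where
  "free_endpoint_space T H \<sigma> x0 = {\<phi>. (\<lambda>t. \<phi> t - x0) \<in> H_space T H \<sigma>}"

definition fixed_endpoint_space ::
  "real \<Rightarrow> real \<Rightarrow> (real \<Rightarrow> real^'n^'n) \<Rightarrow> real^'n \<Rightarrow> real^'n \<Rightarrow> (real \<Rightarrow> real^'n) set" where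
  "fixed_endpoint_space T H \<sigma> x0 xT = {\<phi> \<in> free_endpoint_space T H \<sigma> x0. \<phi> T = xT}"

text \<open>Extended-real valued, so that it is \<open>\<infinity>\<close> (and not a default value) on unbounded functions.\<close>

definition sup_norm :: "real \<Rightarrow> (real \<Rightarrow> 'a::real_normed_vector) \<Rightarrow> ereal" where
  "sup_norm T f = (SUP t\<in>{0..T}. ereal (norm (f t)))"

end

theory Submission
  imports Defs
begin

text \<open>
  Since the residual of \<open>X\<close> vanishes and \<open>K\<^sub>H\<^sup>\<sigma>\<close> is injective, the quadratic part of \<open>J\<^sub>\<epsilon>(X)\<close> is \<open>0\<close>. Let \<open>\<phi>\<close> be a minimizer
  and let \<open>u\<close> be the preimage of its residual under \<open>K\<^sub>H\<^sup>\<sigma>\<close>. Gronwall's inequality and the continuity of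
  \<open>K\<^sub>H\<^sup>\<sigma>\<close> from \<open>L\<^sup>2\<close> to the continuous functions give \<open>\<parallel>\<phi> - X\<parallel> \<le> C \<parallel>u\<parallel>\<close>. As the divergence is Lipschitz,
  \<open>J\<^sub>\<epsilon>(\<phi>) \<le> J\<^sub>\<epsilon>(X)\<close> yields \<open>\<parallel>u\<parallel>\<^sup>2 \<le> \<epsilon> C' \<parallel>\<phi> - X\<parallel>\<close>, hence \<open>\<parallel>u\<parallel> = O(\<epsilon>)\<close> and \<open>\<parallel>\<phi> - X\<parallel> = O(\<epsilon>)\<close>.

  The work lies in the operator: \<open>X - x\<^sub>0\<close> and the integrated drift along every admissible path must belong to
  its range. For \<open>H \<le> 1/2\<close> this holds for any continuous drift. For \<open>H > 1/2\<close> admissible paths have a square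
  integrable derivative, the chain rule passes this on to \<open>\<sigma>\<^sup>-\<^sup>1 b(\<phi>)\<close>, and such functions have a fractional
  derivative of order \<open>H - 1/2\<close> in the required weighted space.
\<close>

section \<open>Fractional integrals\<close>

text \<open>Put al = H - 1/2. Formally the derivative of K_H u is, up to a constant, r^al times the
  fractional integral of order al of s^(-al) u, a negative order meaning a fractional derivative.
  For al < 0 that derivative need not exist when u is only square integrable. The arguments
  therefore refer to \<open>Gop al u\<close>, whose order 1 + al exceeds 1/2 for every H in (0,1):
  square integrability then yields a continuous function of size O(sqrt t), and the weights that are
  singular at 0 stay integrable. The same formula explains why the range splits at H = 1/2. If K_H u
  is the primitive of g, then, up to constants, s^(-al) u is the integral of order -al of s^(-al) g.
  For al < 0 this is a genuine fractional integral; for al > 0 it is a fractional derivative, and g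
  must have some smoothness. The definitions use gauge integrals and arbitrary representatives,
  while Fubini and Cauchy-Schwarz need Lebesgue integrals. Borel representatives that vanish off the
  open interval mediate between the two.\<close>

abbreviation ind :: "real \<Rightarrow> real \<Rightarrow> real" where
  "ind t s \<equiv> indicator {0<..<t} s"

text \<open>Nonnegativity turns gauge integrability into Lebesgue integrability. This carries the
  Beta integral and the integrals of powers, which come from gauge integration, over to the setting
  of Fubini's theorem.\<close>

lemma has_bochner_integral_of_nonneg_has_integral:
  fixes f :: "real \<Rightarrow> real"
  assumes [measurable]: "f \<in> borel_measurable borel"
    and nn: "\<And>x. x \<in> {a<..<b} \<Longrightarrow> 0 \<le> f x" and I: "(f has_integral I) {a..b}"
  shows "has_bochner_integral lborel (\<lambda>x. indicator {a<..<b} x * f x) I"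
proof -
  have I': "(f has_integral I) {a<..<b}" using I by (simp add: has_integral_Icc_iff_Ioo)
  then have "f absolutely_integrable_on {a<..<b}"
    using nn by (intro nonnegative_absolutely_integrable_1) (auto simp: integrable_on_def)
  then have "integrable lebesgue (\<lambda>x. indicator {a<..<b} x * f x)"
    by (simp add: set_integrable_def)
  then have i: "integrable lborel (\<lambda>x. indicator {a<..<b} x * f x)"
    by (subst (asm) integrable_completion) auto
  have "((\<lambda>x. indicator {a<..<b} x * f x) has_integral I) UNIV"
    using I' by (subst (asm) has_integral_restrict_UNIV[symmetric])
      (auto elim!: has_integral_eq[rotated])
  then have "integral\<^sup>L lborel (\<lambda>x. indicator {a<..<b} x * f x) = I"
    using has_integral_integral_lborel[OF i] has_integral_unique by blast
  then show ?thesis using i by (simp add: has_bochner_integral_iff)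
qed

text \<open>Substitute r = s + (t - s) x in Euler's integral over (0,1). The two powers contribute
  the exponent a + b - 2 and the Jacobian one more.\<close>

lemma has_bochner_integral_Beta_segment:
  fixes a b s t :: real
  assumes "0 < a" "0 < b" "s < t"
  shows "has_bochner_integral lborel
           (\<lambda>r. indicator {s<..<t} r * ((t - r) powr (a - 1) * (r - s) powr (b - 1)))
           ((t - s) powr (a + b - 1) * Beta a b)"
proof -
  have "has_bochner_integral lborel
     (\<lambda>x. indicator {0<..<1} x * (x powr (b - 1) * (1 - x) powr (a - 1))) (Beta b a)"
    using has_integral_Beta_real[of b a] assms
    by (intro has_bochner_integral_of_nonneg_has_integral) auto
  from has_bochner_integral_mult_right[OF this, of "(t - s) powr (a + b - 2)"]
  have *: "has_bochner_integral lborel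
     (\<lambda>x. (t - s) powr (a + b - 2) * (indicator {0<..<1} x * (x powr (b - 1) * (1 - x) powr (a - 1))))
     ((t - s) powr (a + b - 2) * Beta a b)" by (simp add: Beta_commute)
  have eq: "(t - s) powr (a + b - 2) * (indicator {0<..<1} x * (x powr (b - 1) * (1 - x) powr (a - 1)))
     = indicator {s<..<t} (s + (t - s) * x) *
        ((t - (s + (t - s) * x)) powr (a - 1) * (s + (t - s) * x - s) powr (b - 1))" for x :: real
  proof (cases "x \<in> {0<..<1}")
    case True
    then have m: "s + (t - s) * x \<in> {s<..<t}"
      using assms mult_strict_left_mono[of x 1 "t - s"] by (simp add: algebra_simps)
    have e: "t - (s + (t - s) * x) = (t - s) * (1 - x)" by algebra
    have "(t - s) powr (a + b - 2) = (t - s) powr (a - 1) * (t - s) powr (b - 1)"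
      by (simp add: powr_add[symmetric] algebra_simps)
    then show ?thesis using True m assms unfolding e by (simp add: powr_mult mult_ac)
  next
    case False
    then have m: "s + (t - s) * x \<notin> {s<..<t}"
    proof -
      have "s + (t - s) * x \<in> {s<..<t} \<longleftrightarrow> 0 < (t - s) * x \<and> (t - s) * x < t - s"
        unfolding greaterThanLessThan_iff by argo
      also have "\<dots> \<longleftrightarrow> 0 < x \<and> x < 1"
        using assms mult_less_cancel_left_pos[of "t - s" x 1] by (simp add: zero_less_mult_iff)
      finally show ?thesis using False by simp
    qed
    show ?thesis using False m by simp
  qed
  have v: "((t - s) powr (a + b - 1) * Beta a b) /\<^sub>R \<bar>t - s\<bar> = (t - s) powr (a + b - 2) * Beta a b"
    using assms powr_mult_base[of "t - s" "a + b - 2"] by (simp add: field_simps)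
  have ts: "t - s \<noteq> 0" using assms by simp
  show ?thesis
    by (rule iffD2[OF lborel_has_bochner_integral_real_affine_iff[where c="t - s" and t=s, OF ts]])
      (use *[unfolded eq] in \<open>simp only: v\<close>)
qed

lemma Cauchy_Schwarz_lborel:
  fixes f g :: "real \<Rightarrow> real"
  assumes [measurable]: "f \<in> borel_measurable borel" "g \<in> borel_measurable borel"
    and f: "integrable lborel (\<lambda>x. (f x)^2)" and g: "integrable lborel (\<lambda>x. (g x)^2)"
  shows "integrable lborel (\<lambda>x. f x * g x)"
    and "(LINT x|lborel. \<bar>f x * g x\<bar>) \<le> sqrt (LINT x|lborel. (f x)^2) * sqrt (LINT x|lborel. (g x)^2)"
    and "\<bar>LINT x|lborel. f x * g x\<bar> \<le> sqrt (LINT x|lborel. (f x)^2) * sqrt (LINT x|lborel. (g x)^2)"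
proof -
  show i: "integrable lborel (\<lambda>x. f x * g x)"
  proof (rule Bochner_Integration.integrable_bound[OF Bochner_Integration.integrable_add[OF f g]])
    show "AE x in lborel. norm (f x * g x) \<le> norm ((f x)^2 + (g x)^2)"
    proof (rule AE_I2)
      fix x
      have "2 * (\<bar>f x\<bar> * \<bar>g x\<bar>) \<le> (f x)^2 + (g x)^2"
        using sum_squares_bound[of "\<bar>f x\<bar>" "\<bar>g x\<bar>"] by (simp add: mult_ac)
      moreover have "0 \<le> \<bar>f x\<bar> * \<bar>g x\<bar>" by simp
      ultimately have "\<bar>f x\<bar> * \<bar>g x\<bar> \<le> (f x)^2 + (g x)^2" by linarith
      then show "norm (f x * g x) \<le> norm ((f x)^2 + (g x)^2)"
        by (simp add: abs_mult)
    qed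
  qed simp
  have "(\<integral>\<^sup>+x. ennreal \<bar>f x\<bar> * ennreal \<bar>g x\<bar> \<partial>lborel)^2 \<le>
      (\<integral>\<^sup>+x. (ennreal \<bar>f x\<bar>)^2 \<partial>lborel) * (\<integral>\<^sup>+x. (ennreal \<bar>g x\<bar>)^2 \<partial>lborel)"
    by (rule Cauchy_Schwarz_nn_integral) auto
  also have "(\<integral>\<^sup>+x. ennreal \<bar>f x\<bar> * ennreal \<bar>g x\<bar> \<partial>lborel) = ennreal (LINT x|lborel. \<bar>f x * g x\<bar>)"
    using integrable_abs[OF i]
    by (subst nn_integral_eq_integral[symmetric]) (auto simp: abs_mult ennreal_mult)
  also have "(\<integral>\<^sup>+x. (ennreal \<bar>f x\<bar>)^2 \<partial>lborel) = ennreal (LINT x|lborel. (f x)^2)"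
    using f by (subst nn_integral_eq_integral[symmetric]) (auto simp: ennreal_power)
  also have "(\<integral>\<^sup>+x. (ennreal \<bar>g x\<bar>)^2 \<partial>lborel) = ennreal (LINT x|lborel. (g x)^2)"
    using g by (subst nn_integral_eq_integral[symmetric]) (auto simp: ennreal_power)
  finally have "(LINT x|lborel. \<bar>f x * g x\<bar>)^2 \<le> (LINT x|lborel. (f x)^2) * (LINT x|lborel. (g x)^2)"
    by (simp add: ennreal_power ennreal_mult[symmetric])
  then have "sqrt ((LINT x|lborel. \<bar>f x * g x\<bar>)^2) \<le>
      sqrt ((LINT x|lborel. (f x)^2) * (LINT x|lborel. (g x)^2))"
    by (rule real_sqrt_le_mono)
  then show 1: "(LINT x|lborel. \<bar>f x * g x\<bar>) \<le> sqrt (LINT x|lborel. (f x)^2) * sqrt (LINT x|lborel. (g x)^2)"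
    by (simp add: real_sqrt_mult)
  show "\<bar>LINT x|lborel. f x * g x\<bar> \<le> sqrt (LINT x|lborel. (f x)^2) * sqrt (LINT x|lborel. (g x)^2)"
    by (rule order_trans[OF integral_abs_bound 1])
qed

text \<open>The Riemann--Liouville integral of order \<open>a\<close> without the factor \<open>1/\<Gamma>(a)\<close>, so that the semigroup
  property \<open>RL_RL\<close> carries a Beta factor.\<close>

definition RL :: "real \<Rightarrow> (real \<Rightarrow> real) \<Rightarrow> real \<Rightarrow> real" where
  "RL a f t = (LINT s|lborel. ind t s * ((t - s) powr (a - 1) * f s))"

text \<open>As a conditional, the cut-off to the triangle s < r is visibly measurable in both
  variables together; as an indicator it is the indicator of a set that moves with
  \<open>r\<close>.\<close>

lemma indicator_triangle: "ind r s * x = (if 0 < s \<and> s < r then x else (0::real))"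
  by (auto simp: indicator_def)

abbreviation moment :: "real \<Rightarrow> (real \<Rightarrow> real) \<Rightarrow> real \<Rightarrow> real" where
  "moment p g t \<equiv> (LINT r|lborel. ind t r * (r powr p * g r))"

lemma RL_measurable [measurable]:
  assumes [measurable]: "f \<in> borel_measurable borel"
  shows "RL a f \<in> borel_measurable borel"
  unfolding RL_def[abs_def] indicator_triangle by measurable

text \<open>Fubini on the triangle 0 < s < r < t, where the integral over r is a Beta integral. The
  condition \<open>1 \<le> a + b\<close> makes the composed kernel bounded, so that integrability of
  \<open>f\<close> suffices for each fixed t. The last claim provides absolute convergence of the
  inner integral for almost every r, which is not automatic when b < 1.\<close>

lemma RL_RL:
  fixes a b t :: real
  assumes a: "0 < a" and b: "0 < b" and ab: "1 \<le> a + b" and f: "integrable lborel f"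
  shows "RL a (RL b f) t = Beta a b * RL (a + b) f t"
    and "integrable lborel (\<lambda>r. ind t r * ((t - r) powr (a - 1) * RL b f r))"
    and "AE r in lborel. r \<in> {0<..<t} \<longrightarrow>
      integrable lborel (\<lambda>s. ind r s * ((r - s) powr (b - 1) * f s))"
proof -
  have [measurable]: "f \<in> borel_measurable borel" using f by auto
  define F where "F s r = ind t r * ((t - r) powr (a - 1) *
      (ind r s * ((r - s) powr (b - 1) * f s)))" for s r
  have [measurable]: "case_prod F \<in> borel_measurable (lborel \<Otimes>\<^sub>M lborel)"
    unfolding F_def[abs_def] indicator_triangle by measurable
  have inner: "has_bochner_integral lborel (\<lambda>r. ind t r * ((t - r) powr (a - 1) *
      (ind r s * ((r - s) powr (b - 1) * c))))
      (Beta a b * (ind t s * ((t - s) powr (a + b - 1) * c)))" for s c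
  proof (cases "0 < s \<and> s < t")
    case True
    have "has_bochner_integral lborel (\<lambda>r. c * (indicator {s<..<t} r * ((t - r) powr (a - 1) * (r - s) powr (b - 1))))
         (c * ((t - s) powr (a + b - 1) * Beta a b))"
      using True a b by (intro has_bochner_integral_mult_right has_bochner_integral_Beta_segment) auto
    also have "(\<lambda>r. c * (indicator {s<..<t} r * ((t - r) powr (a - 1) * (r - s) powr (b - 1)))) =
       (\<lambda>r. ind t r * ((t - r) powr (a - 1) *
      (ind r s * ((r - s) powr (b - 1) * c))))"
      using True by (auto simp: indicator_def)
    finally show ?thesis using True by (simp add: mult_ac)
  next
    case False
    then have "(\<lambda>r. ind t r * ((t - r) powr (a - 1) *
      (ind r s * ((r - s) powr (b - 1) * c)))) = (\<lambda>r. 0)"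
      by (auto simp: indicator_def)
    moreover have "ind t s = (0::real)" using False by auto
    ultimately show ?thesis by (simp only:) (simp add: has_bochner_integral_zero)
  qed
  have I1: "integrable lborel (\<lambda>s. ind t s * ((t - s) powr (a + b - 1) * f s))"
  proof (rule Bochner_Integration.integrable_bound[OF integrable_mult_right[OF integrable_norm[OF f], of "t powr (a + b - 1)"]])
    show "AE s in lborel. norm (ind t s * ((t - s) powr (a + b - 1) * f s)) \<le> norm (t powr (a + b - 1) * norm (f s))"
      using ab by (auto intro!: AE_I2 powr_mono2 mult_right_mono simp: indicator_def abs_mult)
  qed simp
  have nF: "norm (F s r) = ind t r * ((t - r) powr (a - 1) *
      (ind r s * ((r - s) powr (b - 1) * \<bar>f s\<bar>)))" for s r
    by (simp add: F_def abs_mult)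
  have IF: "integrable (lborel \<Otimes>\<^sub>M lborel) (case_prod F)"
  proof (rule lborel_pair.Fubini_integrable)
    have "(\<lambda>s. LINT r|lborel. norm (case_prod F (s, r))) =
        (\<lambda>s. Beta a b * norm (ind t s * ((t - s) powr (a + b - 1) * f s)))"
      using has_bochner_integral_integral_eq[OF inner] by (simp add: nF[unfolded real_norm_def] abs_mult)
    then show "integrable lborel (\<lambda>s. LINT r|lborel. norm (case_prod F (s, r)))"
      using integrable_norm[OF I1] by simp
    show "AE s in lborel. integrable lborel (\<lambda>r. case_prod F (s, r))"
      using inner by (auto simp: F_def has_bochner_integral_iff)
  qed simp
  have e: "(LINT s|lborel. F s r) = ind t r * ((t - r) powr (a - 1) * RL b f r)" for r
    unfolding F_def RL_def by simp
  have "(LINT r|lborel. (LINT s|lborel. F s r)) = (LINT s|lborel. (LINT r|lborel. F s r))"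
    by (rule lborel_pair.Fubini_integral[OF IF])
  also have "(\<lambda>s. LINT r|lborel. F s r) = (\<lambda>s. Beta a b * (ind t s * ((t - s) powr (a + b - 1) * f s)))"
    using has_bochner_integral_integral_eq[OF inner] by (simp add: F_def)
  finally show "RL a (RL b f) t = Beta a b * RL (a + b) f t"
    unfolding e by (simp add: RL_def)
  show "integrable lborel (\<lambda>r. ind t r * ((t - r) powr (a - 1) * RL b f r))"
    using lborel_pair.integrable_snd[OF IF] unfolding e .
  show "AE r in lborel. r \<in> {0<..<t} \<longrightarrow>
      integrable lborel (\<lambda>s. ind r s * ((r - s) powr (b - 1) * f s))"
    using lborel_pair.AE_integrable_snd[OF IF]
  proof eventually_elim
    case (elim r)
    show ?case
    proof
      assume r: "r \<in> {0<..<t}"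
      have "integrable lborel (\<lambda>s. (1 / (t - r) powr (a - 1)) * F s r)"
        using elim by (rule integrable_mult_right)
      also have "(\<lambda>s. (1 / (t - r) powr (a - 1)) * F s r) =
          (\<lambda>s. ind r s * ((r - s) powr (b - 1) * f s))"
        using r by (auto simp: F_def)
      finally show "integrable lborel (\<lambda>s. ind r s * ((r - s) powr (b - 1) * f s))" .
    qed
  qed
qed

lemma integrable_ind_RL:
  assumes f: "integrable lborel f" and b: "0 < b"
  shows "integrable lborel (\<lambda>r. ind t r * RL b f r)"
proof -
  have "integrable lborel (\<lambda>r. ind t r * ((t - r) powr (1 - 1) * RL b f r))"
    using b by (intro RL_RL(2) f) auto
  also have "(\<lambda>r. ind t r * ((t - r) powr (1 - 1) * RL b f r)) = (\<lambda>r. ind t r * RL b f r)"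
    by (auto simp: indicator_def)
  finally show ?thesis .
qed

lemma has_integral_spike_AE:
  fixes f g :: "real \<Rightarrow> real"
  assumes g: "(g has_integral I) {a..b}" and ae: "AE s in lborel. s \<in> {a<..<b} \<longrightarrow> f s = g s"
  shows "(f has_integral I) {a..b}"
proof -
  obtain N where N: "N \<in> null_sets lborel" "{s. \<not> (s \<in> {a<..<b} \<longrightarrow> f s = g s)} \<subseteq> N"
    using ae unfolding eventually_ae_filter by auto
  then have "negligible N" using negligible_iff_null_sets null_sets_completionI by blast
  then have neg: "negligible (insert a (insert b N))" by simp
  show ?thesis by (rule has_integral_spike[OF neg _ g]) (use N(2) in force)
qed

lemma has_integral_AE_lborel:
  fixes f g :: "real \<Rightarrow> real"
  assumes i: "integrable lborel (\<lambda>s. indicator {a<..<b} s * g s)"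
    and ae: "AE s in lborel. s \<in> {a<..<b} \<longrightarrow> f s = g s"
  shows "(f has_integral (LINT s|lborel. indicator {a<..<b} s * g s)) {a..b}"
proof (rule has_integral_spike_AE[OF _ ae])
  have e: "(\<lambda>s. indicator {a<..<b} s * g s) = (\<lambda>s. if s \<in> {a<..<b} then g s else 0)"
    by (auto simp: indicator_def)
  have "((\<lambda>s. if s \<in> {a<..<b} then g s else 0) has_integral (LINT s|lborel. indicator {a<..<b} s * g s)) UNIV"
    using has_integral_integral_lborel[OF i] unfolding e .
  then show "(g has_integral (LINT s|lborel. indicator {a<..<b} s * g s)) {a..b}"
    by (simp only: has_integral_restrict_UNIV has_integral_Icc_iff_Ioo)
qed

lemma integrable_lborel_Ioo:
  fixes f :: "real \<Rightarrow> real"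
  assumes f: "integrable lborel f"
  shows "integrable lborel (\<lambda>s. indicator {a<..<b} s * f s)"
  using integrable_real_mult_indicator[OF _ f, of "{a<..<b}"] by (simp add: mult.commute)

lemma integrable_bounded_Ioo:
  fixes f :: "real \<Rightarrow> real"
  assumes [measurable]: "f \<in> borel_measurable borel" and b: "\<And>s. s \<in> {a<..<b} \<Longrightarrow> \<bar>f s\<bar> \<le> M"
  shows "integrable lborel (\<lambda>s. indicator {a<..<b} s * f s)"
proof (rule Bochner_Integration.integrable_bound)
  show "integrable lborel (\<lambda>s. M * indicator {a<..<b} s)"
    by (intro integrable_mult_right integrable_real_indicator emeasure_bounded_finite) auto
  show "AE s in lborel. norm (indicator {a<..<b} s * f s) \<le> norm (M * indicator {a<..<b} s)"
    using b by (intro AE_I2) (force simp: indicator_def)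
qed simp

lemma has_bochner_integral_powr_segment:
  fixes p s t :: real
  assumes "0 < s" "s < t" "p \<noteq> 0"
  shows "has_bochner_integral lborel (\<lambda>r. indicator {s<..<t} r * r powr (p - 1)) ((t powr p - s powr p) / p)"
proof (rule has_bochner_integral_of_nonneg_has_integral)
  have "((\<lambda>r. r powr (p - 1)) has_integral t powr p / p - s powr p / p) {s..t}"
    using assms by (intro fundamental_theorem_of_calculus)
      (auto intro!: derivative_eq_intros simp: has_real_derivative_iff_has_vector_derivative[symmetric])
  then show "((\<lambda>r. r powr (p - 1)) has_integral (t powr p - s powr p) / p) {s..t}"
    by (simp add: diff_divide_distrib)
qed auto

lemma RL_1: "RL 1 f t = (LINT s|lborel. ind t s * f s)"
  unfolding RL_def by (intro Bochner_Integration.integral_cong) (auto simp: indicator_def)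

lemma RL_cong:
  assumes "\<And>s. s \<in> {0<..<t} \<Longrightarrow> f s = g s"
  shows "RL a f t = RL a g t"
  unfolding RL_def using assms by (intro Bochner_Integration.integral_cong) (auto simp: indicator_def)

lemma RL_powr:
  assumes "0 < a" "0 < b" "0 < t"
  shows "RL a (\<lambda>s. s powr (b - 1)) t = t powr (a + b - 1) * Beta a b"
    and "integrable lborel (\<lambda>s. ind t s * ((t - s) powr (a - 1) * s powr (b - 1)))"
  using has_bochner_integral_Beta_segment[OF assms] by (auto simp: RL_def has_bochner_integral_iff)

text \<open>Integration by parts for the integral of r^p dF with F = \<open>RL 1 f\<close>.
  Inserting t^p - s^p = p times the integral of r^(p-1) over (s,t) and applying Fubini avoids the
  boundary term at 0, which for p < 0 would be a limit of r^p F(r).\<close>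

lemma powr_by_parts:
  fixes p t :: real
  assumes p: "p \<noteq> 0" and f: "integrable lborel f"
    and fp: "integrable lborel (\<lambda>s. ind t s * (s powr p * f s))"
  shows "integrable lborel (\<lambda>r. ind t r * (r powr (p - 1) * RL 1 f r))"
    and "t powr p * RL 1 f t - p * moment (p - 1) (RL 1 f) t
      = (LINT r|lborel. ind t r * (r powr p * f r))"
proof -
  have [measurable]: "f \<in> borel_measurable borel" using f by auto
  define F where "F s r = ind t r * (r powr (p - 1) * (ind r s * f s))" for s r
  have [measurable]: "case_prod F \<in> borel_measurable (lborel \<Otimes>\<^sub>M lborel)"
    unfolding F_def[abs_def] indicator_triangle by measurable
  have inner: "has_bochner_integral lborel (\<lambda>r. ind t r * (r powr (p - 1) *
      (ind r s * c))) (ind t s * (t powr p - s powr p) / p * c)" for s c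
  proof (cases "0 < s \<and> s < t")
    case True
    have "has_bochner_integral lborel (\<lambda>r. c * (indicator {s<..<t} r * r powr (p - 1)))
         (c * ((t powr p - s powr p) / p))"
      using True p by (intro has_bochner_integral_mult_right has_bochner_integral_powr_segment) auto
    also have "(\<lambda>r. c * (indicator {s<..<t} r * r powr (p - 1))) =
       (\<lambda>r. ind t r * (r powr (p - 1) * (ind r s * c)))"
      using True by (auto simp: indicator_def)
    finally show ?thesis using True by (simp add: mult_ac)
  next
    case False
    then have "(\<lambda>r. ind t r * (r powr (p - 1) * (ind r s * c))) = (\<lambda>r. 0)"
      by (auto simp: indicator_def)
    moreover have "ind t s = (0::real)" using False by auto
    ultimately show ?thesis by (simp only:) (simp add: has_bochner_integral_zero)
  qed
  have fs: "integrable lborel (\<lambda>s. ind t s * (t powr p - s powr p) / p * f s)"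
  proof -
    have "integrable lborel (\<lambda>s. t powr p / p * (ind t s * f s)
        - (ind t s * (s powr p * f s)) / p)"
      using integrable_lborel_Ioo[OF f] fp by auto
    also have "(\<lambda>s. t powr p / p * (ind t s * f s)
        - (ind t s * (s powr p * f s)) / p) =
        (\<lambda>s. ind t s * (t powr p - s powr p) / p * f s)"
      by (auto simp: field_simps diff_divide_distrib)
    finally show ?thesis .
  qed
  \<comment> \<open>The sign is the same for increasing and decreasing powers, so the iterated
    integral of the absolute values is again given by \<open>inner\<close>.\<close>
  have mono: "0 \<le> ind t s * (t powr p - s powr p) / p" for s
  proof (cases "p > 0")
    case True then show ?thesis by (auto simp: indicator_def intro!: divide_nonneg_nonneg powr_mono2)
  next
    case False then show ?thesis
      using p by (auto simp: indicator_def intro!: divide_nonpos_nonpos powr_mono2')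
  qed
  have nF: "norm (F s r) = ind t r * (r powr (p - 1) * (ind r s * \<bar>f s\<bar>))" for s r
    by (simp add: F_def abs_mult)
  have IF: "integrable (lborel \<Otimes>\<^sub>M lborel) (case_prod F)"
  proof (rule lborel_pair.Fubini_integrable)
    have "(LINT r|lborel. norm (case_prod F (s, r))) = norm (ind t s * (t powr p - s powr p) / p * f s)" for s
      using has_bochner_integral_integral_eq[OF inner[of s "\<bar>f s\<bar>"]] mono[of s]
      by (simp only: nF[unfolded real_norm_def] case_prod_conv real_norm_def abs_mult[of _ "f s"] abs_of_nonneg)
    then show "integrable lborel (\<lambda>s. LINT r|lborel. norm (case_prod F (s, r)))"
      using integrable_norm[OF fs] by simp
    show "AE s in lborel. integrable lborel (\<lambda>r. case_prod F (s, r))"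
      using inner by (auto simp: F_def has_bochner_integral_iff)
  qed simp
  have e: "(LINT s|lborel. F s r) = ind t r * (r powr (p - 1) * RL 1 f r)" for r
    unfolding F_def RL_1 by simp
  show "integrable lborel (\<lambda>r. ind t r * (r powr (p - 1) * RL 1 f r))"
    using lborel_pair.integrable_snd[OF IF] unfolding e .
  have "(LINT r|lborel. (LINT s|lborel. F s r)) = (LINT s|lborel. (LINT r|lborel. F s r))"
    by (rule lborel_pair.Fubini_integral[OF IF])
  also have "(\<lambda>s. LINT r|lborel. F s r) = (\<lambda>s. ind t s * (t powr p - s powr p) / p * f s)"
    using has_bochner_integral_integral_eq[OF inner] by (simp add: F_def)
  finally have "p * moment (p - 1) (RL 1 f) t =
     (LINT s|lborel. p * (ind t s * (t powr p - s powr p) / p * f s))"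
    unfolding e by (simp only: Bochner_Integration.integral_mult_right_zero)
  also have "\<dots> = (LINT s|lborel. t powr p * (ind t s * f s) - ind t s * (s powr p * f s))"
    using p by (intro Bochner_Integration.integral_cong) (auto simp: field_simps)
  also have "\<dots> = t powr p * RL 1 f t - (LINT r|lborel. ind t r * (r powr p * f r))"
    using integrable_lborel_Ioo[OF f] fp by (simp add: RL_1)
  finally show "t powr p * RL 1 f t - p * moment (p - 1) (RL 1 f) t
      = (LINT r|lborel. ind t r * (r powr p * f r))" by simp
qed

section \<open>Square integrable functions and weighted Cauchy-Schwarz estimates\<close>

text \<open>Borel measurability is preserved in product spaces, as Fubini requires. Vanishing off
  the open interval allows integrals over the whole line and keeps the end points, where the weights
  are singular, out of play.\<close>

definition sq_int :: "real \<Rightarrow> (real \<Rightarrow> real) \<Rightarrow> bool" where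
  "sq_int T u \<longleftrightarrow> u \<in> borel_measurable borel \<and> integrable lborel (\<lambda>x. (u x)^2) \<and> (\<forall>x. x \<notin> {0<..<T} \<longrightarrow> u x = 0)"

definition l2 :: "(real \<Rightarrow> real) \<Rightarrow> real" where
  "l2 u = sqrt (LINT x|lborel. (u x)^2)"

lemma l2_nonneg: "0 \<le> l2 u" by (simp add: l2_def)

text \<open>Cauchy-Schwarz against the kernel (t - s)^p s^q. Its square is integrable because both
  exponents exceed -1/2, and the integral of the square is a Beta integral, which fixes the
  constant.\<close>

lemma powr_weighted_l2_bound:
  fixes p q t :: real
  assumes p: "- 1/2 < p" and q: "- 1/2 < q" and t: "0 < t"
    and [measurable]: "u \<in> borel_measurable borel" and u: "integrable lborel (\<lambda>x. (u x)^2)"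
  shows "integrable lborel (\<lambda>s. ind t s * ((t - s) powr p * (s powr q * u s)))"
    and "(LINT s|lborel. ind t s * ((t - s) powr p * (s powr q * \<bar>u s\<bar>)))
      \<le> sqrt (Beta (2 * p + 1) (2 * q + 1)) * t powr (p + q + 1/2) * l2 u"
    and "\<bar>LINT s|lborel. ind t s * ((t - s) powr p * (s powr q * u s))\<bar>
      \<le> sqrt (Beta (2 * p + 1) (2 * q + 1)) * t powr (p + q + 1/2) * l2 u"
proof -
  define k where "k s = ind t s * ((t - s) powr p * s powr q)" for s
  have [measurable]: "k \<in> borel_measurable borel" unfolding k_def[abs_def] by measurable
  have k2: "(k s)^2 = ind t s * ((t - s) powr (2 * p) * s powr (2 * q))" for s
    by (cases "s \<in> {0<..<t}") (auto simp: k_def power_mult_distrib powr_power mult.commute)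
  have "has_bochner_integral lborel (\<lambda>s. (k s)^2) (t powr (2 * p + 2 * q + 1) * Beta (2 * p + 1) (2 * q + 1))"
    using has_bochner_integral_Beta_segment[of "2 * p + 1" "2 * q + 1" 0 t] p q t
    unfolding k2 by (simp add: add_ac)
  then have ik: "integrable lborel (\<lambda>s. (k s)^2)"
    and vk: "(LINT s|lborel. (k s)^2) = t powr (2 * p + 2 * q + 1) * Beta (2 * p + 1) (2 * q + 1)"
    by (auto simp: has_bochner_integral_iff)
  have "sqrt (t powr (2 * p + 2 * q + 1)) = t powr (p + q + 1/2)"
    using t by (subst powr_half_sqrt[symmetric]) (auto simp: powr_powr field_simps)
  then have sk: "sqrt (LINT s|lborel. (k s)^2) * sqrt (LINT s|lborel. (u s)^2) =
     sqrt (Beta (2 * p + 1) (2 * q + 1)) * t powr (p + q + 1/2) * l2 u"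
    by (simp add: vk real_sqrt_mult l2_def)
  note CS = Cauchy_Schwarz_lborel[of k u, OF _ _ ik u, unfolded sk, simplified]
  have e: "k s * x = ind t s * ((t - s) powr p * (s powr q * x))" for s x
    by (simp add: k_def)
  show "integrable lborel (\<lambda>s. ind t s * ((t - s) powr p * (s powr q * u s)))"
    using CS(1) by (simp add: e)
  have "\<bar>k s * u s\<bar> = k s * \<bar>u s\<bar>" for s by (auto simp: k_def abs_mult)
  then show "(LINT s|lborel. ind t s * ((t - s) powr p * (s powr q * \<bar>u s\<bar>)))
      \<le> sqrt (Beta (2 * p + 1) (2 * q + 1)) * t powr (p + q + 1/2) * l2 u"
    using Cauchy_Schwarz_lborel(2)[of k u, OF _ _ ik u, unfolded sk] by (simp add: e)
  show "\<bar>LINT s|lborel. ind t s * ((t - s) powr p * (s powr q * u s))\<bar>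
      \<le> sqrt (Beta (2 * p + 1) (2 * q + 1)) * t powr (p + q + 1/2) * l2 u"
    using Cauchy_Schwarz_lborel(3)[of k u, OF _ _ ik u, unfolded sk] by (simp add: e)
qed

lemma sq_intD:
  assumes "sq_int T u"
  shows "u \<in> borel_measurable borel" "integrable lborel (\<lambda>x. (u x)^2)" "\<And>x. x \<notin> {0<..<T} \<Longrightarrow> u x = 0"
  using assms by (auto simp: sq_int_def)

lemma sq_int_powr_integrable:
  assumes u: "sq_int T u" and q: "- 1/2 < q"
  shows "integrable lborel (\<lambda>s. s powr q * u s)"
proof (cases "0 < T")
  case True
  note [measurable] = sq_intD(1)[OF u]
  have "integrable lborel (\<lambda>s. ind T s * ((T - s) powr 0 * (s powr q * u s)))"
    by (rule powr_weighted_l2_bound(1)[OF _ q True _ sq_intD(2)[OF u]]) auto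
  also have "(\<lambda>s. ind T s * ((T - s) powr 0 * (s powr q * u s))) = (\<lambda>s. s powr q * u s)"
    using sq_intD(3)[OF u] by (auto simp: indicator_def fun_eq_iff)
  finally show ?thesis .
next
  case False
  then show ?thesis using sq_intD(3)[OF u] by auto
qed

lemma sq_int_integrable: 
  assumes u: "sq_int T u"
  shows "integrable lborel u"
proof -
  have "integrable lborel (\<lambda>s. s powr 0 * u s)" using u by (rule sq_int_powr_integrable) simp
  also have "(\<lambda>s. s powr 0 * u s) = u" using sq_intD(3)[OF u] by (auto simp: powr_def)
  finally show ?thesis .
qed

lemma RL_1_eq_integral:
  assumes "integrable lborel f" "0 \<le> t"
  shows "(f has_integral RL 1 f t) {0..t}" "RL 1 f t = integral {0..t} f" "f integrable_on {0..t}"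
proof -
  show "(f has_integral RL 1 f t) {0..t}"
    unfolding RL_1 using assms by (intro has_integral_AE_lborel integrable_lborel_Ioo) auto
  then show "RL 1 f t = integral {0..t} f" "f integrable_on {0..t}" by (auto simp: integral_unique)
qed

lemma continuous_on_RL_1:
  assumes "integrable lborel f"
  shows "continuous_on {0..T} (RL 1 f)"
proof (cases "0 \<le> T")
  case True
  have "continuous_on {0..T} (\<lambda>t. integral {0..t} f)"
    using RL_1_eq_integral(3)[OF assms True] by (rule indefinite_integral_continuous_1)
  then show ?thesis
    using RL_1_eq_integral(2)[OF assms] by (auto elim!: continuous_on_eq)
qed auto

text \<open>The kernel \<open>x \<mapsto> x\<^sup>a\<^sup>-\<^sup>1\<close> is decreasing, so its increments satisfy \<open>(\<Delta>k)\<^sup>2 \<le> \<bar>\<Delta>(k\<^sup>2)\<bar>\<close>; integrating the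
  right-hand side gives an explicit modulus of continuity.\<close>

lemma RL_Hoelder:
  assumes a: "1/2 < a" "a \<le> 1" and t: "0 \<le> t" "t < t'"
    and [measurable]: "f \<in> borel_measurable borel" and f: "integrable lborel (\<lambda>x. (f x)^2)"
  shows "\<bar>RL a f t' - RL a f t\<bar> \<le> sqrt (2 * ((t' - t) powr (2 * a - 1) * Beta (2 * a - 1) 1)) * l2 f"
proof -
  define m where "m = 2 * a - 1"
  have m: "0 < m" "m \<le> 1" using a by (auto simp: m_def)
  define k where "k t s = ind t s * (t - s) powr (a - 1)" for t s :: real
  have [measurable]: "k t \<in> borel_measurable borel" for t unfolding k_def[abs_def] by measurable
  have k2: "(k t s)^2 = ind t s * (t - s) powr (m - 1)" for t s
    by (cases "s \<in> {0<..<t}") (auto simp: k_def powr_power m_def algebra_simps)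
  have seg: "has_bochner_integral lborel (\<lambda>s. indicator {x<..<y} s * (y - s) powr (m - 1))
     ((y - x) powr m * Beta m 1)" if "x < y" for x y
  proof -
    have "has_bochner_integral lborel (\<lambda>s. indicator {x<..<y} s * ((y - s) powr (m - 1) * (s - x) powr (1 - 1)))
     ((y - x) powr (m + 1 - 1) * Beta m 1)"
      using m that by (intro has_bochner_integral_Beta_segment) auto
    also have "(\<lambda>s. indicator {x<..<y} s * ((y - s) powr (m - 1) * (s - x) powr (1 - 1))) =
       (\<lambda>s. indicator {x<..<y} s * (y - s) powr (m - 1))" by (auto simp: indicator_def)
    finally show ?thesis by simp
  qed
  have bk: "has_bochner_integral lborel (\<lambda>s. (k y s)^2) (y powr m * Beta m 1)" if "0 \<le> y" for y
    using seg[of 0 y] that unfolding k2 by (cases "y = 0") (auto simp: has_bochner_integral_zero)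
  \<comment> \<open>On (0,t) monotonicity of the kernel gives the difference of squares as a
    majorant. On (t,t') the required majorant is the square of \<open>k t'\<close>, which enters
    \<open>B\<close> with a minus sign; adding it twice corrects this.\<close>
  define B where "B s = (k t s)^2 - (k t' s)^2 + 2 * (indicator {t<..<t'} s * (t' - s) powr (m - 1))" for s
  have hB: "has_bochner_integral lborel B (t powr m * Beta m 1 - t' powr m * Beta m 1 + 2 * ((t' - t) powr m * Beta m 1))"
    unfolding B_def[abs_def] using t
    by (intro has_bochner_integral_add has_bochner_integral_diff bk seg has_bochner_integral_mult_right) auto
  have le: "AE s in lborel. (k t' s - k t s)^2 \<le> B s"
    using AE_lborel_singleton[of t]
  proof eventually_elim
    case (elim s)
    consider "s \<in> {0<..<t}" | "s \<in> {t<..<t'}" | "s \<notin> {0<..<t'}" using elim t by force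
    then show ?case
    proof cases
      case 1
      then have "k t' s = (t' - s) powr (a - 1)" "k t s = (t - s) powr (a - 1)"
        using t by (auto simp: k_def)
      moreover have "(t' - s) powr (a - 1) \<le> (t - s) powr (a - 1)"
        using 1 t a by (intro powr_mono2') auto
      ultimately have "0 \<le> k t' s" "k t' s \<le> k t s" by auto
      then have "(k t' s - k t s)^2 \<le> (k t s)^2 - (k t' s)^2"
        using mult_nonneg_nonneg[of "k t' s" "k t s - k t' s"]
        by (simp add: power2_eq_square algebra_simps)
      then show ?thesis using 1 by (simp add: B_def)
    next
      case 2
      then have "k t s = 0" "(k t' s)^2 = (t' - s) powr (m - 1)" using t unfolding k2 by (auto simp: k_def)
      then show ?thesis using 2 by (simp add: B_def)
    next
      case 3
      then show ?thesis using t by (auto simp: B_def k_def indicator_def)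
    qed
  qed
  have ikk: "integrable lborel (\<lambda>s. (k t' s - k t s)^2)"
  proof (rule Bochner_Integration.integrable_bound)
    show "integrable lborel B" using hB by (simp add: has_bochner_integral_iff)
    show "AE s in lborel. norm ((k t' s - k t s)^2) \<le> norm (B s)"
      using le by eventually_elim (smt (verit) real_norm_def zero_le_power2)
  qed simp
  have "(LINT s|lborel. (k t' s - k t s)^2) \<le> (LINT s|lborel. B s)"
    using hB le ikk by (intro integral_mono_AE) (auto simp: has_bochner_integral_iff)
  also have "\<dots> = t powr m * Beta m 1 - t' powr m * Beta m 1 + 2 * ((t' - t) powr m * Beta m 1)"
    using hB by (simp add: has_bochner_integral_iff)
  also have "\<dots> \<le> 2 * ((t' - t) powr m * Beta m 1)"
  proof -
    have "t powr m \<le> t' powr m" using t m by (intro powr_mono2) auto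
    moreover have "0 \<le> Beta m 1" using m by (simp add: Beta_def)
    ultimately have "t powr m * Beta m 1 \<le> t' powr m * Beta m 1" by (rule mult_right_mono)
    then show ?thesis by linarith
  qed
  finally have n: "(LINT s|lborel. (k t' s - k t s)^2) \<le> 2 * ((t' - t) powr m * Beta m 1)" .
  have ik: "integrable lborel (\<lambda>s. k y s * f s)" if "0 \<le> y" for y
    using bk[OF that] f by (intro Cauchy_Schwarz_lborel(1)) (auto simp: has_bochner_integral_iff)
  have "RL a f t' - RL a f t = (LINT s|lborel. k t' s * f s) - (LINT s|lborel. k t s * f s)"
    unfolding RL_def k_def by (simp add: mult.assoc)
  also have "\<dots> = (LINT s|lborel. (k t' s - k t s) * f s)"
    using ik[of t] ik[of t'] t by (simp add: left_diff_distrib)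
  finally have "\<bar>RL a f t' - RL a f t\<bar> \<le> sqrt (LINT s|lborel. (k t' s - k t s)^2) * l2 f"
    using Cauchy_Schwarz_lborel(3)[OF _ _ ikk f] by (simp add: l2_def)
  also have "\<dots> \<le> sqrt (2 * ((t' - t) powr m * Beta m 1)) * l2 f"
    using n by (intro mult_right_mono real_sqrt_le_mono l2_nonneg)
  finally show ?thesis by (simp add: m_def)
qed

lemma continuous_on_RL_L2:
  assumes a: "1/2 < a" "a \<le> 1"
    and f: "f \<in> borel_measurable borel" "integrable lborel (\<lambda>x. (f x)^2)"
  shows "continuous_on {0..} (RL a f)"
proof (rule continuous_onI)
  define h where "h d = sqrt (2 * (d powr (2 * a - 1) * Beta (2 * a - 1) 1)) * l2 f" for d
  have b: "dist (RL a f s) (RL a f t) \<le> h (dist s t)" if "0 \<le> s" "0 \<le> t" for s t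
  proof (cases s t rule: linorder_cases)
    case less then show ?thesis using RL_Hoelder[OF a that(1) less f] by (simp add: h_def dist_real_def abs_minus_commute)
  next
    case equal then show ?thesis by (simp add: h_def l2_nonneg)
  next
    case greater then show ?thesis using RL_Hoelder[OF a that(2) greater f] by (simp add: h_def dist_real_def)
  qed
  have "((\<lambda>d. d powr (2 * a - 1)) \<longlongrightarrow> 0) (at_right 0)"
    using a by (auto intro!: tendsto_eq_intros eventually_mono[OF eventually_at_right_less])
  then have "(h \<longlongrightarrow> sqrt (2 * (0 * Beta (2 * a - 1) 1)) * l2 f) (at_right 0)"
    unfolding h_def by (intro tendsto_intros)
  then have h0: "(h \<longlongrightarrow> 0) (at_right 0)" by simp
  fix t e :: real assume t: "t \<in> {0..}" and e: "0 < e"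
  have "eventually (\<lambda>d. h d < e) (at_right 0)" using order_tendstoD(2)[OF h0 e] .
  then obtain c where c: "c > 0" "\<And>d. 0 < d \<Longrightarrow> d < c \<Longrightarrow> h d < e"
    by (auto simp: eventually_at_right_field)
  have "dist (RL a f s) (RL a f t) \<le> e" if "s \<in> {0..}" "dist s t < c" for s
  proof (cases "s = t")
    case False
    then show ?thesis using b[of s t] c(2)[of "dist s t"] that t by auto
  qed (use e in auto)
  then show "\<exists>d>0. \<forall>s\<in>{0..}. dist s t < d \<longrightarrow> dist (RL a f s) (RL a f t) \<le> e" using c by auto
qed

section \<open>The Volterra operator with the fractional kernel\<close>

text \<open>With \<open>al = H - 1/2\<close>, Fubini's theorem writes \<open>K\<^sub>H u\<close> as \<open>c\<^sub>H\<close> times \<open>kop al u\<close>, see \<open>kernel_has_integral\<close>.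
  Formally \<open>kop al u = \<integral> r powr al dG(r)\<close> with \<open>G = Gop al u\<close>, which treats all \<open>H\<close> at once.\<close>

definition Gop :: "real \<Rightarrow> (real \<Rightarrow> real) \<Rightarrow> real \<Rightarrow> real" where
  "Gop al u = RL (1 + al) (\<lambda>s. s powr (- al) * u s)"

definition kop :: "real \<Rightarrow> (real \<Rightarrow> real) \<Rightarrow> real \<Rightarrow> real" where
  "kop al u t = t powr al * Gop al u t
     - al * moment (al - 1) (Gop al u) t"

text \<open>The L2 norm of (1 - s)^al s^(-al) on (0,1), that is, of the kernel of \<open>Gop\<close>
  at t = 1. By scaling, the norm at t is this number times sqrt t.\<close>

definition gconst :: "real \<Rightarrow> real" where
  "gconst al = sqrt (Beta (2 * al + 1) (1 - 2 * al))"

lemma Gop_measurable [measurable]: "u \<in> borel_measurable borel \<Longrightarrow> Gop al u \<in> borel_measurable borel"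
  unfolding Gop_def by measurable

lemma Gop_0: "Gop al u 0 = 0" by (simp add: Gop_def RL_def)

lemma kop_0: "kop al u 0 = 0" by (simp add: kop_def)

lemma gconst_nonneg: "\<bar>al\<bar> < 1/2 \<Longrightarrow> 0 \<le> gconst al"
  by (simp add: gconst_def Beta_def)

text \<open>The factor sqrt t matters: it reduces the weight r^(al-1) in \<open>kop\<close> to
  r^(al-1/2), which is integrable at 0 because al > -1/2. The version for absolute values supplies
  the hypothesis of Fubini's theorem in \<open>kernel_has_integral\<close>.\<close>

lemma Gop_bound:
  assumes al: "\<bar>al\<bar> < 1/2" and u: "sq_int T u" and t: "0 \<le> t"
  shows "\<bar>Gop al u t\<bar> \<le> gconst al * t powr (1/2) * l2 u"
    and "Gop al (\<lambda>x. \<bar>u x\<bar>) t \<le> gconst al * t powr (1/2) * l2 u"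
proof -
  have "\<bar>Gop al u t\<bar> \<le> gconst al * t powr (1/2) * l2 u \<and>
     Gop al (\<lambda>x. \<bar>u x\<bar>) t \<le> gconst al * t powr (1/2) * l2 u"
  proof (cases "t = 0")
    case False
    then show ?thesis
      using powr_weighted_l2_bound(2,3)[of al "- al" t u] al sq_intD(1,2)[OF u] t
      by (simp add: Gop_def RL_def gconst_def add.commute)
  qed (simp add: Gop_0)
  then show "\<bar>Gop al u t\<bar> \<le> gconst al * t powr (1/2) * l2 u"
    "Gop al (\<lambda>x. \<bar>u x\<bar>) t \<le> gconst al * t powr (1/2) * l2 u" by auto
qed

lemma Gop_weighted:
  assumes al: "\<bar>al\<bar> < 1/2" and u: "sq_int T u" and t: "0 < t"
  shows "integrable lborel (\<lambda>r. ind t r * (r powr (al - 1) * Gop al u r))"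
    and "integrable lborel (\<lambda>r. ind t r * (r powr (al - 1) * Gop al (\<lambda>x. \<bar>u x\<bar>) r))"
    and "\<bar>LINT r|lborel. ind t r * (r powr (al - 1) * Gop al u r)\<bar>
      \<le> gconst al * l2 u * (t powr (al + 1/2) * Beta 1 (al + 1/2))"
proof -
  note [measurable] = sq_intD(1)[OF u]
  have p: "integrable lborel (\<lambda>r. ind t r * r powr (al - 1/2))"
    "(LINT r|lborel. ind t r * r powr (al - 1/2)) = t powr (al + 1/2) * Beta 1 (al + 1/2)"
  proof -
    have "(\<lambda>r. ind t r * ((t - r) powr (1 - 1) * r powr (al + 1/2 - 1))) =
      (\<lambda>r. ind t r * r powr (al - 1/2))" by (auto simp: indicator_def)
    then show "integrable lborel (\<lambda>r. ind t r * r powr (al - 1/2))"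
      using RL_powr(2)[of 1 "al + 1/2" t] al t by (simp only:)
    show "(LINT r|lborel. ind t r * r powr (al - 1/2)) = t powr (al + 1/2) * Beta 1 (al + 1/2)"
      using RL_powr(1)[of 1 "al + 1/2" t] al t by (simp add: RL_1 add.commute)
  qed
  define C where "C = gconst al * l2 u"
  have C: "0 \<le> C" unfolding C_def using gconst_nonneg[OF al] l2_nonneg by simp
  have le: "norm (ind t r * (r powr (al - 1) * g)) \<le> C * (ind t r * r powr (al - 1/2))"
    if "\<bar>g\<bar> \<le> gconst al * r powr (1/2) * l2 u" for g r
  proof (cases "r \<in> {0<..<t}")
    case True
    have "r powr (al - 1) * \<bar>g\<bar> \<le> r powr (al - 1) * (gconst al * r powr (1/2) * l2 u)"
      using that by (intro mult_left_mono) auto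
    also have "\<dots> = C * (r powr (al - 1) * r powr (1/2))" by (simp add: C_def)
    also have "r powr (al - 1) * r powr (1/2) = r powr (al - 1/2)"
      by (simp add: powr_add[symmetric])
    finally show ?thesis using True by (simp add: abs_mult)
  qed simp
  have 0: "0 \<le> Gop al (\<lambda>x. \<bar>u x\<bar>) r" for r
    unfolding Gop_def RL_def by (intro Bochner_Integration.integral_nonneg) (auto simp: indicator_def)
  have int: "integrable lborel (\<lambda>r. ind t r * (r powr (al - 1) * G r))"
    if [measurable]: "G \<in> borel_measurable borel" and b: "\<And>r. 0 \<le> r \<Longrightarrow> \<bar>G r\<bar> \<le> gconst al * r powr (1/2) * l2 u" for G
  proof (rule Bochner_Integration.integrable_bound[OF integrable_mult_right[OF p(1), of C]])
    show "AE r in lborel. norm (ind t r * (r powr (al - 1) * G r)) \<le> norm (C * (ind t r * r powr (al - 1/2)))"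
    proof (rule AE_I2)
      fix r show "norm (ind t r * (r powr (al - 1) * G r)) \<le> norm (C * (ind t r * r powr (al - 1/2)))"
        using le[of "G r" r] b[of r] by (cases "0 \<le> r") auto
    qed
  qed simp
  show i: "integrable lborel (\<lambda>r. ind t r * (r powr (al - 1) * Gop al u r))"
    by (rule int) (use Gop_bound(1)[OF al u] in simp_all)
  show "integrable lborel (\<lambda>r. ind t r * (r powr (al - 1) * Gop al (\<lambda>x. \<bar>u x\<bar>) r))"
    by (rule int) (use Gop_bound(2)[OF al u] 0 in simp_all)
  have "\<bar>LINT r|lborel. ind t r * (r powr (al - 1) * Gop al u r)\<bar>
      \<le> (LINT r|lborel. C * (ind t r * r powr (al - 1/2)))"
  proof (rule integral_abs_bound_integral[OF i integrable_mult_right[OF p(1)]])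
    fix r show "\<bar>ind t r * (r powr (al - 1) * Gop al u r)\<bar> \<le> C * (ind t r * r powr (al - 1/2))"
      using le[of "Gop al u r" r] Gop_bound(1)[OF al u, of r] C by (cases "0 \<le> r") auto
  qed
  then show "\<bar>LINT r|lborel. ind t r * (r powr (al - 1) * Gop al u r)\<bar>
      \<le> gconst al * l2 u * (t powr (al + 1/2) * Beta 1 (al + 1/2))" by (simp add: p(2) C_def)
qed

lemma kop_bound:
  assumes al: "\<bar>al\<bar> < 1/2" and T: "0 < T"
  obtains C where "0 \<le> C" "\<And>u t. sq_int T u \<Longrightarrow> t \<in> {0..T} \<Longrightarrow> \<bar>kop al u t\<bar> \<le> C * l2 u"
proof
  \<comment> \<open>Both terms of \<open>kop\<close> scale like t^(al+1/2), which increases with t,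
    so T is the worst case. The number \<open>Beta 1 (al + 1/2)\<close> is the integral of
    r^(al-1/2) over (0,1).\<close>
  define C where "C = gconst al * (T powr (al + 1/2) * (1 + \<bar>al\<bar> * Beta 1 (al + 1/2)))"
  have b: "0 \<le> Beta 1 (al + 1/2)" using al by (simp add: Beta_def)
  show C: "0 \<le> C" unfolding C_def using gconst_nonneg[OF al] b by simp
  fix u t assume u: "sq_int T u" and t: "t \<in> {0..T}"
  show "\<bar>kop al u t\<bar> \<le> C * l2 u"
  proof (cases "t = 0")
    case False
    then have t: "0 < t" "t \<le> T" using t by auto
    have "\<bar>kop al u t\<bar> \<le> \<bar>t powr al * Gop al u t\<bar>
        + \<bar>al * moment (al - 1) (Gop al u) t\<bar>"
      unfolding kop_def by (rule abs_triangle_ineq4)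
    also have "\<bar>t powr al * Gop al u t\<bar> \<le> t powr al * (gconst al * t powr (1/2) * l2 u)"
      using Gop_bound(1)[OF al u, of t] t by (auto simp: abs_mult intro!: mult_left_mono)
    also have "\<dots> = gconst al * (t powr (al + 1/2) * 1) * l2 u" by (simp add: powr_add)
    also have "\<bar>al * moment (al - 1) (Gop al u) t\<bar>
       \<le> \<bar>al\<bar> * (gconst al * l2 u * (t powr (al + 1/2) * Beta 1 (al + 1/2)))"
      unfolding abs_mult using Gop_weighted(3)[OF al u t(1)] by (intro mult_left_mono) auto
    also have "gconst al * (t powr (al + 1/2) * 1) * l2 u
        + \<bar>al\<bar> * (gconst al * l2 u * (t powr (al + 1/2) * Beta 1 (al + 1/2)))
       = (gconst al * (t powr (al + 1/2) * (1 + \<bar>al\<bar> * Beta 1 (al + 1/2)))) * l2 u"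
      by (simp add: algebra_simps)
    also have "\<dots> \<le> C * l2 u"
    proof -
      have "t powr (al + 1/2) \<le> T powr (al + 1/2)" using t al by (intro powr_mono2) auto
      then show ?thesis unfolding C_def using b gconst_nonneg[OF al]
        by (intro mult_right_mono mult_left_mono l2_nonneg) auto
    qed
    finally show ?thesis by simp
  qed (use C l2_nonneg in \<open>simp add: kop_0\<close>)
qed

lemma kernel_eq_LINT:
  assumes s: "0 < s" "s < t" and i: "integrable lborel (\<lambda>r. indicator {s<..<t} r * (r powr (al - 1) * (r - s) powr al))"
  shows "kernel (al + 1/2) t s = c_const (al + 1/2) * (t powr al * s powr (- al) * (t - s) powr al
    - al * s powr (- al) * (LINT r|lborel. indicator {s<..<t} r * (r powr (al - 1) * (r - s) powr al)))"
proof -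
  have e: "al + 1/2 - 1/2 = al" "1/2 - (al + 1/2) = - al" "al + 1/2 - 3/2 = al - 1" by auto
  have "((\<lambda>r. r powr (al - 1) * (r - s) powr al) has_integral
     (LINT r|lborel. indicator {s<..<t} r * (r powr (al - 1) * (r - s) powr al))) {s..t}"
    using i by (rule has_integral_AE_lborel) auto
  then have I: "integral {s..t} (\<lambda>r. r powr (al - 1) * (r - s) powr al) =
     (LINT r|lborel. indicator {s<..<t} r * (r powr (al - 1) * (r - s) powr al))"
    by (rule integral_unique)
  show ?thesis
    unfolding kernel_def e I using s by (simp add: powr_divide powr_minus field_simps)
qed

lemma kernel_has_integral:
  assumes al: "\<bar>al\<bar> < 1/2" and u: "sq_int T u" and t: "0 < t"
  shows "((\<lambda>s. kernel (al + 1/2) t s * u s) has_integral (c_const (al + 1/2) * kop al u t)) {0..t}"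
proof -
  note [measurable] = sq_intD(1)[OF u]
  define F where "F r s = ind t r * (r powr (al - 1) *
      (ind r s * ((r - s) powr (1 + al - 1) * (s powr (- al) * u s))))" for r s
  have [measurable]: "case_prod F \<in> borel_measurable (lborel \<Otimes>\<^sub>M lborel)"
    unfolding F_def[abs_def] indicator_triangle by measurable
  have nF: "\<bar>F r s\<bar> = ind t r * (r powr (al - 1) *
      (ind r s * ((r - s) powr (1 + al - 1) * (s powr (- al) * \<bar>u s\<bar>))))" for r s
    by (simp add: F_def abs_mult)
  have inner: "integrable lborel (\<lambda>s. ind r s * ((r - s) powr (1 + al - 1) * (s powr (- al) * u s)))" for r
  proof (cases "0 < r")
    case True then show ?thesis
      using powr_weighted_l2_bound(1)[of al "- al" r u] al sq_intD(1,2)[OF u] by simp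
  qed auto
  \<comment> \<open>Integrating the absolute value of \<open>F\<close> over s first produces
    \<open>Gop\<close> of the absolute value of \<open>u\<close>, whose weighted integral is already
    known to be finite.\<close>
  have IF: "integrable (lborel \<Otimes>\<^sub>M lborel) (case_prod F)"
  proof (rule lborel_pair.Fubini_integrable)
    show "integrable lborel (\<lambda>r. LINT s|lborel. norm (case_prod F (r, s)))"
      using Gop_weighted(2)[OF al u t] by (simp add: nF Gop_def RL_def)
    show "AE r in lborel. integrable lborel (\<lambda>s. case_prod F (r, s))"
      using inner by (simp add: F_def)
  qed simp
  have "(LINT s|lborel. (LINT r|lborel. F r s)) = (LINT r|lborel. (LINT s|lborel. F r s))"
    by (rule lborel_pair.Fubini_integral[OF IF])
  also have "\<dots> = moment (al - 1) (Gop al u) t"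
    by (simp add: F_def Gop_def RL_def)
  finally have FG: "(LINT s|lborel. (LINT r|lborel. F r s)) = \<dots>" .
  define g where "g s = c_const (al + 1/2) * (t powr al * ((t - s) powr al * (s powr (- al) * u s)) - al * (LINT r|lborel. F r s))" for s
  have z: "ind t s * (LINT r|lborel. F r s) = (LINT r|lborel. F r s)" for s
  proof (cases "s \<in> {0<..<t}")
    case False
    then have "F r s = 0" for r by (auto simp: F_def indicator_def)
    then show ?thesis by simp
  qed simp
  have ge: "ind t s * g s = c_const (al + 1/2) * (t powr al * (ind t s * ((t - s) powr (1 + al - 1) * (s powr (- al) * u s))) - al * (LINT r|lborel. F r s))" for s
    unfolding g_def by (subst z[symmetric]) (simp add: algebra_simps)
  have ig: "integrable lborel (\<lambda>s. ind t s * g s)"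
    unfolding ge using inner[of t] lborel_pair.integrable_snd[OF IF]
    by (intro integrable_mult_right Bochner_Integration.integrable_diff) auto
  have vg: "(LINT s|lborel. ind t s * g s) = c_const (al + 1/2) * kop al u t"
    unfolding ge kop_def unfolding FG[symmetric] unfolding Gop_def RL_def
    using inner[of t] lborel_pair.integrable_snd[OF IF]
    by (simp only: Bochner_Integration.integral_mult_right_zero integrable_mult_right Bochner_Integration.integral_diff)
  have "AE s in lborel. s \<in> {0<..<t} \<longrightarrow> kernel (al + 1/2) t s * u s = g s"
    using lborel_pair.AE_integrable_snd[OF IF]
  proof eventually_elim
    case (elim s)
    show ?case
    proof
      assume s: "s \<in> {0<..<t}"
      have Fs: "F r s = (s powr (- al) * u s) * (indicator {s<..<t} r * (r powr (al - 1) * (r - s) powr al))" for r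
        using s by (auto simp: F_def indicator_def)
      show "kernel (al + 1/2) t s * u s = g s"
      \<comment> \<open>Fubini gives integrability of the section of \<open>F\<close> for almost
        every s. Division by s^(-al) u(s) transfers it to the inner integral of the kernel; where
        u(s) = 0 that integral does not matter.\<close>
      proof (cases "u s = 0")
        case True then show ?thesis by (simp add: g_def Fs)
      next
        case False
        then have "integrable lborel (\<lambda>r. indicator {s<..<t} r * (r powr (al - 1) * (r - s) powr al))"
          using elim s unfolding Fs by simp
        then show ?thesis using s
          by (subst kernel_eq_LINT) (auto simp: g_def Fs algebra_simps)
      qed
    qed
  qed
  from has_integral_AE_lborel[OF ig this] show ?thesis by (simp add: vg)
qed

section \<open>Continuity of the images, and their derivative for H > 1/2\<close>

lemma Beta_real_pos: "0 < a \<Longrightarrow> 0 < b \<Longrightarrow> 0 < Beta a (b::real)"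
  by (simp add: Beta_def)

text \<open>For al > 0 the order 1 + al splits off a full integration, so \<open>Gop\<close> is a
  primitive and \<open>kop al u\<close> has the derivative k r^al Q with Q the fractional integral
  of order al of s^(-al) u. Cauchy-Schwarz bounds Q^2 by a multiple of r^(-al) times the fractional
  integral of u^2, and the latter is integrable by the semigroup property.\<close>

lemma kop_AC:
  assumes al: "0 < al" "al < 1/2" and u: "sq_int T u" and T: "0 < T"
  obtains q where "sq_int T q" "\<And>t. t \<in> {0..T} \<Longrightarrow> kop al u t = RL 1 q t"
    and "continuous_on {0..T} (Gop al u)"
proof -
  note [measurable] = sq_intD(1)[OF u]
  define f where "f s = s powr (- al) * u s" for s
  have f: "integrable lborel f" unfolding f_def using u al by (intro sq_int_powr_integrable) auto
  have [measurable]: "f \<in> borel_measurable borel" using f by auto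
  \<comment> \<open>Removes the Beta factor that \<open>RL_RL\<close> produces in the composition of
    the orders 1 and al.\<close>
  define k where "k = 1 / Beta 1 al"
  have k: "0 < k" using Beta_real_pos[of 1 al] al by (simp add: k_def)
  define Q where "Q = RL al f"
  have [measurable]: "Q \<in> borel_measurable borel" unfolding Q_def by measurable
  have GQ: "Gop al u t = RL 1 (\<lambda>r. k * Q r) t" for t
    using RL_RL(1)[of 1 al f t] al f Beta_real_pos[of 1 al]
    by (simp add: Gop_def f_def[symmetric] Q_def k_def RL_1 divide_simps)
  define f2 where "f2 r = ind T r * (k * Q r)" for r
  have f2: "integrable lborel f2"
    using integrable_mult_right[OF integrable_ind_RL[OF f al(1), of T], of k]
    by (simp add: f2_def[abs_def] Q_def mult.left_commute)
  have [measurable]: "f2 \<in> borel_measurable borel" using f2 by auto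
  have G2: "Gop al u t = RL 1 f2 t" if "t \<le> T" for t
    unfolding GQ using that by (intro RL_cong) (auto simp: f2_def)
  define q where "q r = r powr al * f2 r" for r
  have [measurable]: "q \<in> borel_measurable borel" unfolding q_def[abs_def] by measurable
  define B where "B = Beta al (1 - 2 * al)"
  have B: "0 < B" unfolding B_def using al by (intro Beta_real_pos) auto
  have u2: "integrable lborel (\<lambda>s. (u s)^2)" using u by (rule sq_intD)
  have ae: "AE r in lborel. r \<in> {0<..<T} \<longrightarrow> (Q r)^2 \<le> r powr (- al) * B * RL al (\<lambda>s. (u s)^2) r"
    using RL_RL(3)[of 1 al "\<lambda>s. (u s)^2" T, OF _ al(1) _ u2, simplified] al(1)
  proof (simp, elim eventually_mono, intro impI)
    fix r assume "0 < r \<and> r < T \<longrightarrow> integrable lborel (\<lambda>s. ind r s * ((r - s) powr (al - 1) * (u s)^2))"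
      and r: "0 < r \<and> r < T"
    then have i: "integrable lborel (\<lambda>s. ind r s * ((r - s) powr (al - 1) * (u s)^2))" by simp
    \<comment> \<open>The singular kernel is divided evenly between the two factors, so that
      squaring restores it in each. The weight s^(-al) goes to \<open>g1\<close>, where its square
      s^(-2 al) is integrable because al < 1/2.\<close>
    define g1 where "g1 s = ind r s * ((r - s) powr ((al - 1) / 2) * s powr (- al))" for s
    define g2 where "g2 s = ind r s * ((r - s) powr ((al - 1) / 2) * u s)" for s
    have [measurable]: "g1 \<in> borel_measurable borel" "g2 \<in> borel_measurable borel"
      unfolding g1_def[abs_def] g2_def[abs_def] by measurable
    have h: "(x powr ((al - 1) / 2))^2 = x powr (al - 1)" for x
      by (simp add: power2_eq_square powr_add[symmetric])
    have e1: "(g1 s)^2 = ind r s * ((r - s) powr (al - 1) * (s - 0) powr (1 - 2 * al - 1))" for s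
      by (cases "s \<in> {0<..<r}") (auto simp: g1_def power_mult_distrib h powr_power mult.commute)
    have e2: "(g2 s)^2 = ind r s * ((r - s) powr (al - 1) * (u s)^2)" for s
      by (cases "s \<in> {0<..<r}") (auto simp: g2_def power_mult_distrib h)
    have b1: "has_bochner_integral lborel (\<lambda>s. (g1 s)^2) (r powr (- al) * B)"
      using has_bochner_integral_Beta_segment[of al "1 - 2 * al" 0 r] al r
      unfolding e1 by (simp add: B_def)
    have e3: "g1 s * g2 s = ind r s * ((r - s) powr (al - 1) * f s)" for s
    proof (cases "s \<in> {0<..<r}")
      case True
      have "(r - s) powr ((al - 1) / 2) * (r - s) powr ((al - 1) / 2) = (r - s) powr (al - 1)"
        by (simp add: powr_add[symmetric])
      then show ?thesis using True by (simp add: g1_def g2_def f_def mult_ac)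
    qed (simp add: g1_def)
    have "\<bar>Q r\<bar> \<le> sqrt (r powr (- al) * B) * sqrt (RL al (\<lambda>s. (u s)^2) r)"
      using Cauchy_Schwarz_lborel(3)[of g1 g2] b1 i
      unfolding e2 e3 has_bochner_integral_iff by (simp add: Q_def RL_def)
    then have "\<bar>Q r\<bar>^2 \<le> (sqrt (r powr (- al) * B) * sqrt (RL al (\<lambda>s. (u s)^2) r))^2"
      by (intro power_mono) auto
    also have "\<dots> = r powr (- al) * B * RL al (\<lambda>s. (u s)^2) r"
    proof -
      have "0 \<le> RL al (\<lambda>s. (u s)^2) r" unfolding RL_def
        by (intro Bochner_Integration.integral_nonneg) auto
      then show ?thesis using B by (simp add: power_mult_distrib)
    qed
    finally show "(Q r)^2 \<le> r powr (- al) * B * RL al (\<lambda>s. (u s)^2) r" by simp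
  qed
  have iq: "integrable lborel (\<lambda>r. (q r)^2)"
  proof (rule Bochner_Integration.integrable_bound)
    show "integrable lborel (\<lambda>r. (T powr al * k^2 * B) * (ind T r * ((T - r) powr (1 - 1) * RL al (\<lambda>s. (u s)^2) r)))"
      using RL_RL(2)[of 1 al "\<lambda>s. (u s)^2" T] al u2 by (intro integrable_mult_right) auto
    show "AE r in lborel. norm ((q r)^2) \<le> norm ((T powr al * k^2 * B) * (ind T r * ((T - r) powr (1 - 1) * RL al (\<lambda>s. (u s)^2) r)))"
      using ae
    proof eventually_elim
      case (elim r)
      show ?case
      proof (cases "r \<in> {0<..<T}")
        case True
        define R where "R = RL al (\<lambda>s. (u s)^2) r"
        have R: "0 \<le> R" unfolding RL_def R_def by (intro Bochner_Integration.integral_nonneg) auto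
        have "(q r)^2 = r powr (2 * al) * k^2 * (Q r)^2"
          using True by (simp add: q_def f2_def power_mult_distrib powr_power mult.commute)
        also have "\<dots> \<le> r powr (2 * al) * k^2 * (r powr (- al) * B * R)"
          using elim True by (intro mult_left_mono) (auto simp: R_def)
        also have "\<dots> = (r powr (2 * al) * r powr (- al)) * k^2 * B * R" by simp
        also have "r powr (2 * al) * r powr (- al) = r powr al" by (simp add: powr_add[symmetric])
        also have "r powr al * k^2 * B * R \<le> T powr al * k^2 * B * R"
          using True al B R by (intro mult_right_mono powr_mono2) auto
        finally show ?thesis using True R B by (simp add: R_def)
      qed (simp add: q_def f2_def)
    qed
  qed simp
  have sq: "sq_int T q"
    unfolding sq_int_def using iq by (auto simp: q_def f2_def)
  have ind_q: "integrable lborel q" using sq by (rule sq_int_integrable)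
  have kq: "kop al u t = RL 1 q t" if t: "t \<in> {0..T}" for t
  proof -
    have "kop al u t = t powr al * RL 1 f2 t - al * moment (al - 1) (RL 1 f2) t"
    proof -
      have "moment (al - 1) (Gop al u) t =
          moment (al - 1) (RL 1 f2) t"
        by (rule Bochner_Integration.integral_cong) (use t in \<open>auto simp: indicator_def G2\<close>)
      then show ?thesis using t by (simp add: kop_def G2)
    qed
    also have "\<dots> = (LINT r|lborel. ind t r * (r powr al * f2 r))"
      using al f2 integrable_lborel_Ioo[OF ind_q, of 0 t] by (intro powr_by_parts(2)) (auto simp: q_def[abs_def])
    finally show ?thesis by (simp add: RL_1 q_def)
  qed
  have "continuous_on {0..T} (Gop al u)"
    using continuous_on_RL_1[OF f2] by (rule continuous_on_eq) (auto simp: G2)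
  then show ?thesis using that sq kq by blast
qed

text \<open>For al > 0 the weight s^(-al) is unbounded, but \<open>Gop\<close> is a primitive. For
  al at most 0 the weight is bounded on (0,T), so the weighted function is again square integrable,
  and the order 1 + al > 1/2 gives continuity through \<open>RL_Hoelder\<close>.\<close>

lemma continuous_on_Gop:
  assumes al: "\<bar>al\<bar> < 1/2" and u: "sq_int T u" and T: "0 < T"
  shows "continuous_on {0..T} (Gop al u)"
proof (cases "0 < al")
  case True
  then show ?thesis using kop_AC[OF True _ u T] al by (metis abs_of_pos)
next
  case False
  note [measurable] = sq_intD(1)[OF u]
  have "integrable lborel (\<lambda>s. (s powr (- al) * u s)^2)"
  proof (rule Bochner_Integration.integrable_bound)
    show "integrable lborel (\<lambda>s. (T powr (- al))^2 * (u s)^2)" using sq_intD(2)[OF u] by auto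
    show "AE s in lborel. norm ((s powr (- al) * u s)^2) \<le> norm ((T powr (- al))^2 * (u s)^2)"
    proof (rule AE_I2)
      fix s show "norm ((s powr (- al) * u s)^2) \<le> norm ((T powr (- al))^2 * (u s)^2)"
      proof (cases "s \<in> {0<..<T}")
        case True
        then have "s powr (- al) \<le> T powr (- al)" using False by (intro powr_mono2) auto
        then have "(s powr (- al))^2 \<le> (T powr (- al))^2" by (intro power_mono) auto
        then show ?thesis by (simp add: power_mult_distrib mult_right_mono)
      qed (simp add: sq_intD(3)[OF u])
    qed
  qed simp
  then have "continuous_on {0..} (Gop al u)"
    unfolding Gop_def using al False by (intro continuous_on_RL_L2) auto
  then show ?thesis by (rule continuous_on_subset) auto
qed

text \<open>The cut-off at T makes the integrand independent of t and integrable on the whole line,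
  so that \<open>kop\<close> can be treated with the facts on primitives
  \<open>RL 1\<close>.\<close>

lemma kop_alt:
  assumes t: "t \<le> T"
  shows "kop al u t = t powr al * Gop al u t - al * RL 1 (\<lambda>r. ind T r * (r powr (al - 1) * Gop al u r)) t"
proof -
  have "moment (al - 1) (Gop al u) t =
      RL 1 (\<lambda>r. ind T r * (r powr (al - 1) * Gop al u r)) t"
    unfolding RL_1 by (rule Bochner_Integration.integral_cong) (use t in \<open>auto simp: indicator_def\<close>)
  then show ?thesis by (simp add: kop_def)
qed

lemma continuous_on_kop:
  assumes al: "\<bar>al\<bar> < 1/2" and u: "sq_int T u" and T: "0 < T"
  shows "continuous_on {0..T} (kop al u)"
proof -
  have P: "continuous_on {0..T} (\<lambda>t. t powr al * Gop al u t)"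
    unfolding continuous_on_eq_continuous_within
  proof
    fix t assume t: "t \<in> {0..T}"
    have G: "continuous (at t within {0..T}) (Gop al u)"
      using continuous_on_Gop[OF al u T] t by (auto simp: continuous_on_eq_continuous_within)
    show "continuous (at t within {0..T}) (\<lambda>t. t powr al * Gop al u t)"
    proof (cases "t = 0")
      case False
      then show ?thesis using G t by (intro continuous_intros) auto
    next
      case True
      \<comment> \<open>For al < 0 the factor t^al blows up at 0; the sqrt t in
        \<open>Gop_bound\<close> leaves t^(al+1/2), which tends to 0.\<close>
      have "((\<lambda>x. gconst al * l2 u * x powr (al + 1/2)) \<longlongrightarrow> gconst al * l2 u * 0) (at 0 within {0..T})"
        using al by (intro tendsto_mult tendsto_const tendsto_zero_powrI)
          (auto simp: eventually_at_topological intro!: tendsto_eq_intros)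
      then have z: "((\<lambda>x. gconst al * l2 u * x powr (al + 1/2)) \<longlongrightarrow> 0) (at 0 within {0..T})" by simp
      have "((\<lambda>t. t powr al * Gop al u t) \<longlongrightarrow> 0) (at 0 within {0..T})"
      proof (rule Lim_null_comparison[OF _ z])
        show "\<forall>\<^sub>F x in at 0 within {0..T}. norm (x powr al * Gop al u x) \<le> gconst al * l2 u * x powr (al + 1/2)"
          unfolding eventually_at_filter
        proof (intro always_eventually allI impI)
          fix x :: real assume "x \<in> {0..T}"
          then have "\<bar>Gop al u x\<bar> \<le> gconst al * x powr (1/2) * l2 u" using Gop_bound(1)[OF al u] by auto
          then have "x powr al * \<bar>Gop al u x\<bar> \<le> x powr al * (gconst al * x powr (1/2) * l2 u)"
            by (intro mult_left_mono) auto
          then show "norm (x powr al * Gop al u x) \<le> gconst al * l2 u * x powr (al + 1/2)"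
            by (simp add: abs_mult powr_add mult_ac)
        qed
      qed
      then show ?thesis using True by (simp add: continuous_within)
    qed
  qed
  have "continuous_on {0..T} (\<lambda>t. t powr al * Gop al u t - al * RL 1 (\<lambda>r. ind T r * (r powr (al - 1) * Gop al u r)) t)"
    by (intro continuous_intros P continuous_on_RL_1 Gop_weighted(1)[OF al u T])
  then show ?thesis by (rule continuous_on_eq) (auto simp: kop_alt[of _ T])
qed

lemma sq_int_bounded:
  assumes [measurable]: "u \<in> borel_measurable borel" and b: "\<And>s. s \<in> {0<..<T} \<Longrightarrow> \<bar>u s\<bar> \<le> M"
    and z: "\<And>s. s \<notin> {0<..<T} \<Longrightarrow> u s = 0"
  shows "sq_int T u"
proof -
  have "integrable lborel (\<lambda>s. ind T s * (u s)^2)"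
  proof (rule integrable_bounded_Ioo)
    fix s assume "s \<in> {0<..<T}"
    then have "\<bar>u s\<bar>^2 \<le> M^2" using b by (intro power_mono) auto
    then show "\<bar>(u s)^2\<bar> \<le> M^2" by simp
  qed simp
  also have "(\<lambda>s. ind T s * (u s)^2) = (\<lambda>s. (u s)^2)"
    using z by (auto simp: indicator_def fun_eq_iff)
  finally show ?thesis using z by (auto simp: sq_int_def)
qed

lemma sq_int_add:
  assumes u: "sq_int T u" and v: "sq_int T v"
  shows "sq_int T (\<lambda>x. u x + v x)"
proof -
  note [measurable] = sq_intD(1)[OF u] sq_intD(1)[OF v]
  have "integrable lborel (\<lambda>x. (u x)^2 + (v x)^2 + 2 * (u x * v x))"
    using sq_intD(2)[OF u] sq_intD(2)[OF v] Cauchy_Schwarz_lborel(1)[of u v] by auto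
  then show ?thesis
    using sq_intD(3)[OF u] sq_intD(3)[OF v] by (auto simp: sq_int_def power2_sum algebra_simps)
qed

lemma sq_int_cmult:
  assumes u: "sq_int T u"
  shows "sq_int T (\<lambda>x. c * u x)"
  using sq_intD[OF u] by (auto simp: sq_int_def power_mult_distrib)

lemma sq_int_diff:
  assumes u: "sq_int T u" and v: "sq_int T v"
  shows "sq_int T (\<lambda>x. u x - v x)"
  using sq_int_add[OF u sq_int_cmult[OF v, of "-1"]] by simp

lemma Gop_diff:
  assumes al: "\<bar>al\<bar> < 1/2" and u: "sq_int T u" and v: "sq_int T v"
  shows "Gop al (\<lambda>x. u x - v x) t = Gop al u t - Gop al v t"
proof (cases "0 < t")
  case True
  have "integrable lborel (\<lambda>s. ind t s * ((t - s) powr al * (s powr (- al) * u s)))" if u: "sq_int T u" for u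
    using powr_weighted_l2_bound(1)[of al "- al" t u] al True sq_intD(1,2)[OF u] by simp
  from this[OF u] this[OF v] show ?thesis
    by (simp add: Gop_def RL_def right_diff_distrib)
qed (simp add: Gop_def RL_def)

lemma kop_diff:
  assumes al: "\<bar>al\<bar> < 1/2" and u: "sq_int T u" and v: "sq_int T v" and t: "0 \<le> t"
  shows "kop al (\<lambda>x. u x - v x) t = kop al u t - kop al v t"
proof (cases "t = 0")
  case False
  then show ?thesis using Gop_weighted(1)[OF al u, of t] Gop_weighted(1)[OF al v, of t] t
    by (simp add: kop_def Gop_diff[OF al u v] right_diff_distrib)
qed (simp add: kop_0)

section \<open>Injectivity of the Volterra operator\<close>

lemma DERIV_RL_1:
  assumes f: "integrable lborel f" and t: "0 < t" and c: "isCont f t"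
  shows "(RL 1 f has_real_derivative f t) (at t)"
proof -
  have "((\<lambda>u. integral {0..u} f) has_vector_derivative f t) (at t within ({0..t+1} - {}))"
    using t c by (intro integral_has_vector_derivative_continuous_at RL_1_eq_integral(3)[OF f])
      (auto intro: continuous_at_imp_continuous_at_within)
  then have "((\<lambda>u. integral {0..u} f) has_real_derivative f t) (at t within {0..t+1})"
    by (simp add: has_real_derivative_iff_has_vector_derivative)
  then have "((\<lambda>u. integral {0..u} f) has_real_derivative f t) (at t)"
    using t by (subst (asm) at_within_interior) auto
  then show ?thesis
    by (rule has_field_derivative_transform_within_open[where S="{0<..}"])
      (use t RL_1_eq_integral(2)[OF f] in auto)
qed

text \<open>All integrals of \<open>f\<close> over subintervals vanish, so the error sums in
  Henstock's lemma are just the Riemann sums of the absolute value of \<open>f\<close>. These become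
  small, hence the absolute value has integral 0. No differentiation theorem for Lebesgue integrals
  enters.\<close>

lemma AE_zero_of_RL_1_zero:
  assumes f: "integrable lborel f" and z: "\<And>t. t \<in> {0..T} \<Longrightarrow> RL 1 f t = 0"
  shows "AE x in lborel. x \<in> {0<..<T} \<longrightarrow> f x = 0"
proof (cases "0 < T")
  case True
  have fi: "f integrable_on {0..T}" using RL_1_eq_integral(3)[OF f] True by simp
  have z: "integral {0..t} f = 0" if "t \<in> {0..T}" for t using z[OF that] RL_1_eq_integral(2)[OF f] that by simp
  have z2: "integral {a..b} f = 0" if "a \<in> {0..T}" "b \<in> {0..T}" "a \<le> b" for a b
  proof -
    have "integral {0..a} f + integral {a..b} f = integral {0..b} f"
      using that by (intro Henstock_Kurzweil_Integration.integral_combine integrable_on_subinterval[OF fi]) auto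
    then show ?thesis using z that by simp
  qed
  have "((\<lambda>x. \<bar>f x\<bar>) has_integral 0) (cbox 0 T)"
    unfolding has_integral
  proof (intro allI impI)
    fix e :: real assume e: "0 < e"
    obtain \<gamma> where g: "gauge \<gamma>" and le: "\<And>p. p tagged_partial_division_of (cbox 0 T) \<Longrightarrow> \<gamma> fine p \<Longrightarrow>
        (\<Sum>(x,k)\<in>p. norm (measure lborel k *\<^sub>R f x - integral k f)) < e"
      by (rule Henstock_lemma[OF fi[folded box_real] e]) blast
    have "norm ((\<Sum>(x,k)\<in>p. measure lborel k *\<^sub>R \<bar>f x\<bar>) - 0) < e"
      if p: "p tagged_division_of cbox 0 T" and fine: "\<gamma> fine p" for p
    proof -
      have "(\<Sum>(x,k)\<in>p. measure lborel k *\<^sub>R \<bar>f x\<bar>) = (\<Sum>(x,k)\<in>p. norm (measure lborel k *\<^sub>R f x - integral k f))"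
      proof (rule sum.cong, simp, clarify)
        fix x k assume xk: "(x, k) \<in> p"
        then obtain a b where k: "k = {a..b}" using tagged_division_ofD(4)[OF p] by (metis box_real(2))
        have "k \<subseteq> {0..T}" "x \<in> k" using tagged_division_ofD(2,3)[OF p xk] by auto
        then have "integral k f = 0" unfolding k by (intro z2) auto
        then show "measure lborel k *\<^sub>R \<bar>f x\<bar> = norm (measure lborel k *\<^sub>R f x - integral k f)" by (simp add: abs_mult)
      qed
      moreover have "(\<Sum>(x,k)\<in>p. norm (measure lborel k *\<^sub>R f x - integral k f)) < e"
        using le[of p] p fine tagged_division_of_def by blast
      moreover have "0 \<le> (\<Sum>(x,k)\<in>p. norm (measure lborel k *\<^sub>R f x - integral k f))" by (intro sum_nonneg) auto
      ultimately show ?thesis by simp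
    qed
    then show "\<exists>\<gamma>. gauge \<gamma> \<and> (\<forall>\<D>. \<D> tagged_division_of cbox 0 T \<and> \<gamma> fine \<D> \<longrightarrow>
        norm ((\<Sum>(x,k)\<in>\<D>. measure lborel k *\<^sub>R \<bar>f x\<bar>) - 0) < e)" using g by blast
  qed
  moreover have "((\<lambda>x. \<bar>f x\<bar>) has_integral RL 1 (\<lambda>x. \<bar>f x\<bar>) T) {0..T}"
    using f True by (intro RL_1_eq_integral) auto
  ultimately have "RL 1 (\<lambda>x. \<bar>f x\<bar>) T = 0" using has_integral_unique by (metis box_real(2))
  then have "(LINT x|lborel. ind T x * \<bar>f x\<bar>) = 0" by (simp add: RL_1)
  then have "AE x in lborel. ind T x * \<bar>f x\<bar> = 0"
    using integrable_lborel_Ioo[OF integrable_abs[OF f]] by (subst (asm) integral_nonneg_eq_0_iff_AE) auto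
  then show ?thesis by eventually_elim (auto simp: indicator_def)
qed auto

text \<open>If \<open>kop al u = 0\<close>, then \<open>P(t) = t powr al * G(t)\<close> solves \<open>P' = al P / t\<close>, so \<open>G\<close> is constant, hence \<open>0\<close>;
  the fractional integral \<open>G\<close> of \<open>s powr (-al) * u\<close> is then inverted by Abel's method.\<close>

lemma kop_inj:
  assumes al: "\<bar>al\<bar> < 1/2" and u: "sq_int T u" and T: "0 < T"
    and z: "\<And>t. t \<in> {0..T} \<Longrightarrow> kop al u t = 0"
  shows "AE x in lborel. u x = 0"
proof -
  note [measurable] = sq_intD(1)[OF u]
  define f where "f s = s powr (- al) * u s" for s
  have f: "integrable lborel f" unfolding f_def using u al by (intro sq_int_powr_integrable) auto
  define h where "h r = ind T r * (r powr (al - 1) * Gop al u r)" for r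
  have h: "integrable lborel h" unfolding h_def by (rule Gop_weighted(1)[OF al u T])
  have P: "t powr al * Gop al u t = al * RL 1 h t" if "t \<in> {0..T}" for t
    using kop_alt[of t T al u] z[OF that] that by (simp add: h_def[abs_def])
  have cG: "isCont (Gop al u) t" if "t \<in> {0<..<T}" for t
    using continuous_on_Gop[OF al u T] that by (simp add: continuous_on_interior)
  have ch: "isCont h t" if t: "t \<in> {0<..<T}" for t
  proof -
    have "isCont (\<lambda>r. r powr (al - 1) * Gop al u r) t"
      using cG[OF t] t by (intro continuous_intros) auto
    moreover have "\<forall>\<^sub>F r in nhds t. h r = r powr (al - 1) * Gop al u r"
      using t eventually_nhds_in_open[of "{0<..<T}" t] by (auto simp: h_def elim!: eventually_mono)
    ultimately show ?thesis by (rule iffD2[OF isCont_cong, rotated])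
  qed
  have G0: "Gop al u t = 0" if t: "t \<in> {0..T}" for t
  proof -
    have "Gop al u t = Gop al u 0"
    proof (rule DERIV_isconst2[OF T continuous_on_Gop[OF al u T]])
      fix x assume x: "0 < x" "x < T"
      have d: "((\<lambda>t. t powr (- al) * (al * RL 1 h t)) has_real_derivative
          (- al * x powr (- al - 1)) * (al * RL 1 h x) + (al * h x) * x powr (- al)) (at x)"
        using x ch[of x] by (intro DERIV_mult DERIV_cmult DERIV_RL_1 h) (auto intro!: derivative_eq_intros)
      have "al * RL 1 h x = x powr al * Gop al u x" using P[of x] x by simp
      then have "(- al * x powr (- al - 1)) * (al * RL 1 h x) + (al * h x) * x powr (- al)
         = al * Gop al u x * (x powr (- al) * x powr (al - 1) - x powr (- al - 1) * x powr al)"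
        using x by (simp add: h_def algebra_simps)
      also have "\<dots> = 0" by (simp add: powr_add[symmetric])
      finally have "((\<lambda>t. t powr (- al) * (al * RL 1 h t)) has_real_derivative 0) (at x)" using d by (simp only:)
      then show "(Gop al u has_real_derivative 0) (at x)"
      proof (rule has_field_derivative_transform_within_open[where S="{0<..<T}"])
        fix y assume "y \<in> {0<..<T}"
        then show "y powr (- al) * (al * RL 1 h y) = Gop al u y"
          using P[of y] by (simp add: powr_minus field_simps)
      qed (use x in auto)
    qed (use t in auto)
    then show ?thesis by (simp add: Gop_0)
  qed
  \<comment> \<open>An integration of the complementary order 1 - al brings the total order to 2, so
    the double primitive of \<open>f\<close> vanishes.\<close>
  have R2: "RL 2 f t = 0" if t: "t \<in> {0..T}" for t
  proof -
    have "RL (1 - al) (RL (1 + al) f) t = Beta (1 - al) (1 + al) * RL (1 - al + (1 + al)) f t"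
      using al f by (intro RL_RL) auto
    moreover have "RL (1 - al) (RL (1 + al) f) t = RL (1 - al) (\<lambda>_. 0) t"
      using G0 t by (intro RL_cong) (auto simp: Gop_def f_def[abs_def])
    moreover have "Beta (1 - al) (1 + al) > 0" using al by (intro Beta_real_pos) auto
    ultimately show ?thesis by (simp add: RL_def)
  qed
  \<comment> \<open>The double primitive is removed in two stages: the outer integrand
    \<open>RL 1 f\<close> is continuous and can be recovered by ordinary differentiation, while for
    \<open>f\<close> itself only an almost everywhere statement is possible. The cut-off makes
    \<open>g\<close> integrable on the line.\<close>
  define g where "g r = ind T r * RL 1 f r" for r
  have g: "integrable lborel g" unfolding g_def[abs_def] by (rule integrable_ind_RL[OF f]) simp
  have R1: "RL 1 g t = 0" if "t \<in> {0..T}" for t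
  proof -
    have "RL 1 g t = RL 1 (RL 1 f) t" using that by (intro RL_cong) (auto simp: g_def)
    then show ?thesis using RL_RL(1)[of 1 1 f t] f R2[OF that] by simp
  qed
  have F0: "RL 1 f t = 0" if t: "t \<in> {0<..<T}" for t
  proof -
    have "isCont (RL 1 f) t"
      using continuous_on_RL_1[OF f, of T] t by (simp add: continuous_on_interior)
    moreover have "\<forall>\<^sub>F r in nhds t. g r = RL 1 f r"
      using t eventually_nhds_in_open[of "{0<..<T}" t] by (auto simp: g_def elim!: eventually_mono)
    ultimately have "isCont g t" by (rule iffD2[OF isCont_cong, rotated])
    then have "(RL 1 g has_real_derivative g t) (at t)" using t g by (intro DERIV_RL_1) auto
    moreover have "(RL 1 g has_real_derivative 0) (at t)"
      by (rule has_field_derivative_transform_within_open[where f="\<lambda>_. 0" and S="{0<..<T}"])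
        (use t R1 in auto)
    ultimately have "g t = 0" by (rule DERIV_unique)
    then show ?thesis using t by (simp add: g_def)
  qed
  have z0: "RL 1 f t = 0" if "t \<in> {0..T}" for t
  proof -
    have "closure {0<..<T} = {0..T}" using T by simp
    then show ?thesis
      using continuous_constant_on_closure[of "{0<..<T}" "RL 1 f" 0 t] continuous_on_RL_1[OF f, of T] F0 that by simp
  qed
  have "AE x in lborel. x \<in> {0<..<T} \<longrightarrow> f x = 0"
    using f z0 by (rule AE_zero_of_RL_1_zero)
  then show ?thesis
    by eventually_elim (use sq_intD(3)[OF u] in \<open>auto simp: f_def\<close>)
qed

section \<open>Primitives in the range of the Volterra operator\<close>

lemma RL_bound:
  assumes a: "0 < a" and b: "0 < b" and t: "0 < t" and [measurable]: "f \<in> borel_measurable borel"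
    and f: "\<And>s. s \<in> {0<..<t} \<Longrightarrow> \<bar>f s\<bar> \<le> M * s powr (b - 1)"
  shows "\<bar>RL a f t\<bar> \<le> M * (t powr (a + b - 1) * Beta a b)"
    and "integrable lborel (\<lambda>s. ind t s * ((t - s) powr (a - 1) * f s))"
proof -
  note i = RL_powr(2)[OF a b t]
  have le: "\<bar>ind t s * ((t - s) powr (a - 1) * f s)\<bar>
      \<le> M * (ind t s * ((t - s) powr (a - 1) * s powr (b - 1)))" for s
  proof (cases "s \<in> {0<..<t}")
    case True
    then show ?thesis using mult_left_mono[OF f[OF True], of "(t - s) powr (a - 1)"] by (simp add: abs_mult mult_ac)
  qed simp
  show j: "integrable lborel (\<lambda>s. ind t s * ((t - s) powr (a - 1) * f s))"
    by (rule Bochner_Integration.integrable_bound[OF integrable_mult_right[OF i, of M]])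
      (use le in \<open>auto intro!: AE_I2 intro: order_trans[OF _ abs_ge_self]\<close>)
  have "\<bar>RL a f t\<bar> \<le> (LINT s|lborel. M * (ind t s * ((t - s) powr (a - 1) * s powr (b - 1))))"
    unfolding RL_def by (rule integral_abs_bound_integral[OF j integrable_mult_right[OF i] le])
  also have "\<dots> = M * RL a (\<lambda>s. s powr (b - 1)) t" by (simp add: RL_def)
  finally show "\<bar>RL a f t\<bar> \<le> M * (t powr (a + b - 1) * Beta a b)" by (simp add: RL_powr(1)[OF a b t])
qed

lemma RL_cmult: "RL a (\<lambda>s. c * f s) t = c * RL a f t"
proof -
  have "RL a (\<lambda>s. c * f s) t = (LINT s|lborel. c * (ind t s * ((t - s) powr (a - 1) * f s)))"
    unfolding RL_def by (simp add: mult_ac)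
  then show ?thesis by (simp add: RL_def)
qed

lemma continuous_Ioo_extension:
  fixes g :: "real \<Rightarrow> real"
  assumes "continuous_on {0..T} g"
  obtains M where "(\<lambda>s. ind T s * g s) \<in> borel_measurable borel" "0 \<le> M"
    "\<And>s. s \<in> {0..T} \<Longrightarrow> \<bar>g s\<bar> \<le> M"
proof -
  have "(\<lambda>s. ind T s *\<^sub>R g s) \<in> borel_measurable borel"
    using assms by (intro borel_measurable_continuous_on_indicator) (auto intro: continuous_on_subset)
  then have m: "(\<lambda>s. ind T s * g s) \<in> borel_measurable borel" by simp
  have "bounded (g ` {0..T})" using assms by (intro compact_imp_bounded compact_continuous_image) auto
  then obtain M where "\<forall>y\<in>g ` {0..T}. norm y \<le> M" unfolding bounded_iff by blast
  then have M: "\<And>s. s \<in> {0..T} \<Longrightarrow> \<bar>g s\<bar> \<le> M" by auto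
  show ?thesis using m M by (intro that[of "max 0 M"]) (auto simp: le_max_iff_disj)
qed

lemma continuous_Icc_bounded:
  fixes g :: "real \<Rightarrow> real"
  assumes "continuous_on {0..T} g"
  shows "\<exists>M\<ge>0. \<forall>r\<in>{0..T}. \<bar>g r\<bar> \<le> M"
  using continuous_Ioo_extension[OF assms] by metis

lemma sq_int_continuous:
  assumes f: "continuous_on {0..T} f"
  shows "sq_int T (\<lambda>s. ind T s * f s)"
proof -
  obtain M where "(\<lambda>s. ind T s * f s) \<in> borel_measurable borel" "0 \<le> M"
    "\<And>s. s \<in> {0..T} \<Longrightarrow> \<bar>f s\<bar> \<le> M" using continuous_Ioo_extension[OF f] by blast
  then show ?thesis by (intro sq_int_bounded[where M=M]) auto
qed

lemma kop_of_Gop: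
  assumes al: "al \<noteq> 0" "\<bar>al\<bar> < 1/2" and T: "0 < T" and g: "continuous_on {0..T} g" 
    and G: "\<And>t. t \<in> {0..T} \<Longrightarrow> Gop al u t = RL 1 (\<lambda>s. ind T s * (s powr (- al) * g s)) t"
    and t: "t \<in> {0..T}"
  shows "kop al u t = integral {0..t} g"
proof -
  define f where "f s = ind T s * (s powr (- al) * g s)" for s
  have fe: "f = (\<lambda>s. s powr (- al) * (ind T s * g s))" by (auto simp: f_def)
  have gs: "sq_int T (\<lambda>s. ind T s * g s)" using g by (rule sq_int_continuous)
  have f: "integrable lborel f" unfolding fe using al by (intro sq_int_powr_integrable[OF gs]) auto
  have gi: "integrable lborel (\<lambda>s. ind T s * g s)" using gs by (rule sq_int_integrable)
  have e: "ind t s * (s powr al * f s) = ind t s * (ind T s * g s)" for s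
    by (auto simp: f_def indicator_def powr_minus)
  have "kop al u t = t powr al * RL 1 f t - al * moment (al - 1) (RL 1 f) t"
  proof -
    have "moment (al - 1) (Gop al u) t =
        moment (al - 1) (RL 1 f) t"
      by (rule Bochner_Integration.integral_cong) (use t in \<open>auto simp: indicator_def G f_def[abs_def]\<close>)
    then show ?thesis using t by (simp add: kop_def G f_def[abs_def])
  qed
  also have "\<dots> = (LINT r|lborel. ind t r * (r powr al * f r))"
    using al f integrable_lborel_Ioo[OF gi, of 0 t] by (intro powr_by_parts(2)) (auto simp: e)
  also have "\<dots> = RL 1 (\<lambda>s. ind T s * g s) t" by (simp add: RL_1 e)
  also have "\<dots> = integral {0..t} (\<lambda>s. ind T s * g s)"
    using gi t by (intro RL_1_eq_integral) auto
  also have "\<dots> = integral {0..t} g"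
    by (rule integral_spike[of "{0, T}"]) (use t in \<open>auto simp: indicator_def\<close>)
  finally show ?thesis .
qed

text \<open>\<open>G(t) = \<integral> s powr (-al) * g(s) ds\<close> makes \<open>kop al u\<close> the primitive of \<open>g\<close>; the semigroup property tells which
  \<open>u\<close> has this \<open>G\<close>.\<close>

lemma kop_surj_neg:
  assumes al: "- 1/2 < al" "al < 0" and T: "0 < T" and g: "continuous_on {0..T} g"
  obtains u where "sq_int T u" "\<And>t. t \<in> {0..T} \<Longrightarrow> kop al u t = integral {0..t} g"
proof -
  obtain M where [measurable]: "(\<lambda>s. ind T s * g s) \<in> borel_measurable borel" and M: "0 \<le> M"
    "\<And>s. s \<in> {0..T} \<Longrightarrow> \<bar>g s\<bar> \<le> M" using continuous_Ioo_extension[OF g] by blast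
  define f where "f s = ind T s * (s powr (- al) * g s)" for s
  have fe: "f = (\<lambda>s. s powr (- al) * (ind T s * g s))" by (auto simp: f_def)
  have [measurable]: "f \<in> borel_measurable borel" unfolding fe by measurable
  have gs: "sq_int T (\<lambda>s. ind T s * g s)" using g by (rule sq_int_continuous)
  have f: "integrable lborel f" unfolding fe using al by (intro sq_int_powr_integrable[OF gs]) auto
  \<comment> \<open>Compensates the Beta factor from composing the orders 1 + al and -al, which add
    up to 1.\<close>
  define k where "k = 1 / Beta (1 + al) (- al)"
  have k: "0 < Beta (1 + al) (- al)" using al by (intro Beta_real_pos) auto
  define u where "u s = ind T s * (s powr al * (k * RL (- al) f s))" for s
  have u: "sq_int T u"
  \<comment> \<open>As \<open>f\<close> is O(s^(-al)), its integral of order -al is O(s^(-2 al)).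
    The outer factor s^al leaves O(s^(-al)), which is largest at T because al < 0.\<close>
  proof (rule sq_int_bounded[where M="k * (M * (T powr (- al) * Beta (- al) (1 - al)))"])
    fix s assume s: "s \<in> {0<..<T}"
    have B: "0 < Beta (- al) (1 - al)" using al by (intro Beta_real_pos) auto
    have "\<bar>RL (- al) f s\<bar> \<le> M * (s powr (- al + (1 - al) - 1) * Beta (- al) (1 - al))"
      using al s M(2) by (intro RL_bound) (auto simp: f_def abs_mult mult.commute indicator_def intro!: mult_right_mono)
    then have "s powr al * \<bar>RL (- al) f s\<bar> \<le> s powr al * (M * (s powr (- al + (1 - al) - 1) * Beta (- al) (1 - al)))"
      by (intro mult_left_mono) auto
    also have "\<dots> = M * ((s powr al * s powr (- al + (1 - al) - 1)) * Beta (- al) (1 - al))" by simp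
    also have "s powr al * s powr (- al + (1 - al) - 1) = s powr (- al)" by (simp add: powr_add[symmetric])
    also have "M * (s powr (- al) * Beta (- al) (1 - al)) \<le> M * (T powr (- al) * Beta (- al) (1 - al))"
      using s al M(1) B by (intro mult_left_mono mult_right_mono powr_mono2) auto
    finally have "k * (s powr al * \<bar>RL (- al) f s\<bar>) \<le> k * (M * (T powr (- al) * Beta (- al) (1 - al)))"
      using k by (intro mult_left_mono) (auto simp: k_def)
    then show "\<bar>u s\<bar> \<le> k * (M * (T powr (- al) * Beta (- al) (1 - al)))"
      using s k by (simp add: u_def abs_mult k_def mult_ac)
  qed (auto simp: u_def[abs_def])
  have "Gop al u t = RL 1 f t" if t: "t \<in> {0..T}" for t
  proof -
    have "Gop al u t = RL (1 + al) (\<lambda>s. k * RL (- al) f s) t"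
      unfolding Gop_def using t by (intro RL_cong) (auto simp: u_def powr_minus field_simps)
    also have "\<dots> = k * (Beta (1 + al) (- al) * RL (1 + al + - al) f t)"
      unfolding RL_cmult using al f by (subst RL_RL(1)) auto
    finally show ?thesis using k by (simp add: k_def)
  qed
  then have "kop al u t = integral {0..t} g" if "t \<in> {0..T}" for t
    using al T g that by (intro kop_of_Gop[where T=T]) (auto simp: f_def[abs_def])
  with u show ?thesis by (rule that)
qed

text \<open>Kept apart because inversion by \<open>RL (- al)\<close> degenerates at order 0, where
  the kernel would be 1/(t - s). Here \<open>kop\<close> is plain integration and \<open>g\<close>
  is its own preimage.\<close>

lemma kop_surj_zero:
  assumes T: "0 < T" and g: "continuous_on {0..T} g"
  obtains u where "sq_int T u" "\<And>t. t \<in> {0..T} \<Longrightarrow> kop 0 u t = integral {0..t} g"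
proof -
  define u where "u s = ind T s * g s" for s
  have u: "sq_int T u" unfolding u_def using g by (rule sq_int_continuous)
  have "kop 0 u t = integral {0..t} g" if t: "t \<in> {0..T}" for t
  proof (cases "t = 0")
    case False
    have "kop 0 u t = RL 1 (\<lambda>s. s powr 0 * u s) t" using False by (simp add: kop_def Gop_def)
    also have "\<dots> = RL 1 u t" by (intro RL_cong) auto
    also have "\<dots> = integral {0..t} u" using t by (intro RL_1_eq_integral sq_int_integrable[OF u]) auto
    also have "\<dots> = integral {0..t} g"
      by (rule integral_spike[of "{0, T}"]) (use t in \<open>auto simp: indicator_def u_def\<close>)
    finally show ?thesis .
  qed (simp add: kop_0)
  with u show ?thesis by (rule that)
qed

text \<open>Here \<open>s powr (-al) * u\<close> has to be a fractional derivative of order \<open>al\<close> of \<open>s powr (-al) * g\<close>. The constant part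
  of \<open>g\<close> contributes a multiple of \<open>s powr (-2 * al)\<close>; the rest is the primitive of \<open>w\<close> below.\<close>

lemma kop_surj_pos:
  assumes al: "0 < al" "al < 1/2" and T: "0 < T" and v: "sq_int T v"
    and g: "\<And>t. t \<in> {0..T} \<Longrightarrow> g t = c + RL 1 v t"
  obtains u where "sq_int T u" "\<And>t. t \<in> {0..T} \<Longrightarrow> kop al u t = integral {0..t} g"
proof -
  note [measurable] = sq_intD(1)[OF v]
  have gc: "continuous_on {0..T} g"
    using continuous_on_add[OF continuous_on_const continuous_on_RL_1[OF sq_int_integrable[OF v]]]
    by (rule continuous_on_eq) (auto simp: g)
  \<comment> \<open>The function w is the derivative of r^(-al) times \<open>RL 1 v\<close>, and
    \<open>w1\<close> and \<open>w2\<close> come from the two terms of the product rule.\<close>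
  define w1 where "w1 r = r powr (- al) * v r" for r
  define w2 where "w2 r = ind T r * (r powr (- al - 1) * RL 1 v r)" for r
  define w where "w r = w1 r - al * w2 r" for r
  have [measurable]: "w1 \<in> borel_measurable borel" "w2 \<in> borel_measurable borel"
    unfolding w1_def[abs_def] w2_def[abs_def] by measurable
  have w1: "integrable lborel w1" unfolding w1_def using al by (intro sq_int_powr_integrable[OF v]) auto
  have w2: "integrable lborel w2"
    unfolding w2_def using al integrable_lborel_Ioo[OF w1] sq_int_integrable[OF v]
    by (intro powr_by_parts(1)) (auto simp: w1_def)
  have w: "integrable lborel w" unfolding w_def using w1 w2 by auto
  have [measurable]: "w \<in> borel_measurable borel" using w by auto
  have Rw: "RL 1 w t = t powr (- al) * RL 1 v t" if t: "t \<in> {0..T}" for t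
  proof -
    have p: "t powr (- al) * RL 1 v t - (- al) * moment (- al - 1) (RL 1 v) t
      = (LINT r|lborel. ind t r * (r powr (- al) * v r))"
      using al integrable_lborel_Ioo[OF w1] sq_int_integrable[OF v]
      by (intro powr_by_parts(2)) (auto simp: w1_def)
    have "RL 1 w t = RL 1 w1 t - al * RL 1 w2 t"
      using integrable_lborel_Ioo[OF w1, of 0 t] integrable_lborel_Ioo[OF w2, of 0 t]
      by (simp add: RL_1 w_def right_diff_distrib mult.left_commute[of _ al])
    moreover have "RL 1 w2 t = moment (- al - 1) (RL 1 v) t"
      unfolding RL_1[of w2]
      by (rule Bochner_Integration.integral_cong) (use t in \<open>auto simp: w2_def indicator_def\<close>)
    moreover have "RL 1 w1 t = (LINT r|lborel. ind t r * (r powr (- al) * v r))"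
      by (simp add: RL_1 w1_def)
    ultimately show ?thesis using p by simp
  qed
  \<comment> \<open>Both constants compare Beta factors. For \<open>k\<close>, the composed orders
    (1 + al) + (1 - al) and 1 + 1 both give 2. For \<open>k0\<close>, the integral of order 1 + al
    of s^(-2 al) and that of order 1 of s^(-al) are both multiples of t^(1-al).\<close>
  define k where "k = Beta 1 1 / Beta (1 + al) (1 - al)"
  define k0 where "k0 = Beta 1 (1 - al) / Beta (1 + al) (1 - 2 * al)"
  have B: "0 < Beta (1 + al) (1 - al)" "0 < Beta (1 + al) (1 - 2 * al)" using al by (auto intro!: Beta_real_pos)
  define u1 where "u1 s = ind T s * s powr (- al)" for s
  define u2 where "u2 s = ind T s * (s powr al * RL (1 - al) w s)" for s
  have u1: "sq_int T u1"
  proof -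
    have "integrable lborel (\<lambda>s. ind T s * ((T - s) powr (1 - 1) * s powr (1 - 2 * al - 1)))"
      using al T by (intro RL_powr(2)) auto
    also have "(\<lambda>s. ind T s * ((T - s) powr (1 - 1) * s powr (1 - 2 * al - 1))) = (\<lambda>s. (u1 s)^2)"
      by (auto simp: u1_def indicator_def fun_eq_iff powr_power)
    finally show ?thesis by (auto simp: sq_int_def u1_def[abs_def])
  qed
  \<comment> \<open>\<open>C1\<close> and \<open>C2\<close> bound the fractional integrals of order
    1 - al of \<open>w1\<close> and \<open>w2\<close>, each as a multiple of s^(1/2 - 2 al). The
    first uses Cauchy-Schwarz directly, the second the growth sqrt r of the primitive of
    \<open>v\<close>. The factor s^al in \<open>u2\<close> then leaves the positive power 1/2 -
    al.\<close>
  define C1 where "C1 = sqrt (Beta (2 * (- al) + 1) (2 * (- al) + 1)) * l2 v"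
  define C2 where "C2 = sqrt (Beta (2 * 0 + 1) (2 * 0 + 1)) * l2 v * Beta (1 - al) (1/2 - al)"
  have u2: "sq_int T u2"
  proof (rule sq_int_bounded[where M="T powr (1/2 - al) * (C1 + al * C2)"])
    fix s assume s: "s \<in> {0<..<T}"
    have i1: "integrable lborel (\<lambda>r. ind s r * ((s - r) powr (- al) * w1 r))"
      and b1: "\<bar>RL (1 - al) w1 s\<bar> \<le> s powr (1/2 - 2 * al) * C1"
      using powr_weighted_l2_bound(1,3)[of "- al" "- al" s v] al s sq_intD(2)[OF v]
      by (auto simp: w1_def RL_def C1_def mult_ac)
    have w2b: "\<bar>w2 r\<bar> \<le> (sqrt (Beta (2 * 0 + 1) (2 * 0 + 1)) * l2 v) * r powr (1/2 - al - 1)" if r: "r \<in> {0<..<s}" for r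
    proof -
      have "\<bar>RL 1 v r\<bar> \<le> sqrt (Beta (2 * 0 + 1) (2 * 0 + 1)) * r powr (0 + 0 + 1/2) * l2 v"
      proof -
        have "RL 1 v r = (LINT s|lborel. ind r s * ((r - s) powr 0 * (s powr 0 * v s)))"
          unfolding RL_1 by (rule Bochner_Integration.integral_cong) (auto simp: indicator_def)
        then show ?thesis using powr_weighted_l2_bound(3)[of 0 0 r v] r sq_intD(2)[OF v] by simp
      qed
      then have "r powr (- al - 1) * \<bar>RL 1 v r\<bar> \<le> r powr (- al - 1) * (sqrt (Beta (2 * 0 + 1) (2 * 0 + 1)) * r powr (0 + 0 + 1/2) * l2 v)"
        by (intro mult_left_mono) auto
      also have "\<dots> = (sqrt (Beta (2 * 0 + 1) (2 * 0 + 1)) * l2 v) * (r powr (- al - 1) * r powr (1/2))" by simp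
      also have "r powr (- al - 1) * r powr (1/2) = r powr (1/2 - al - 1)" by (simp add: powr_add[symmetric])
      finally show ?thesis using r s by (simp add: w2_def abs_mult)
    qed
    have b2: "\<bar>RL (1 - al) w2 s\<bar> \<le> (sqrt (Beta (2 * 0 + 1) (2 * 0 + 1)) * l2 v) * (s powr (1 - al + (1/2 - al) - 1) * Beta (1 - al) (1/2 - al))"
      and i2: "integrable lborel (\<lambda>r. ind s r * ((s - r) powr (1 - al - 1) * w2 r))"
      by (rule RL_bound[OF _ _ _ _ w2b]; use al s in simp)+
    have "RL (1 - al) w s = RL (1 - al) w1 s - al * RL (1 - al) w2 s"
      using i1 i2 by (simp add: RL_def w_def right_diff_distrib mult.left_commute[of _ al])
    then have "\<bar>RL (1 - al) w s\<bar> \<le> \<bar>RL (1 - al) w1 s\<bar> + al * \<bar>RL (1 - al) w2 s\<bar>"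
      using abs_triangle_ineq4[of "RL (1 - al) w1 s" "al * RL (1 - al) w2 s"] al by (simp add: abs_mult)
    also have "\<dots> \<le> s powr (1/2 - 2 * al) * C1 + al * (s powr (1/2 - 2 * al) * C2)"
      using b1 b2 al by (intro add_mono mult_left_mono) (auto simp: C2_def algebra_simps)
    finally have "\<bar>RL (1 - al) w s\<bar> \<le> s powr (1/2 - 2 * al) * (C1 + al * C2)" by (simp add: algebra_simps)
    then have "s powr al * \<bar>RL (1 - al) w s\<bar> \<le> s powr al * (s powr (1/2 - 2 * al) * (C1 + al * C2))"
      by (intro mult_left_mono) auto
    also have "\<dots> = (s powr al * s powr (1/2 - 2 * al)) * (C1 + al * C2)" by simp
    also have "s powr al * s powr (1/2 - 2 * al) = s powr (1/2 - al)" by (simp add: powr_add[symmetric])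
    also have "s powr (1/2 - al) * (C1 + al * C2) \<le> T powr (1/2 - al) * (C1 + al * C2)"
    proof (intro mult_right_mono powr_mono2)
      have "0 \<le> Beta (1 - al) (1/2 - al)" "0 \<le> Beta (2 * (- al) + 1) (2 * (- al) + 1)" "0 \<le> Beta (2 * 0 + 1) (2 * 0 + 1::real)"
        using al by (auto intro!: less_imp_le[OF Beta_real_pos])
      then show "0 \<le> C1 + al * C2" unfolding C1_def C2_def using al l2_nonneg[of v] by simp
    qed (use s al in auto)
    finally show "\<bar>u2 s\<bar> \<le> T powr (1/2 - al) * (C1 + al * C2)" using s by (simp add: u2_def abs_mult)
  qed (auto simp: u2_def[abs_def])
  define u where "u s = k0 * c * u1 s + k * u2 s" for s
  have u: "sq_int T u" unfolding u_def by (intro sq_int_add sq_int_cmult u1 u2)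
  have "Gop al u t = RL 1 (\<lambda>s. ind T s * (s powr (- al) * g s)) t" if t: "t \<in> {0..T}" for t
  proof (cases "t = 0")
    case False
    then have t0: "0 < t" using t by simp
    have j1: "integrable lborel (\<lambda>s. ind t s * ((t - s) powr (1 + al - 1) * s powr (1 - 2 * al - 1)))"
      using al t0 by (intro RL_powr(2)) auto
    have j2: "integrable lborel (\<lambda>s. ind t s * ((t - s) powr (1 + al - 1) * RL (1 - al) w s))"
      using al w by (intro RL_RL(2)) auto
    have "Gop al u t = RL (1 + al) (\<lambda>s. k0 * c * s powr (1 - 2 * al - 1) + k * RL (1 - al) w s) t"
      unfolding Gop_def
    proof (rule RL_cong)
      fix s assume s: "s \<in> {0<..<t}"
      have "s powr (- al) * s powr (- al) = s powr (1 - 2 * al - 1)" by (simp add: powr_add[symmetric])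
      moreover have "s powr (- al) * s powr al = 1" using s by (simp add: powr_add[symmetric])
      moreover have "s powr (- al) * u s = k0 * c * (s powr (- al) * s powr (- al)) + k * ((s powr (- al) * s powr al) * RL (1 - al) w s)"
        using s t by (simp add: u_def u1_def u2_def algebra_simps)
      ultimately show "s powr (- al) * u s = k0 * c * s powr (1 - 2 * al - 1) + k * RL (1 - al) w s" by simp
    qed
    also have "\<dots> = k0 * c * RL (1 + al) (\<lambda>s. s powr (1 - 2 * al - 1)) t + k * RL (1 + al) (RL (1 - al) w) t"
    proof -
      have "RL (1 + al) (\<lambda>s. k0 * c * s powr (1 - 2 * al - 1) + k * RL (1 - al) w s) t =
        (LINT s|lborel. k0 * c * (ind t s * ((t - s) powr (1 + al - 1) * s powr (1 - 2 * al - 1)))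
          + k * (ind t s * ((t - s) powr (1 + al - 1) * RL (1 - al) w s)))"
        unfolding RL_def[of "1 + al"] by (intro Bochner_Integration.integral_cong) (auto simp: algebra_simps)
      also have "\<dots> = k0 * c * RL (1 + al) (\<lambda>s. s powr (1 - 2 * al - 1)) t + k * RL (1 + al) (RL (1 - al) w) t"
        using Bochner_Integration.integral_add[OF integrable_mult_right[OF j1, of "k0 * c"] integrable_mult_right[OF j2, of k]]
        unfolding RL_def[of "1 + al"] by (simp only: Bochner_Integration.integral_mult_right_zero)
      finally show ?thesis .
    qed
    also have "RL (1 + al) (\<lambda>s. s powr (1 - 2 * al - 1)) t = t powr (1 + al + (1 - 2 * al) - 1) * Beta (1 + al) (1 - 2 * al)"
      using al t0 by (intro RL_powr) auto
    also have "RL (1 + al) (RL (1 - al) w) t = Beta (1 + al) (1 - al) * RL (1 + al + (1 - al)) w t"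
      using al w by (intro RL_RL) auto
    also have "k * \<dots> = Beta 1 1 * RL 2 w t" using B by (simp add: k_def)
    also have "\<dots> = RL 1 (RL 1 w) t" using RL_RL(1)[of 1 1 w t] w by simp
    also have "\<dots> = RL 1 (\<lambda>s. s powr (- al) * RL 1 v s) t"
      using t by (intro RL_cong Rw) auto
    also have "k0 * c * (t powr (1 + al + (1 - 2 * al) - 1) * Beta (1 + al) (1 - 2 * al)) =
      c * (t powr (1 + (1 - al) - 1) * Beta 1 (1 - al))" using B by (simp add: k0_def)
    also have "t powr (1 + (1 - al) - 1) * Beta 1 (1 - al) = RL 1 (\<lambda>s. s powr (1 - al - 1)) t"
      using al t0 by (intro RL_powr(1)[symmetric]) auto
    also have "c * RL 1 (\<lambda>s. s powr (1 - al - 1)) t + RL 1 (\<lambda>s. s powr (- al) * RL 1 v s) t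
       = RL 1 (\<lambda>s. c * s powr (- al) + s powr (- al) * RL 1 v s) t"
    proof -
      have a: "integrable lborel (\<lambda>s. ind t s * s powr (- al))"
      proof -
        have "integrable lborel (\<lambda>s. ind t s * ((t - s) powr (1 - 1) * s powr (1 - al - 1)))"
          using al t0 by (intro RL_powr(2)) auto
        also have "(\<lambda>s. ind t s * ((t - s) powr (1 - 1) * s powr (1 - al - 1))) = (\<lambda>s. ind t s * s powr (- al))"
          by (auto simp: indicator_def)
        finally show ?thesis .
      qed
      have b: "integrable lborel (\<lambda>s. ind t s * (s powr (- al) * RL 1 v s))"
      proof -
        have "(\<lambda>r. ind t r * RL 1 w r) = (\<lambda>s. ind t s * (s powr (- al) * RL 1 v s))"
          using t by (auto simp: indicator_def Rw)
        then show ?thesis using integrable_ind_RL[OF w, of 1 t] by simp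
      qed
      have "RL 1 (\<lambda>s. c * s powr (- al) + s powr (- al) * RL 1 v s) t =
        (LINT s|lborel. c * (ind t s * s powr (- al)) + ind t s * (s powr (- al) * RL 1 v s))"
        unfolding RL_1 by (intro Bochner_Integration.integral_cong) (auto simp: algebra_simps)
      also have "\<dots> = c * RL 1 (\<lambda>s. s powr (1 - al - 1)) t + RL 1 (\<lambda>s. s powr (- al) * RL 1 v s) t"
        using Bochner_Integration.integral_add[OF integrable_mult_right[OF a, of c] b]
        by (simp add: RL_1)
      finally show ?thesis by simp
    qed
    also have "\<dots> = RL 1 (\<lambda>s. ind T s * (s powr (- al) * g s)) t"
      using t by (intro RL_cong) (auto simp: g algebra_simps)
    finally show ?thesis .
  qed (simp add: Gop_0 RL_def)
  then have "kop al u t = integral {0..t} g" if "t \<in> {0..T}" for t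
    using al T gc that by (intro kop_of_Gop[where T=T]) auto
  with u show ?thesis by (rule that)
qed

section \<open>Chain rule and Young integrals\<close>

lemma tagged_division_interval:
  fixes a b :: real
  assumes p: "p tagged_division_of {a..b}" and xk: "(x, k) \<in> p"
  obtains c d where "k = {c..d}" "c \<le> x" "x \<le> d" "a \<le> c" "d \<le> b" "Inf k = c" "Sup k = d"
proof -
  obtain c d where k: "k = {c..d}" using tagged_division_ofD(4)[OF p xk] unfolding box_real by blast
  have "x \<in> k" "k \<subseteq> {a..b}" using tagged_division_ofD(2,3)[OF p xk] by auto
  then show ?thesis using k by (intro that[of c d]) auto
qed

text \<open>The derivative of \<open>\<psi>\<close> is only integrable. The Henstock lemma replaces differentiability almost everywhere,
  and the gauge absorbs the lack of uniformity in \<open>strict\<close>.\<close>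

lemma has_integral_chain:
  fixes \<psi> \<psi>' :: "real \<Rightarrow> 'a::euclidean_space" and h :: "real \<Rightarrow> real" and L :: "real \<Rightarrow> 'a \<Rightarrow> real"
  assumes T: "0 \<le> T" and \<psi>: "\<And>t. t \<in> {0..T} \<Longrightarrow> (\<psi>' has_integral \<psi> t - \<psi> 0) {0..t}"
    and abs: "\<psi>' absolutely_integrable_on {0..T}"
    and L: "\<And>x. x \<in> {0..T} \<Longrightarrow> linear (L x)" "\<And>x v. x \<in> {0..T} \<Longrightarrow> \<bar>L x v\<bar> \<le> M * norm v"
    and strict: "\<And>x e. x \<in> {0..T} \<Longrightarrow> 0 < e \<Longrightarrow> \<exists>r>0. \<forall>y\<in>{0..T}. \<forall>z\<in>{0..T}. \<bar>y - x\<bar> < r \<longrightarrow> \<bar>z - x\<bar> < r \<longrightarrow>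
        \<bar>h y - h z - L x (\<psi> y - \<psi> z)\<bar> \<le> e * norm (\<psi> y - \<psi> z)"
  shows "((\<lambda>x. L x (\<psi>' x)) has_integral h T - h 0) {0..T}"
proof -
  have i: "\<psi>' integrable_on {0..T}" and ni: "(\<lambda>x. norm (\<psi>' x)) integrable_on {0..T}"
    using abs by (auto simp: absolutely_integrable_on_def)
  define I where "I = integral {0..T} (\<lambda>x. norm (\<psi>' x))"
  have I: "0 \<le> I" unfolding I_def by (intro integral_nonneg ni) auto
  have M: "0 \<le> M"
  proof -
    obtain v :: 'a where v: "v \<in> Basis" using nonempty_Basis by blast
    have "0 \<le> \<bar>L 0 v\<bar>" by simp
    also have "\<dots> \<le> M * norm v" using L(2)[of 0 v] T by simp
    finally show ?thesis using v by simp
  qed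
  have seg: "\<psi> d - \<psi> c = integral {c..d} \<psi>'" if "0 \<le> c" "c \<le> d" "d \<le> T" for c d
  proof -
    have "integral {0..c} \<psi>' + integral {c..d} \<psi>' = integral {0..d} \<psi>'"
      using that by (intro Henstock_Kurzweil_Integration.integral_combine integrable_on_subinterval[OF i]) auto
    moreover have "integral {0..c} \<psi>' = \<psi> c - \<psi> 0" "integral {0..d} \<psi>' = \<psi> d - \<psi> 0"
      using \<psi>[of c] \<psi>[of d] that by (auto intro: integral_unique)
    ultimately show ?thesis by (simp add: algebra_simps)
  qed
  have "((\<lambda>x. L x (\<psi>' x)) has_integral h T - h 0) (cbox 0 T)"
    unfolding has_integral
  proof (intro allI impI)
    fix e :: real assume e: "0 < e"
    \<comment> \<open>\<open>e1\<close> will be multiplied by the total variation \<open>I\<close>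
      and \<open>e2\<close> by the bound \<open>M\<close> of the linear maps; either may vanish,
      hence the added 1.\<close>
    define e1 where "e1 = e / (2 * (I + 1))"
    define e2 where "e2 = e / (2 * (M + 1))"
    have e12: "0 < e1" "0 < e2" using e I M by (auto simp: e1_def e2_def)
    obtain \<gamma> where g: "gauge \<gamma>" and le: "\<And>p. p tagged_partial_division_of (cbox 0 T) \<Longrightarrow> \<gamma> fine p \<Longrightarrow>
        (\<Sum>(x,k)\<in>p. norm (measure lborel k *\<^sub>R \<psi>' x - integral k \<psi>')) < e2"
      by (rule Henstock_lemma[OF i[folded box_real] e12(2)]) blast
    obtain r where r: "\<And>x. x \<in> {0..T} \<Longrightarrow> 0 < r x"
      "\<And>x y z. x \<in> {0..T} \<Longrightarrow> y \<in> {0..T} \<Longrightarrow> z \<in> {0..T} \<Longrightarrow> \<bar>y - x\<bar> < r x \<Longrightarrow> \<bar>z - x\<bar> < r x \<Longrightarrow>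
        \<bar>h y - h z - L x (\<psi> y - \<psi> z)\<bar> \<le> e1 * norm (\<psi> y - \<psi> z)"
      using strict[OF _ e12(1)] by metis
    define \<gamma>' where "\<gamma>' x = \<gamma> x \<inter> ball x (if x \<in> {0..T} then r x else 1)" for x
    have g': "gauge \<gamma>'" unfolding \<gamma>'_def using g r(1) by (intro gauge_Int) (auto simp: gauge_def)
    have "norm ((\<Sum>(x,k)\<in>p. measure lborel k *\<^sub>R L x (\<psi>' x)) - (h T - h 0)) < e"
      if p: "p tagged_division_of cbox 0 T" and fine: "\<gamma>' fine p" for p
    proof -
      have p': "p tagged_division_of {0..T}" using p by simp
      have fp: "finite p" using p by (rule tagged_division_of_finite)
      have "\<gamma> fine p" using fine by (auto simp: fine_def \<gamma>'_def)
      then have H: "(\<Sum>(x,k)\<in>p. norm (measure lborel k *\<^sub>R \<psi>' x - integral k \<psi>')) < e2"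
        using le p tagged_division_of_def by blast
      \<comment> \<open>The increment of \<open>h\<close> is compared with \<open>L x\<close> of the
        increment of \<psi>, at a cost controlled by the variation on \<open>k\<close>; that
        increment is then compared with the Riemann term, at the cost of the Henstock error. The
        increments of \<open>h\<close> telescope.\<close>
      have A: "\<bar>measure lborel k *\<^sub>R L x (\<psi>' x) - (h (Sup k) - h (Inf k))\<bar> \<le>
          e1 * integral k (\<lambda>x. norm (\<psi>' x)) + M * norm (measure lborel k *\<^sub>R \<psi>' x - integral k \<psi>')"
        if xk: "(x, k) \<in> p" for x k
      proof -
        obtain c d where k: "k = {c..d}" "c \<le> x" "x \<le> d" "0 \<le> c" "d \<le> T" "Inf k = c" "Sup k = d"
          using tagged_division_interval[OF p' xk] .
        have x: "x \<in> {0..T}" using k by auto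
        have "k \<subseteq> \<gamma>' x" using fine xk by (auto simp: fine_def)
        moreover have "c \<in> k" "d \<in> k" using k by auto
        ultimately have "c \<in> \<gamma>' x" "d \<in> \<gamma>' x" by auto
        then have dc: "\<bar>d - x\<bar> < r x" "\<bar>c - x\<bar> < r x"
          using x by (auto simp: \<gamma>'_def dist_real_def abs_minus_commute)
        have s: "\<psi> d - \<psi> c = integral k \<psi>'" using seg[of c d] k by simp
        have "\<bar>h d - h c - L x (\<psi> d - \<psi> c)\<bar> \<le> e1 * norm (integral k \<psi>')"
          using r(2)[OF x _ _ dc] k s by auto
        also have "norm (integral k \<psi>') \<le> integral k (\<lambda>x. norm (\<psi>' x))"
          unfolding k(1) using k i ni
          by (intro integral_norm_bound_integral integrable_on_subinterval[OF i] integrable_on_subinterval[OF ni]) auto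
        finally have 1: "\<bar>h d - h c - L x (\<psi> d - \<psi> c)\<bar> \<le> e1 * integral k (\<lambda>x. norm (\<psi>' x))"
          using e12 by (simp add: mult_left_mono)
        have "L x (measure lborel k *\<^sub>R \<psi>' x - integral k \<psi>') = measure lborel k *\<^sub>R L x (\<psi>' x) - L x (integral k \<psi>')"
          using L(1)[OF x] by (simp add: linear_diff linear_cmul)
        then have 2: "\<bar>measure lborel k *\<^sub>R L x (\<psi>' x) - L x (integral k \<psi>')\<bar> \<le> M * norm (measure lborel k *\<^sub>R \<psi>' x - integral k \<psi>')"
          using L(2)[OF x, of "measure lborel k *\<^sub>R \<psi>' x - integral k \<psi>'"] by simp
        show ?thesis using 1 2 unfolding s k(6,7) by linarith
      qed
      have "(\<Sum>(x,k)\<in>p. measure lborel k *\<^sub>R L x (\<psi>' x)) - (h T - h 0) =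
          (\<Sum>(x,k)\<in>p. measure lborel k *\<^sub>R L x (\<psi>' x) - (h (Sup k) - h (Inf k)))"
        using additive_tagged_division_1[OF T p', of h] by (simp add: case_prod_unfold sum_subtractf)
      also have "\<bar>\<dots>\<bar> \<le> (\<Sum>(x,k)\<in>p. e1 * integral k (\<lambda>x. norm (\<psi>' x)) + M * norm (measure lborel k *\<^sub>R \<psi>' x - integral k \<psi>'))"
        by (rule order_trans[OF sum_abs]) (use A in \<open>auto intro!: sum_mono\<close>)
      also have "\<dots> = e1 * (\<Sum>(x,k)\<in>p. integral k (\<lambda>x. norm (\<psi>' x))) + M * (\<Sum>(x,k)\<in>p. norm (measure lborel k *\<^sub>R \<psi>' x - integral k \<psi>'))"
        by (simp add: case_prod_unfold sum.distrib sum_distrib_left)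
      also have "(\<Sum>(x,k)\<in>p. integral k (\<lambda>x. norm (\<psi>' x))) = I"
        unfolding I_def using integral_combine_tagged_division_topdown[of "\<lambda>x. norm (\<psi>' x)" 0 T p] ni p by simp
      also have "e1 * I + M * (\<Sum>(x,k)\<in>p. norm (measure lborel k *\<^sub>R \<psi>' x - integral k \<psi>')) \<le> e1 * I + M * e2"
        using H M by (intro add_left_mono mult_left_mono) auto
      also have "\<dots> < e"
      proof -
        have "e1 * I < e / 2" "M * e2 < e / 2"
          using e I M by (auto simp: e1_def e2_def field_simps)
        then show ?thesis by linarith
      qed
      finally show ?thesis by simp
    qed
    then show "\<exists>\<gamma>. gauge \<gamma> \<and> (\<forall>\<D>. \<D> tagged_division_of cbox 0 T \<and> \<gamma> fine \<D> \<longrightarrow>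
        norm ((\<Sum>(x,k)\<in>\<D>. measure lborel k *\<^sub>R L x (\<psi>' x)) - (h T - h 0)) < e)" using g' by blast
  qed
  then show ?thesis by simp
qed

lemma continuous_on_has_integral:
  fixes f F :: "real \<Rightarrow> real"
  assumes T: "0 \<le> T" and F: "\<And>t. t \<in> {0..T} \<Longrightarrow> (f has_integral F t - F 0) {0..t}"
  shows "continuous_on {0..T} F"
proof -
  have "f integrable_on {0..T}" using F[of T] T by auto
  then have "continuous_on {0..T} (\<lambda>t. F 0 + integral {0..t} f)"
    by (intro continuous_intros indefinite_integral_continuous_1)
  then show ?thesis
    by (rule continuous_on_eq) (simp add: integral_unique[OF F])
qed

text \<open>The chain rule for the path (F,G) and the multiplication map. The remainder is exactly
  (G y - G x)(F y - F z) + (F z - F x)(G y - G z), so continuity of F and G gives the required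
  strictness.\<close>

lemma has_integral_product:
  fixes f g F G :: "real \<Rightarrow> real"
  assumes T: "0 \<le> T"
    and F: "\<And>t. t \<in> {0..T} \<Longrightarrow> (f has_integral F t - F 0) {0..t}" and f: "f absolutely_integrable_on {0..T}"
    and G: "\<And>t. t \<in> {0..T} \<Longrightarrow> (g has_integral G t - G 0) {0..t}" and g: "g absolutely_integrable_on {0..T}"
  shows "((\<lambda>x. f x * G x + F x * g x) has_integral F T * G T - F 0 * G 0) {0..T}"
proof -
  have cF: "continuous_on {0..T} F" and cG: "continuous_on {0..T} G"
    using continuous_on_has_integral[OF T] F G by blast+
  obtain B1 B2 where B: "\<forall>x\<in>{0..T}. \<bar>F x\<bar> \<le> B1" "\<forall>x\<in>{0..T}. \<bar>G x\<bar> \<le> B2"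
    using continuous_Icc_bounded[OF cF] continuous_Icc_bounded[OF cG] by blast
  define \<psi> where "\<psi> t = (F t, G t)" for t
  define \<psi>' where "\<psi>' t = (f t, g t)" for t
  define L where "L x = (\<lambda>v. G x * fst v + F x * snd v)" for x
  have pr: "\<bar>fst v\<bar> \<le> norm v" "\<bar>snd v\<bar> \<le> norm v" for v :: "real \<times> real"
    using norm_fst_le[of "fst v" "snd v"] norm_snd_le[of "snd v" "fst v"] by auto
  have "((\<lambda>x. L x (\<psi>' x)) has_integral F T * G T - F 0 * G 0) {0..T}"
  proof (rule has_integral_chain[where \<psi>=\<psi> and M="B1 + B2" and h="\<lambda>t. F t * G t", OF T])
    fix t assume t: "t \<in> {0..T}"
    have "((\<lambda>x. f x *\<^sub>R (1::real, 0) + g x *\<^sub>R (0, 1::real)) has_integral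
        (F t - F 0) *\<^sub>R (1::real, 0) + (G t - G 0) *\<^sub>R (0, 1)) {0..t}"
      by (intro has_integral_add has_integral_scaleR_left F G t)
    then show "(\<psi>' has_integral \<psi> t - \<psi> 0) {0..t}" by (simp add: \<psi>'_def[abs_def] \<psi>_def)
  next
    have "(\<lambda>x. f x *\<^sub>R (1::real, 0) + g x *\<^sub>R (0, 1::real)) absolutely_integrable_on {0..T}"
      by (intro set_integral_add absolutely_integrable_scaleR_right f g)
    then show "\<psi>' absolutely_integrable_on {0..T}" by (simp add: \<psi>'_def[abs_def])
  next
    fix x show "linear (L x)" unfolding L_def by (auto intro!: linearI simp: algebra_simps)
  next
    fix x v assume x: "x \<in> {0..T}"
    have "\<bar>L x v\<bar> \<le> \<bar>G x\<bar> * \<bar>fst v\<bar> + \<bar>F x\<bar> * \<bar>snd v\<bar>"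
      unfolding L_def by (metis abs_mult abs_triangle_ineq)
    also have "\<dots> \<le> B2 * norm v + B1 * norm v"
      using B x pr[of v] by (intro add_mono mult_mono) auto
    finally show "\<bar>L x v\<bar> \<le> (B1 + B2) * norm v" by (simp add: algebra_simps)
  next
    fix x e :: real assume x: "x \<in> {0..T}" and e: "0 < e"
    obtain r1 where r1: "0 < r1" "\<And>y. y \<in> {0..T} \<Longrightarrow> dist y x < r1 \<Longrightarrow> dist (F y) (F x) < e / 2"
      using cF x e unfolding continuous_on_iff by (metis half_gt_zero)
    obtain r2 where r2: "0 < r2" "\<And>y. y \<in> {0..T} \<Longrightarrow> dist y x < r2 \<Longrightarrow> dist (G y) (G x) < e / 2"
      using cG x e unfolding continuous_on_iff by (metis half_gt_zero)
    have "\<bar>F y * G y - F z * G z - L x (\<psi> y - \<psi> z)\<bar> \<le> e * norm (\<psi> y - \<psi> z)"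
      if "y \<in> {0..T}" "z \<in> {0..T}" "\<bar>y - x\<bar> < min r1 r2" "\<bar>z - x\<bar> < min r1 r2" for y z
    proof -
      have a: "\<bar>G y - G x\<bar> \<le> e / 2" "\<bar>F z - F x\<bar> \<le> e / 2"
        using r1(2)[of z] r2(2)[of y] that by (auto simp: dist_real_def)
      have n: "\<bar>F y - F z\<bar> \<le> norm (\<psi> y - \<psi> z)" "\<bar>G y - G z\<bar> \<le> norm (\<psi> y - \<psi> z)"
        using pr[of "\<psi> y - \<psi> z"] by (auto simp: \<psi>_def)
      have "F y * G y - F z * G z - L x (\<psi> y - \<psi> z) = (G y - G x) * (F y - F z) + (F z - F x) * (G y - G z)"
        by (simp add: L_def \<psi>_def algebra_simps)
      also have "\<bar>\<dots>\<bar> \<le> \<bar>G y - G x\<bar> * \<bar>F y - F z\<bar> + \<bar>F z - F x\<bar> * \<bar>G y - G z\<bar>"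
        by (metis abs_mult abs_triangle_ineq)
      also have "\<dots> \<le> e / 2 * norm (\<psi> y - \<psi> z) + e / 2 * norm (\<psi> y - \<psi> z)"
        using a n e by (intro add_mono mult_mono) auto
      finally show ?thesis by simp
    qed
    then show "\<exists>r>0. \<forall>y\<in>{0..T}. \<forall>z\<in>{0..T}. \<bar>y - x\<bar> < r \<longrightarrow> \<bar>z - x\<bar> < r \<longrightarrow>
        \<bar>F y * G y - F z * G z - L x (\<psi> y - \<psi> z)\<bar> \<le> e * norm (\<psi> y - \<psi> z)"
      using r1(1) r2(1) by (intro exI[of _ "min r1 r2"]) auto
  qed
  then show ?thesis by (simp add: L_def \<psi>'_def mult.commute)
qed

text \<open>The integrator \<open>g\<close> is only continuous and may have unbounded variation, so
  the smoothness of \<open>s\<close> must be used: integration by parts moves the derivative onto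
  \<open>s\<close>. Uniform continuity of \<open>g\<close> provides a radius independent of the tag,
  as the definition of the Young integral demands.\<close>

lemma Stieltjes_sum_limit:
  fixes s s' g :: "real \<Rightarrow> real"
  assumes s: "\<And>r. r \<in> {0..T} \<Longrightarrow> (s has_real_derivative s' r) (at r within {0..T})"
    and s': "continuous_on {0..T} s'" and g: "continuous_on {0..T} g" and t: "0 \<le> t" "t \<le> T" and e: "0 < e"
  shows "\<exists>\<delta>>0. \<forall>p. p tagged_division_of {0..t} \<longrightarrow> (\<lambda>x. ball x \<delta>) fine p \<longrightarrow>
     \<bar>(\<Sum>(x,k)\<in>p. s x * (g (Sup k) - g (Inf k))) - (s t * g t - s 0 * g 0 - integral {0..t} (\<lambda>r. s' r * g r))\<bar> < e"
proof -
  obtain M where M: "0 \<le> M" "\<forall>x\<in>{0..T}. \<bar>s' x\<bar> \<le> M" using continuous_Icc_bounded[OF s'] by blast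
  \<comment> \<open>The total error will be at most \<open>M * T * \<eta>\<close>, which this choice
    makes smaller than \<open>e\<close> even if \<open>M\<close> is 0.\<close>
  define \<eta> where "\<eta> = e / (M * T + 1)"
  have MT: "0 < M * T + 1" using M(1) t by (smt (verit) mult_nonneg_nonneg)
  have \<eta>: "0 < \<eta>" using e MT by (simp add: \<eta>_def)
  have "uniformly_continuous_on {0..T} g" using g by (intro compact_uniformly_continuous) auto
  then obtain \<delta> where \<delta>: "0 < \<delta>" "\<And>x y. x \<in> {0..T} \<Longrightarrow> y \<in> {0..T} \<Longrightarrow> dist y x < \<delta> \<Longrightarrow> dist (g y) (g x) < \<eta>"
    using \<eta> unfolding uniformly_continuous_on_def by metis
  have c1: "continuous_on {a..b} s'" and c2: "continuous_on {a..b} (\<lambda>r. s' r * g r)" if "0 \<le> a" "b \<le> T" for a b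
    using continuous_on_subset[OF s', of "{a..b}"] continuous_on_subset[OF g, of "{a..b}"] that
    by (auto intro!: continuous_intros)
  have FTC: "(s' has_integral s b - s a) {a..b}" if "0 \<le> a" "a \<le> b" "b \<le> T" for a b
    using that by (intro fundamental_theorem_of_calculus)
     (auto simp: has_real_derivative_iff_has_vector_derivative[symmetric] intro!: DERIV_subset[OF s])
  have E: "\<bar>integral {a..b} (\<lambda>r. s' r * g r) - (s b - s a) * g q\<bar> \<le> M * \<eta> * (b - a)"
    if ab: "0 \<le> a" "a \<le> b" "b \<le> T" "b - a < \<delta>" "q \<in> {a..b}" for a b q
  proof -
    have "((\<lambda>r. s' r * g r - s' r * g q) has_integral (integral {a..b} (\<lambda>r. s' r * g r) - (s b - s a) * g q)) {a..b}"
      using FTC[OF ab(1-3)] integrable_integral[OF integrable_continuous_real[OF c2[of a b]]] ab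
      by (intro has_integral_diff has_integral_mult_left) auto
    then have "((\<lambda>r. s' r * (g r - g q)) has_integral (integral {a..b} (\<lambda>r. s' r * g r) - (s b - s a) * g q)) (cbox a b)"
      by (simp add: algebra_simps)
    then have "norm (integral {a..b} (\<lambda>r. s' r * g r) - (s b - s a) * g q) \<le> (M * \<eta>) * measure lborel (cbox a b)"
    proof (rule has_integral_bound[rotated])
      fix r assume r: "r \<in> cbox a b"
      have "\<bar>r - q\<bar> \<le> b - a" using r ab by (auto simp: abs_le_iff)
      then have "\<bar>g r - g q\<bar> \<le> \<eta>" using \<delta>(2)[of q r] r ab by (auto simp: dist_real_def)
      then show "norm (s' r * (g r - g q)) \<le> M * \<eta>"
        using M r ab by (auto simp: abs_mult intro!: mult_mono)
    qed (use M \<eta> in auto)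
    then show ?thesis using ab by simp
  qed
  \<comment> \<open>The increments of \<Psi> are what the Stieltjes terms approximate, and they
    telescope. Balls of half the radius \<delta> force the intervals of the division to be shorter
    than \<delta>.\<close>
  define \<Psi> where "\<Psi> r = s r * g r - integral {0..r} (\<lambda>r. s' r * g r)" for r
  have "\<bar>(\<Sum>(x,k)\<in>p. s x * (g (Sup k) - g (Inf k))) - (s t * g t - s 0 * g 0 - integral {0..t} (\<lambda>r. s' r * g r))\<bar> < e"
    if p: "p tagged_division_of {0..t}" and fine: "(\<lambda>x. ball x (\<delta>/2)) fine p" for p
  proof -
    have A: "\<bar>s x * (g (Sup k) - g (Inf k)) - (\<Psi> (Sup k) - \<Psi> (Inf k))\<bar> \<le> M * \<eta> * (Sup k - Inf k)"
      if xk: "(x, k) \<in> p" for x k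
    proof -
      obtain c d where k: "k = {c..d}" "c \<le> x" "x \<le> d" "0 \<le> c" "d \<le> t" "Inf k = c" "Sup k = d"
        using tagged_division_interval[OF p xk] .
      have "k \<subseteq> ball x (\<delta>/2)" using fine xk by (auto simp: fine_def)
      moreover have "c \<in> k" "d \<in> k" using k by auto
      ultimately have "c \<in> ball x (\<delta>/2)" "d \<in> ball x (\<delta>/2)" by auto
      then have dc: "d - c < \<delta>" unfolding mem_ball dist_real_def by linarith
      have i: "integral {c..x} (\<lambda>r. s' r * g r) + integral {x..d} (\<lambda>r. s' r * g r) = integral {c..d} (\<lambda>r. s' r * g r)"
        "integral {0..c} (\<lambda>r. s' r * g r) + integral {c..d} (\<lambda>r. s' r * g r) = integral {0..d} (\<lambda>r. s' r * g r)"
        using k t by (auto intro!: Henstock_Kurzweil_Integration.integral_combine integrable_continuous_real c2)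
      \<comment> \<open>Splitting at the tag x pairs the value of \<open>g\<close> at each end point
        with the increment of \<open>s\<close> on the adjacent piece; on each piece \<open>g\<close>
        is nearly constant.\<close>
      have "s x * (g d - g c) - (\<Psi> d - \<Psi> c) =
        (integral {c..x} (\<lambda>r. s' r * g r) - (s x - s c) * g c) + (integral {x..d} (\<lambda>r. s' r * g r) - (s d - s x) * g d)"
        using i by (simp add: \<Psi>_def algebra_simps)
      also have "\<bar>\<dots>\<bar> \<le> M * \<eta> * (x - c) + M * \<eta> * (d - x)"
        using E[of c x c] E[of x d d] k t dc by (intro order_trans[OF abs_triangle_ineq] add_mono) auto
      finally show ?thesis unfolding k(6,7) by (simp add: algebra_simps)
    qed
    have "(\<Sum>(x,k)\<in>p. s x * (g (Sup k) - g (Inf k))) - (\<Psi> t - \<Psi> 0) =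
        (\<Sum>(x,k)\<in>p. s x * (g (Sup k) - g (Inf k)) - (\<Psi> (Sup k) - \<Psi> (Inf k)))"
      using additive_tagged_division_1[OF t(1) p, of \<Psi>] by (simp add: case_prod_unfold sum_subtractf)
    also have "\<bar>\<dots>\<bar> \<le> (\<Sum>(x,k)\<in>p. M * \<eta> * (Sup k - Inf k))"
      by (rule order_trans[OF sum_abs]) (use A in \<open>auto intro!: sum_mono\<close>)
    also have "\<dots> = M * \<eta> * (t - 0)"
      using additive_tagged_division_1[OF t(1) p, of "\<lambda>x. x"] by (simp add: case_prod_unfold sum_distrib_left[symmetric])
    also have "\<dots> \<le> (M * T) * \<eta>" using mult_left_mono[of t T "M * \<eta>"] M(1) \<eta> t by (simp add: mult_ac)
    also have "\<dots> < (M * T + 1) * \<eta>" using \<eta> by simp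
    also have "\<dots> = e" using MT by (simp add: \<eta>_def)
    finally show ?thesis by (simp add: \<Psi>_def)
  qed
  then show ?thesis using \<delta>(1) by (intro exI[of _ "\<delta>/2"]) auto
qed

text \<open>A division that is fine for the smaller of the two radii exists, and its sum is close to
  both values. This gives a meaning to the description in \<open>young_integral\<close>.\<close>

lemma has_young_integral_unique:
  assumes "has_young_integral f g I a b" "has_young_integral f g J a b"
  shows "I = J"
proof (rule ccontr)
  assume "I \<noteq> J"
  then have e: "0 < norm (I - J) / 2" by simp
  obtain d1 where d1: "0 < d1" "\<forall>p. p tagged_division_of {a..b} \<and> (\<lambda>x. ball x d1) fine p \<longrightarrow>
      norm ((\<Sum>(x, k)\<in>p. f x *v (g (Sup k) - g (Inf k))) - I) < norm (I - J) / 2"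
    using assms(1)[unfolded has_young_integral_def, rule_format, OF e] by auto
  obtain d2 where d2: "0 < d2" "\<forall>p. p tagged_division_of {a..b} \<and> (\<lambda>x. ball x d2) fine p \<longrightarrow>
      norm ((\<Sum>(x, k)\<in>p. f x *v (g (Sup k) - g (Inf k))) - J) < norm (I - J) / 2"
    using assms(2)[unfolded has_young_integral_def, rule_format, OF e] by auto
  have "gauge (\<lambda>x::real. ball x (min d1 d2))" using d1 d2 by (auto simp: gauge_def)
  then obtain p where p: "p tagged_division_of {a..b}" "(\<lambda>x. ball x (min d1 d2)) fine p"
    by (rule fine_division_exists_real)
  define S where "S = (\<Sum>(x, k)\<in>p. f x *v (g (Sup k) - g (Inf k)))"
  have "ball x (min d1 d2) \<subseteq> ball x d1" "ball x (min d1 d2) \<subseteq> ball x d2" for x :: real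
    by (auto intro!: subset_ball)
  then have "(\<lambda>x. ball x d1) fine p" "(\<lambda>x. ball x d2) fine p"
    using p(2) unfolding fine_def by blast+
  then have "norm (S - I) < norm (I - J) / 2" "norm (S - J) < norm (I - J) / 2"
    unfolding S_def using d1(2) d2(2) p(1) by blast+
  moreover have "norm (I - J) \<le> norm (S - J) + norm (S - I)"
    using norm_triangle_ineq4[of "S - J" "S - I"] by simp
  ultimately show False by linarith
qed

text \<open>A diagonal matrix decouples the components, and the smallest of the finitely many radii
  serves all of them. From here on the Young integral is replaced by its integrated-by-parts
  form.\<close>

lemma young_integral_diagonal:
  fixes \<sigma> :: "real \<Rightarrow> real^'n^'n" and g :: "real \<Rightarrow> real^'n"
  assumes diag: "\<And>t i j. t \<in> {0..T} \<Longrightarrow> i \<noteq> j \<Longrightarrow> \<sigma> t $ i $ j = 0"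
    and s: "\<And>i r. r \<in> {0..T} \<Longrightarrow> ((\<lambda>t. \<sigma> t $ i $ i) has_real_derivative s' i r) (at r within {0..T})"
    and s': "\<And>i. continuous_on {0..T} (s' i)" and g: "\<And>i. continuous_on {0..T} (\<lambda>t. g t $ i)" and t: "0 \<le> t" "t \<le> T"
  shows "young_integral \<sigma> g 0 t =
    (\<chi> i. \<sigma> t $ i $ i * g t $ i - \<sigma> 0 $ i $ i * g 0 $ i - integral {0..t} (\<lambda>r. s' i r * g r $ i))" (is "_ = ?I")
proof -
  have hy: "has_young_integral \<sigma> g ?I 0 t"
    unfolding has_young_integral_def
  proof (intro allI impI)
    fix e :: real assume e: "0 < e"
    then have e': "0 < e / real CARD('n)" by simp
    have ex: "\<forall>i. \<exists>\<delta>>0. \<forall>p. p tagged_division_of {0..t} \<longrightarrow> (\<lambda>x. ball x \<delta>) fine p \<longrightarrow>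
     \<bar>(\<Sum>(x,k)\<in>p. \<sigma> x $ i $ i * (g (Sup k) $ i - g (Inf k) $ i)) - ?I $ i\<bar> < e / real CARD('n)"
    proof
      fix i
      show "\<exists>\<delta>>0. \<forall>p. p tagged_division_of {0..t} \<longrightarrow> (\<lambda>x. ball x \<delta>) fine p \<longrightarrow>
       \<bar>(\<Sum>(x,k)\<in>p. \<sigma> x $ i $ i * (g (Sup k) $ i - g (Inf k) $ i)) - ?I $ i\<bar> < e / real CARD('n)"
        unfolding vec_lambda_beta by (rule Stieltjes_sum_limit[OF s s' g t e'])
    qed
    obtain \<delta> where \<delta>: "\<forall>i. 0 < \<delta> i \<and> (\<forall>p. p tagged_division_of {0..t} \<longrightarrow> (\<lambda>x. ball x (\<delta> i)) fine p \<longrightarrow>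
     \<bar>(\<Sum>(x,k)\<in>p. \<sigma> x $ i $ i * (g (Sup k) $ i - g (Inf k) $ i)) - ?I $ i\<bar> < e / real CARD('n))"
      by (rule exE[OF choice[OF ex]]) (rule that)
    have "norm ((\<Sum>(x, k)\<in>p. \<sigma> x *v (g (Sup k) - g (Inf k))) - ?I) < e"
      if p: "p tagged_division_of {0..t}" and fine: "(\<lambda>x. ball x (Min (range \<delta>))) fine p" for p
    proof -
      have fine: "(\<lambda>x. ball x (\<delta> i)) fine p" for i
      proof -
        have "ball x (Min (range \<delta>)) \<subseteq> ball x (\<delta> i)" for x by (intro subset_ball) simp
        then show ?thesis using fine unfolding fine_def by blast
      qed
      have comp: "(\<Sum>(x, k)\<in>p. \<sigma> x *v (g (Sup k) - g (Inf k))) $ i = (\<Sum>(x,k)\<in>p. \<sigma> x $ i $ i * (g (Sup k) $ i - g (Inf k) $ i))" for i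
        unfolding sum_component
      proof (rule sum.cong, simp, clarify)
        fix x k assume xk: "(x, k) \<in> p"
        then have x: "x \<in> {0..T}" using tagged_division_ofD(2,3)[OF p xk] t by auto
        have "(\<sigma> x *v (g (Sup k) - g (Inf k))) $ i = (\<Sum>j\<in>UNIV. if j = i then \<sigma> x $ i $ i * (g (Sup k) $ i - g (Inf k) $ i) else 0)"
          unfolding matrix_vector_mult_def vec_lambda_beta
          by (rule sum.cong) (use diag[OF x, of i] in auto)
        then show "(\<sigma> x *v (g (Sup k) - g (Inf k))) $ i = \<sigma> x $ i $ i * (g (Sup k) $ i - g (Inf k) $ i)" by simp
      qed
      have "norm ((\<Sum>(x, k)\<in>p. \<sigma> x *v (g (Sup k) - g (Inf k))) - ?I) \<le> (\<Sum>i\<in>UNIV. \<bar>((\<Sum>(x, k)\<in>p. \<sigma> x *v (g (Sup k) - g (Inf k))) - ?I) $ i\<bar>)"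
        by (rule norm_le_l1_cart)
      also have "\<dots> < (\<Sum>i\<in>(UNIV::'n set). e / real CARD('n))"
      proof (intro sum_strict_mono)
        fix i
        show "\<bar>((\<Sum>(x, k)\<in>p. \<sigma> x *v (g (Sup k) - g (Inf k))) - ?I) $ i\<bar> < e / real CARD('n)"
          unfolding vector_minus_component comp using \<delta> p fine by blast
      qed auto
      finally show ?thesis by simp
    qed
    moreover have "0 < Min (range \<delta>)" using \<delta> by (subst Min_gr_iff) auto
    ultimately show "\<exists>\<delta>>0. \<forall>p. p tagged_division_of {0..t} \<and> (\<lambda>x. ball x \<delta>) fine p \<longrightarrow>
        norm ((\<Sum>(x, k)\<in>p. \<sigma> x *v (g (Sup k) - g (Inf k))) - ?I) < e" by blast
  qed
  show ?thesis unfolding young_integral_def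
    by (rule the_equality, rule hy, rule has_young_integral_unique[OF _ hy])
qed

section \<open>The operator with diffusion coefficient\<close>

text \<open>Maximise exp(-2 L t) f(t). At the maximum the integral term amounts to at most half of
  the left-hand side and can be absorbed, which explains the factors 2.\<close>

lemma Gronwall_integral:
  fixes f :: "real \<Rightarrow> real"
  assumes f: "continuous_on {0..T} f" and A: "0 \<le> A" and L: "0 < L"
    and le: "\<And>t. t \<in> {0..T} \<Longrightarrow> f t \<le> A + L * integral {0..t} f" and t: "t \<in> {0..T}"
  shows "f t \<le> 2 * A * exp (2 * L * T)"
proof -
  have "continuous_on {0..T} (\<lambda>t. exp (- (2 * L * t)) * f t)" by (intro continuous_intros f)
  then obtain t0 where t0: "t0 \<in> {0..T}" "\<And>s. s \<in> {0..T} \<Longrightarrow> exp (- (2 * L * s)) * f s \<le> exp (- (2 * L * t0)) * f t0"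
    using continuous_attains_sup[of "{0..T}" "\<lambda>t. exp (- (2 * L * t)) * f t"] t by auto
  define m where "m = exp (- (2 * L * t0)) * f t0"
  have fm: "f s \<le> m * exp (2 * L * s)" if "s \<in> {0..T}" for s
    using mult_right_mono[OF t0(2)[OF that], of "exp (2 * L * s)"] by (simp add: m_def exp_minus field_simps)
  have ft0: "f t0 = m * exp (2 * L * t0)" by (simp add: m_def exp_minus)
  have "m \<le> 2 * A"
  proof (cases "m \<le> 0")
    case False
    have i: "((\<lambda>s. m * exp (2 * L * s)) has_integral m * exp (2 * L * t0) / (2 * L) - m * exp (2 * L * 0) / (2 * L)) {0..t0}"
      using t0(1) L by (intro fundamental_theorem_of_calculus)
        (auto intro!: derivative_eq_intros simp: has_real_derivative_iff_has_vector_derivative[symmetric])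
    have "integral {0..t0} f \<le> integral {0..t0} (\<lambda>s. m * exp (2 * L * s))"
      using t0(1) fm i continuous_on_subset[OF f, of "{0..t0}"]
      by (intro integral_le integrable_continuous_real) (auto intro!: continuous_intros)
    also have "\<dots> \<le> m * exp (2 * L * t0) / (2 * L)"
      using integral_unique[OF i] False L by simp
    finally have "L * integral {0..t0} f \<le> m * exp (2 * L * t0) / 2"
      using L by (simp add: field_simps)
    then have "m * exp (2 * L * t0) \<le> 2 * A" using le[OF t0(1)] ft0 by simp
    moreover have "m * 1 \<le> m * exp (2 * L * t0)" using False L t0(1) by (intro mult_left_mono) auto
    ultimately show ?thesis by simp
  qed (use A in simp)
  then have "f t \<le> 2 * A * exp (2 * L * t)"
    by (intro order_trans[OF fm[OF t]] mult_right_mono) auto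
  also have "\<dots> \<le> 2 * A * exp (2 * L * T)" using t A L by (intro mult_left_mono) auto
  finally show ?thesis .
qed

lemma c_const_pos: "0 < H \<Longrightarrow> H < 1 \<Longrightarrow> 0 < c_const H"
  by (simp add: c_const_def Gamma_real_pos)

lemma sq_int_mult_continuous:
  assumes v: "sq_int T v" and f: "continuous_on {0..T} f"
  shows "sq_int T (\<lambda>s. f s * v s)"
proof -
  note [measurable] = sq_intD(1)[OF v]
  obtain M where [measurable]: "(\<lambda>s. ind T s * f s) \<in> borel_measurable borel" and M: "0 \<le> M"
    "\<And>s. s \<in> {0..T} \<Longrightarrow> \<bar>f s\<bar> \<le> M" using continuous_Ioo_extension[OF f] by blast
  have e: "(\<lambda>s. f s * v s) = (\<lambda>s. (ind T s * f s) * v s)"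
    using sq_intD(3)[OF v] by (auto simp: indicator_def fun_eq_iff)
  have m: "(\<lambda>s. f s * v s) \<in> borel_measurable borel" unfolding e by measurable
  have "integrable lborel (\<lambda>s. (f s * v s)^2)"
  proof (rule Bochner_Integration.integrable_bound)
    show "integrable lborel (\<lambda>s. M^2 * (v s)^2)" using sq_intD(2)[OF v] by simp
    show "(\<lambda>s. (f s * v s)^2) \<in> borel_measurable lborel" using m by simp
    show "AE s in lborel. norm ((f s * v s)^2) \<le> norm (M^2 * (v s)^2)"
    proof (rule AE_I2)
      fix s show "norm ((f s * v s)^2) \<le> norm (M^2 * (v s)^2)"
      proof (cases "s \<in> {0<..<T}")
        case True
        then have "\<bar>f s\<bar>^2 \<le> M^2" using M(2)[of s] by (intro power_mono) auto
        then show ?thesis by (simp add: power_mult_distrib mult_right_mono)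
      qed (simp add: sq_intD(3)[OF v])
    qed
  qed
  then show ?thesis using m sq_intD(3)[OF v] by (auto simp: sq_int_def)
qed

text \<open>A component of \<open>K\<^sub>H\<^sup>\<sigma>\<close>: the Young integral \<open>\<integral> s d(K\<^sub>H w)\<close>, integrated by parts.\<close>

definition Sop :: "real \<Rightarrow> (real \<Rightarrow> real) \<Rightarrow> (real \<Rightarrow> real) \<Rightarrow> (real \<Rightarrow> real) \<Rightarrow> real \<Rightarrow> real" where
  "Sop H s s' w t = c_const H * (s t * kop (H - 1/2) w t - integral {0..t} (\<lambda>r. s' r * kop (H - 1/2) w r))"

lemma sq_int_abs_integrable:
  assumes v: "sq_int T v"
  shows "v absolutely_integrable_on {0..T}"
proof -
  have "integrable lborel v" using v by (rule sq_int_integrable)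
  then have "integrable lebesgue v" by (subst integrable_completion) auto
  then have "v absolutely_integrable_on UNIV" by (simp add: set_integrable_def)
  then show ?thesis by (rule set_integrable_subset) auto
qed

locale diffusion_coefficient =
  fixes H T :: real and s s' :: "real \<Rightarrow> real" and m :: real
  assumes H: "0 < H" "H < 1" and T: "0 < T" and m: "0 < m"
    and s: "\<And>r. r \<in> {0..T} \<Longrightarrow> (s has_real_derivative s' r) (at r within {0..T})"
    and s': "continuous_on {0..T} s'" and s_ge: "\<And>r. r \<in> {0..T} \<Longrightarrow> m \<le> s r"
begin

lemma al: "\<bar>H - 1/2\<bar> < 1/2" using H by linarith

lemma s_cont: "continuous_on {0..T} s"
  using s by (intro DERIV_continuous_on) auto

lemma kop_cont: "sq_int T w \<Longrightarrow> continuous_on {0..T} (kop (H - 1/2) w)"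
  using continuous_on_kop[OF al _ T] .

lemma s'_kop: 
  assumes "sq_int T w" "t \<in> {0..T}"
  shows "continuous_on {0..t} (\<lambda>r. s' r * kop (H - 1/2) w r)" "(\<lambda>r. s' r * kop (H - 1/2) w r) integrable_on {0..t}"
proof -
  have "continuous_on {0..T} (\<lambda>r. s' r * kop (H - 1/2) w r)" by (intro continuous_intros s' kop_cont assms)
  then show "continuous_on {0..t} (\<lambda>r. s' r * kop (H - 1/2) w r)"
    using assms by (auto elim: continuous_on_subset)
  then show "(\<lambda>r. s' r * kop (H - 1/2) w r) integrable_on {0..t}" by (rule integrable_continuous_real)
qed

lemma Sop_diff:
  assumes "sq_int T u" "sq_int T v" "t \<in> {0..T}"
  shows "Sop H s s' (\<lambda>x. u x - v x) t = Sop H s s' u t - Sop H s s' v t"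
proof -
  have "integral {0..t} (\<lambda>r. s' r * kop (H - 1/2) (\<lambda>x. u x - v x) r) =
      integral {0..t} (\<lambda>r. s' r * kop (H - 1/2) u r - s' r * kop (H - 1/2) v r)"
    by (rule integral_cong) (use assms in \<open>auto simp: kop_diff[OF al] right_diff_distrib\<close>)
  also have "\<dots> = integral {0..t} (\<lambda>r. s' r * kop (H - 1/2) u r) - integral {0..t} (\<lambda>r. s' r * kop (H - 1/2) v r)"
    using assms by (intro Henstock_Kurzweil_Integration.integral_diff s'_kop)
  finally have I: "integral {0..t} (\<lambda>r. s' r * kop (H - 1/2) (\<lambda>x. u x - v x) r) = \<dots>" .
  have k: "kop (H - 1/2) (\<lambda>x. u x - v x) t = kop (H - 1/2) u t - kop (H - 1/2) v t"
    using assms by (intro kop_diff[OF al]) auto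
  show ?thesis unfolding Sop_def I k by (simp add: algebra_simps)
qed

lemma s_bounds:
  obtains M where "0 \<le> M" "\<And>r. r \<in> {0..T} \<Longrightarrow> \<bar>s r\<bar> \<le> M \<and> \<bar>s' r\<bar> \<le> M"
proof -
  obtain M1 where "0 \<le> M1" "\<forall>r\<in>{0..T}. \<bar>s r\<bar> \<le> M1" using continuous_Icc_bounded[OF s_cont] by blast
  moreover obtain M2 where "0 \<le> M2" "\<forall>r\<in>{0..T}. \<bar>s' r\<bar> \<le> M2" using continuous_Icc_bounded[OF s'] by blast
  ultimately show ?thesis by (intro that[of "max M1 M2"]) (auto simp: le_max_iff_disj)
qed

lemma Sop_bound:
  obtains C where "0 \<le> C" "\<And>w t. sq_int T w \<Longrightarrow> t \<in> {0..T} \<Longrightarrow> \<bar>Sop H s s' w t\<bar> \<le> C * l2 w"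
proof -
  obtain K where K: "0 \<le> K" "\<And>u t. sq_int T u \<Longrightarrow> t \<in> {0..T} \<Longrightarrow> \<bar>kop (H - 1/2) u t\<bar> \<le> K * l2 u"
    using kop_bound[OF al T] by blast
  obtain M where M: "0 \<le> M" "\<And>r. r \<in> {0..T} \<Longrightarrow> \<bar>s r\<bar> \<le> M \<and> \<bar>s' r\<bar> \<le> M" using s_bounds by blast
  define C where "C = c_const H * (M * K + M * K * T)"
  have c: "0 < c_const H" using H by (rule c_const_pos)
  show ?thesis
  proof (rule that[of C])
    show "0 \<le> C" unfolding C_def using c M K T by simp
    fix w t assume w: "sq_int T w" and t: "t \<in> {0..T}"
    have b: "\<bar>s' r * kop (H - 1/2) w r\<bar> \<le> M * K * l2 w" "\<bar>s r * kop (H - 1/2) w r\<bar> \<le> M * K * l2 w" if "r \<in> {0..T}" for r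
      using M(2)[OF that] K(2)[OF w that] M(1) unfolding abs_mult mult.assoc by (auto intro!: mult_mono)
    have "norm (integral {0..t} (\<lambda>r. s' r * kop (H - 1/2) w r)) \<le> M * K * l2 w * (t - 0)"
      using t b s'_kop[OF w t] by (intro integral_bound) auto
    also have "\<dots> \<le> M * K * l2 w * T" using t M K l2_nonneg[of w] by (intro mult_left_mono) auto
    finally have "\<bar>s t * kop (H - 1/2) w t - integral {0..t} (\<lambda>r. s' r * kop (H - 1/2) w r)\<bar> \<le> M * K * l2 w + M * K * l2 w * T"
      using b(2)[OF t] by (simp add: abs_le_iff)
    then have "c_const H * \<bar>s t * kop (H - 1/2) w t - integral {0..t} (\<lambda>r. s' r * kop (H - 1/2) w r)\<bar> \<le> c_const H * (M * K * l2 w + M * K * l2 w * T)"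
      using c by (intro mult_left_mono) auto
    then show "\<bar>Sop H s s' w t\<bar> \<le> C * l2 w"
      unfolding Sop_def abs_mult abs_of_pos[OF c] C_def by (simp only: distrib_left distrib_right mult_ac)
  qed
qed

lemma Sop_cont:
  assumes w: "sq_int T w"
  shows "continuous_on {0..T} (Sop H s s' w)"
  unfolding Sop_def[abs_def] using T
  by (intro continuous_intros s_cont kop_cont[OF w] indefinite_integral_continuous_1 s'_kop(2)[OF w]) auto

text \<open>With k = \<open>kop (H - 1/2) w\<close>, vanishing of \<open>Sop\<close> says that s k
  equals the primitive of s' k. Since \<open>s\<close> is bounded below by \<open>m\<close>,
  Gronwall's inequality with initial constant 0 forces k = 0, and \<open>kop_inj\<close>
  applies.\<close>

lemma Sop_inj:
  assumes w: "sq_int T w" and z: "\<And>t. t \<in> {0..T} \<Longrightarrow> Sop H s s' w t = 0"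
  shows "AE x in lborel. w x = 0"
proof -
  define k where "k = kop (H - 1/2) w"
  have kc: "continuous_on {0..T} k" unfolding k_def using w by (rule kop_cont)
  obtain M where M: "0 \<le> M" "\<And>r. r \<in> {0..T} \<Longrightarrow> \<bar>s r\<bar> \<le> M \<and> \<bar>s' r\<bar> \<le> M" using s_bounds by blast
  have c: "0 < c_const H" using H by (rule c_const_pos)
  \<comment> \<open>The rate uses \<open>M + 1\<close> because \<open>Gronwall_integral\<close> asks
    for a positive one; the factor 0 is its constant \<open>A\<close>.\<close>
  have "\<bar>k t\<bar> \<le> 2 * 0 * exp (2 * ((M + 1) / m) * T)" if t: "t \<in> {0..T}" for t
  proof (rule Gronwall_integral[OF _ _ _ _ t])
    fix t assume t: "t \<in> {0..T}"
    have kt: "continuous_on {0..t} k" using kc t by (auto elim: continuous_on_subset)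
    have "m * \<bar>k t\<bar> \<le> \<bar>s t * k t\<bar>"
      using s_ge[OF t] m by (simp add: abs_mult mult_right_mono)
    also have "s t * k t = integral {0..t} (\<lambda>r. s' r * k r)" using z[OF t] c by (simp add: Sop_def k_def)
    also have "\<bar>\<dots>\<bar> \<le> integral {0..t} (\<lambda>r. (M + 1) * \<bar>k r\<bar>)"
      unfolding real_norm_def[symmetric]
    proof (rule integral_norm_bound_integral)
      show "(\<lambda>r. s' r * k r) integrable_on {0..t}" unfolding k_def using s'_kop(2)[OF w t] .
      show "(\<lambda>r. (M + 1) * norm (k r)) integrable_on {0..t}"
        by (intro integrable_continuous_real continuous_intros kt)
      fix r assume "r \<in> {0..t}"
      then show "norm (s' r * k r) \<le> (M + 1) * norm (k r)"
        using M(2)[of r] t by (auto simp: abs_mult intro!: mult_right_mono)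
    qed
    also have "\<dots> = (M + 1) * integral {0..t} (\<lambda>r. \<bar>k r\<bar>)" by simp
    finally show "\<bar>k t\<bar> \<le> 0 + (M + 1) / m * integral {0..t} (\<lambda>r. \<bar>k r\<bar>)"
      using m by (simp add: field_simps)
  qed (use kc m M in \<open>auto intro!: continuous_intros divide_pos_pos add_nonneg_pos\<close>)
  then have "kop (H - 1/2) w t = 0" if "t \<in> {0..T}" for t using that by (simp add: k_def)
  then show ?thesis by (rule kop_inj[OF al w T])
qed

lemma RL_1_has_integral:
  assumes q: "sq_int T q" and t: "0 \<le> t"
  shows "(q has_integral RL 1 q t) {0..t}"
  using RL_1_eq_integral(1)[OF sq_int_integrable[OF q] t] .

lemma C1_has_integral:
  assumes f: "\<And>r. r \<in> {0..T} \<Longrightarrow> (f has_real_derivative f' r) (at r within {0..T})" and t: "t \<in> {0..T}"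
  shows "(f' has_integral f t - f 0) {0..t}"
  using t by (intro fundamental_theorem_of_calculus)
    (auto simp: has_real_derivative_iff_has_vector_derivative[symmetric] intro!: DERIV_subset[OF f])

lemma RL_1_product:
  assumes q: "sq_int T q" and f: "\<And>r. r \<in> {0..T} \<Longrightarrow> (f has_real_derivative f' r) (at r within {0..T})"
    and f': "continuous_on {0..T} f'" and t: "t \<in> {0..T}" and F: "\<And>t. t \<in> {0..T} \<Longrightarrow> F t = c + RL 1 q t"
  shows "((\<lambda>x. q x * f x + F x * f' x) has_integral F t * f t - F 0 * f 0) {0..t}"
proof (rule has_integral_product)
  show "0 \<le> t" using t by simp
  have R0: "RL 1 q 0 = 0" by (simp add: RL_def)
  fix x assume x: "x \<in> {0..t}"
  show "(q has_integral F x - F 0) {0..x}"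
    using RL_1_has_integral[OF q, of x] F[of x] F[of 0] x t R0 by simp
  show "(f' has_integral f x - f 0) {0..x}" using C1_has_integral[OF f] x t by auto
next
  show "q absolutely_integrable_on {0..t}"
    using sq_int_abs_integrable[OF q] by (rule set_integrable_subset) (use t in auto)
  show "f' absolutely_integrable_on {0..t}"
    by (rule absolutely_integrable_continuous_real[OF continuous_on_subset[OF f']]) (use t in auto)
qed

text \<open>The product rule undoes the integration by parts in \<open>Sop\<close>: if q is the
  derivative of \<open>kop\<close>, the derivative of \<open>Sop\<close> is c_H s q, and
  multiplication by the continuous s keeps it square integrable.\<close>

lemma Sop_AC:
  assumes w: "sq_int T w" and H2: "1/2 < H"
  obtains v where "sq_int T v" "\<And>t. t \<in> {0..T} \<Longrightarrow> Sop H s s' w t = RL 1 v t"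
proof -
  obtain q where q: "sq_int T q" "\<And>t. t \<in> {0..T} \<Longrightarrow> kop (H - 1/2) w t = RL 1 q t"
    using kop_AC[OF _ _ w T, of "H - 1/2"] H H2 by auto
  have sq: "sq_int T (\<lambda>x. c_const H * (s x * q x))"
    by (intro sq_int_cmult sq_int_mult_continuous q s_cont)
  have "Sop H s s' w t = RL 1 (\<lambda>x. c_const H * (s x * q x)) t" if t: "t \<in> {0..T}" for t
  proof -
    have "((\<lambda>x. q x * s x + kop (H - 1/2) w x * s' x) has_integral kop (H - 1/2) w t * s t - kop (H - 1/2) w 0 * s 0) {0..t}"
      by (rule RL_1_product[OF q(1) s s' t, where c=0]) (auto simp: q(2))
    then have 1: "((\<lambda>x. q x * s x + kop (H - 1/2) w x * s' x) has_integral kop (H - 1/2) w t * s t) {0..t}" by (simp add: kop_0)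
    have 2: "((\<lambda>r. s' r * kop (H - 1/2) w r) has_integral integral {0..t} (\<lambda>r. s' r * kop (H - 1/2) w r)) {0..t}"
      using s'_kop(2)[OF w t] by (rule integrable_integral)
    have "((\<lambda>x. c_const H * (s x * q x)) has_integral Sop H s s' w t) {0..t}"
      using has_integral_mult_right[OF has_integral_diff[OF 1 2], of "c_const H"]
      by (simp add: Sop_def algebra_simps)
    moreover have "((\<lambda>x. c_const H * (s x * q x)) has_integral RL 1 (\<lambda>x. c_const H * (s x * q x)) t) {0..t}"
      using RL_1_has_integral[OF sq] t by simp
    ultimately show ?thesis by (rule has_integral_unique)
  qed
  with sq show ?thesis by (rule that)
qed

text \<open>To have c_H s d(kop w) = h dt, \<open>kop\<close> of the preimage must be the primitive
  of g = h / (c_H s). For H > 1/2 the derivative required of g is obtained from that of h by the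
  product rule, since 1/s is continuously differentiable.\<close>

lemma Sop_surj:
  assumes h: "continuous_on {0..T} h"
    and AC: "1/2 < H \<Longrightarrow> \<exists>v. sq_int T v \<and> (\<forall>t\<in>{0..T}. h t = h 0 + RL 1 v t)"
  obtains w where "sq_int T w" "\<And>t. t \<in> {0..T} \<Longrightarrow> Sop H s s' w t = integral {0..t} h"
proof -
  have c: "0 < c_const H" using H by (rule c_const_pos)
  have sp: "0 < s r" if "r \<in> {0..T}" for r using s_ge[OF that] m by simp
  define f where "f r = 1 / (c_const H * s r)" for r
  define f' where "f' r = - s' r / (c_const H * (s r)^2)" for r
  have f: "(f has_real_derivative f' r) (at r within {0..T})" if "r \<in> {0..T}" for r
    unfolding f_def f'_def using sp[OF that] c s[OF that]
    by (auto intro!: derivative_eq_intros simp: field_simps power2_eq_square)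
  have f': "continuous_on {0..T} f'"
    unfolding f'_def using sp c by (intro continuous_intros s' s_cont) force
  have fc: "continuous_on {0..T} f" using f by (intro DERIV_continuous_on) auto
  define g where "g r = h r * f r" for r
  have g: "continuous_on {0..T} g" unfolding g_def by (intro continuous_intros h fc)
  obtain w where w: "sq_int T w" "\<And>t. t \<in> {0..T} \<Longrightarrow> kop (H - 1/2) w t = integral {0..t} g"
  proof (cases "H - 1/2" "0::real" rule: linorder_cases)
    case less
    have "- 1/2 < H - 1/2" using H by simp
    then show ?thesis by (rule kop_surj_neg[OF _ less T g]) (rule that, assumption, simp only:)
  next
    case equal
    show ?thesis by (rule kop_surj_zero[OF T g]) (rule that, assumption, simp only: equal)
  next
    case greater
    then have "1/2 < H" by simp
    from AC[OF this] obtain v where v: "sq_int T v" "\<forall>t\<in>{0..T}. h t = h 0 + RL 1 v t" by blast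
    \<comment> \<open>The derivative of h f. Its second term does not vanish off (0,T) by itself,
      hence the indicator.\<close>
    define q where "q x = f x * v x + ind T x * (h x * f' x)" for x
    have q: "sq_int T q"
      unfolding q_def by (intro sq_int_add sq_int_mult_continuous sq_int_continuous v fc continuous_intros h f')
    have gq: "g t = g 0 + RL 1 q t" if t: "t \<in> {0..T}" for t
    proof -
      have "((\<lambda>x. v x * f x + h x * f' x) has_integral h t * f t - h 0 * f 0) {0..t}"
        by (rule RL_1_product[OF v(1) f f' t v(2)[rule_format]])
      then have "(q has_integral h t * f t - h 0 * f 0) {0..t}"
        by (rule has_integral_spike_finite[where S="{0, T}", rotated 2]) (use t in \<open>auto simp: q_def\<close>)
      moreover have "(q has_integral RL 1 q t) {0..t}" using RL_1_has_integral[OF q] t by simp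
      ultimately have "h t * f t - h 0 * f 0 = RL 1 q t" by (rule has_integral_unique)
      then show ?thesis by (simp add: g_def)
    qed
    have h2: "H - 1/2 < 1/2" using H by simp
    show ?thesis by (rule kop_surj_pos[OF greater h2 T q gq], assumption) (rule that, assumption, simp only:)
  qed
  have "Sop H s s' w t = integral {0..t} h" if t: "t \<in> {0..T}" for t
  proof -
    have d: "((\<lambda>x. s x * integral {0..x} g) has_real_derivative s' r * integral {0..r} g + g r * s r) (at r within {0..T})" if "r \<in> {0..T}" for r
      by (intro DERIV_mult s that integral_has_real_derivative g)
    have 1: "((\<lambda>r. s' r * integral {0..r} g + g r * s r) has_integral s t * integral {0..t} g - s 0 * integral {0..0} g) {0..t}"
      by (rule C1_has_integral[OF d t])
    have "((\<lambda>r. s' r * integral {0..r} g) has_integral integral {0..t} (\<lambda>r. s' r * kop (H - 1/2) w r)) {0..t}"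
      using integrable_integral[OF s'_kop(2)[OF w(1) t]]
      by (rule has_integral_eq[rotated]) (use t in \<open>auto simp: w(2)\<close>)
    from has_integral_mult_right[OF has_integral_diff[OF 1 this], of "c_const H"]
    have "((\<lambda>r. c_const H * (g r * s r)) has_integral Sop H s s' w t) {0..t}"
      using t by (simp add: Sop_def w(2))
    moreover have "c_const H * (g r * s r) = h r" if "r \<in> {0..t}" for r
      using sp[of r] c that t by (simp add: g_def f_def)
    ultimately have "(h has_integral Sop H s s' w t) {0..t}" by (auto elim: has_integral_eq[rotated])
    then show ?thesis by (simp add: integral_unique)
  qed
  with w(1) show ?thesis by (rule that)
qed

end

section \<open>Vector-valued functions and the matrix operator\<close>

lemma has_integral_vec:
  fixes f :: "'a::euclidean_space \<Rightarrow> real^'n"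
  assumes "\<And>i. ((\<lambda>x. f x $ i) has_integral y $ i) S"
  shows "(f has_integral y) S"
  unfolding has_integral_componentwise_iff[of f] using assms by (auto simp: Basis_vec_def inner_axis)

text \<open>Connects a vector function that is Lebesgue measurable on [0,T] and arbitrary elsewhere
  with scalar Borel functions to which the preceding sections apply. Agreement almost everywhere
  suffices because the operators and the norm are integrals.\<close>

definition represents :: "real \<Rightarrow> (real \<Rightarrow> real^'n) \<Rightarrow> ('n \<Rightarrow> real \<Rightarrow> real) \<Rightarrow> bool" where
  "represents T u w \<longleftrightarrow> (\<forall>i. sq_int T (w i) \<and> (AE x in lborel. x \<in> {0<..<T} \<longrightarrow> u x $ i = w i x))"

lemma L2_represents:
  assumes u: "u \<in> L2 T"
  shows "\<exists>w. represents T u w"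
proof -
  have S: "{0..T} \<in> sets lebesgue" by simp
  \<comment> \<open>Membership in \<open>L2\<close> says nothing about values off [0,T]; they are
    set to 0 before a Borel version is chosen.\<close>
  have m: "(\<lambda>x. if x \<in> {0..T} then u x else 0) \<in> borel_measurable lebesgue"
    using u by (intro borel_measurable_if_I) (auto simp: L2_def)
  have n: "integrable lebesgue (\<lambda>x. indicator {0..T} x *\<^sub>R (norm (u x))^2)"
    using u by (subst integrable_restrict_space[symmetric]) (auto simp: L2_def)
  have "\<exists>w. sq_int T w \<and> (AE x in lborel. x \<in> {0<..<T} \<longrightarrow> u x $ i = w x)" for i
  proof -
    have "(\<lambda>x. (if x \<in> {0..T} then u x else 0) \<bullet> axis i 1) \<in> borel_measurable lebesgue"
      using m by (intro borel_measurable_inner) auto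
    then obtain g where g: "g \<in> borel_measurable lborel"
      "AE x in lborel. (if x \<in> {0..T} then u x else 0) \<bullet> axis i 1 = g x"
      using completion_ex_borel_measurable_real by blast
    define w where "w x = ind T x * g x" for x
    have [measurable]: "w \<in> borel_measurable borel" using g(1) unfolding w_def[abs_def] by simp
    have ae: "AE x in lborel. x \<in> {0<..<T} \<longrightarrow> u x $ i = w x"
      using g(2) by eventually_elim (auto simp: w_def inner_axis)
    have "integrable lebesgue (\<lambda>x. (w x)^2)"
    proof (rule Bochner_Integration.integrable_bound[OF n])
      show "(\<lambda>x. (w x)^2) \<in> borel_measurable lebesgue" by (rule measurable_completion) simp
      show "AE x in lebesgue. norm ((w x)^2) \<le> norm (indicator {0..T} x *\<^sub>R (norm (u x))^2)"
        using AE_completion[OF ae]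
      proof eventually_elim
        case (elim x)
        show ?case
        proof (cases "x \<in> {0<..<T}")
          case True
          then have "\<bar>w x\<bar> \<le> norm (u x)" using elim component_le_norm_cart[of "u x" i] by simp
          then have "\<bar>w x\<bar>^2 \<le> (norm (u x))^2" by (intro power_mono) auto
          then show ?thesis using True by simp
        qed (simp add: w_def)
      qed
    qed
    then have "integrable lborel (\<lambda>x. (w x)^2)" by (subst (asm) integrable_completion) auto
    then have "sq_int T w" by (auto simp: sq_int_def w_def[abs_def] intro!: \<open>w \<in> borel_measurable borel\<close>[unfolded w_def[abs_def]])
    with ae show ?thesis by blast
  qed
  then show ?thesis unfolding represents_def by (intro choice) blast
qed

lemma norm_square_cart: "(norm (x::real^'n))^2 = (\<Sum>i\<in>UNIV. (x $ i)^2)"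
  by (simp add: norm_vec_def L2_set_def sum_nonneg)

lemma represents_norm_integral:
  fixes u :: "real \<Rightarrow> real^'n"
  assumes r: "represents T u w" 
  shows "integral {0..T} (\<lambda>t. (norm (u t))^2) = (\<Sum>i\<in>UNIV. (l2 (w i))^2)"
proof -
  have sq: "sq_int T (w i)" for i using r by (simp add: represents_def)
  have 1: "((\<lambda>t. (w i t)^2) has_integral (l2 (w i))^2) {0..T}" for i
  proof -
    have e: "(\<lambda>t. ind T t * (w i t)^2) = (\<lambda>t. (w i t)^2)"
      using sq_intD(3)[OF sq[of i]] by (auto simp: indicator_def fun_eq_iff)
    have "((\<lambda>t. (w i t)^2) has_integral (LINT s|lborel. ind T s * (w i s)^2)) {0..T}"
      using sq_intD(2)[OF sq[of i]] by (intro has_integral_AE_lborel) (auto simp: e)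
    then show ?thesis by (simp add: e l2_def)
  qed
  have "((\<lambda>t. \<Sum>i\<in>UNIV. (w i t)^2) has_integral (\<Sum>i\<in>UNIV. (l2 (w i))^2)) {0..T}"
    by (intro has_integral_sum 1) auto
  then have "((\<lambda>t. (norm (u t))^2) has_integral (\<Sum>i\<in>UNIV. (l2 (w i))^2)) {0..T}"
  proof (rule has_integral_spike_AE)
    have "AE x in lborel. \<forall>i\<in>UNIV. x \<in> {0<..<T} \<longrightarrow> u x $ i = w i x"
      using r by (intro AE_finite_allI) (auto simp: represents_def)
    then show "AE s in lborel. s \<in> {0<..<T} \<longrightarrow> (norm (u s))^2 = (\<Sum>i\<in>UNIV. (w i s)^2)"
      by eventually_elim (simp add: norm_square_cart)
  qed
  then show ?thesis by (rule integral_unique)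
qed

lemma L2_of_components:
  fixes w :: "'n::finite \<Rightarrow> real \<Rightarrow> real"
  assumes w: "\<And>i. sq_int T (w i)"
  shows "(\<lambda>t. \<chi> i. w i t) \<in> L2 T" "represents T (\<lambda>t. \<chi> i. w i t) w"
proof -
  have m: "(\<lambda>t. \<chi> i. w i t) \<in> borel_measurable borel"
    using sq_intD(1)[OF w]
    by (subst borel_measurable_euclidean_space) (auto simp: Basis_vec_def inner_axis)
  have "integrable lborel (\<lambda>t. \<Sum>i\<in>UNIV. (w i t)^2)"
    using sq_intD(2)[OF w] by (intro Bochner_Integration.integrable_sum) auto
  then have i: "integrable lborel (\<lambda>t. (norm (\<chi> i. w i t))^2)" by (simp add: norm_square_cart)
  have "integrable lebesgue (\<lambda>t. (norm (\<chi> i. w i t))^2)"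
    using i m by (subst integrable_completion) auto
  then have "integrable lebesgue (\<lambda>t. indicator {0..T} t *\<^sub>R (norm (\<chi> i. w i t))^2)"
    by (intro integrable_mult_indicator) auto
  moreover have "(\<lambda>t. \<chi> i. w i t) \<in> borel_measurable (lebesgue_on {0..T})"
    using m by (intro measurable_restrict_space1 measurable_completion) simp
  ultimately show "(\<lambda>t. \<chi> i. w i t) \<in> L2 T" by (simp add: L2_def integrable_restrict_space)
  show "represents T (\<lambda>t. \<chi> i. w i t) w" using w by (simp add: represents_def)
qed

lemma represents_diff:
  assumes "represents T u w" "represents T u' w'"
  shows "represents T (\<lambda>x. u x - u' x) (\<lambda>i x. w i x - w' i x)"
  unfolding represents_def
proof (intro allI conjI)
  fix i
  show "sq_int T (\<lambda>x. w i x - w' i x)" using assms by (intro sq_int_diff) (auto simp: represents_def)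
  have "AE x in lborel. x \<in> {0<..<T} \<longrightarrow> u x $ i = w i x" "AE x in lborel. x \<in> {0<..<T} \<longrightarrow> u' x $ i = w' i x"
    using assms by (auto simp: represents_def)
  then show "AE x in lborel. x \<in> {0<..<T} \<longrightarrow> (u x - u' x) $ i = w i x - w' i x" by eventually_elim auto
qed

locale diffusion_matrix =
  fixes H T :: real and \<sigma> :: "real \<Rightarrow> real^'n^'n" and sd :: "'n \<Rightarrow> real \<Rightarrow> real" and m :: "'n \<Rightarrow> real"
  assumes diag: "\<And>t i j. t \<in> {0..T} \<Longrightarrow> i \<noteq> j \<Longrightarrow> \<sigma> t $ i $ j = 0"
    and dc: "\<And>i. diffusion_coefficient H T (\<lambda>t. \<sigma> t $ i $ i) (sd i) (m i)"
begin

abbreviation S :: "'n \<Rightarrow> (real \<Rightarrow> real) \<Rightarrow> real \<Rightarrow> real" where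
  "S i \<equiv> Sop H (\<lambda>t. \<sigma> t $ i $ i) (sd i)"

lemma H: "0 < H" "H < 1" and T: "0 < T"
  using diffusion_coefficient.H[OF dc[of undefined]] diffusion_coefficient.T[OF dc[of undefined]] by auto

lemma K_op_component:
  fixes u :: "real \<Rightarrow> real^'n"
  assumes r: "represents T u w" and t: "t \<in> {0..T}"
  shows "K_op H u t $ i = c_const H * kop (H - 1/2) (w i) t"
proof (cases "t = 0")
  case True
  then show ?thesis by (simp add: K_op_def kop_0)
next
  case False
  have "((\<lambda>s. kernel H t s *\<^sub>R u s) has_integral (\<chi> j. c_const H * kop (H - 1/2) (w j) t)) {0..t}"
  proof (rule has_integral_vec, simp)
    fix i :: 'n
    have "((\<lambda>s. kernel H t s * w i s) has_integral c_const H * kop (H - 1/2) (w i) t) {0..t}"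
      using kernel_has_integral[OF diffusion_coefficient.al[OF dc[of i]], of T "w i" t] r False t by (simp add: represents_def)
    moreover have "AE s in lborel. s \<in> {0<..<t} \<longrightarrow> kernel H t s * u s $ i = kernel H t s * w i s"
    proof -
      have "AE x in lborel. x \<in> {0<..<T} \<longrightarrow> u x $ i = w i x" using r by (simp add: represents_def)
      then show ?thesis by eventually_elim (use t in auto)
    qed
    ultimately show "((\<lambda>s. kernel H t s * u s $ i) has_integral c_const H * kop (H - 1/2) (w i) t) {0..t}"
      by (rule has_integral_spike_AE)
  qed
  then show ?thesis by (simp add: K_op_def integral_unique)
qed

text \<open>The boundary term at 0 of the integration by parts vanishes with \<open>K_op\<close>
  there, and what remains is \<open>Sop\<close>. All properties of the matrix operator are read off
  from the scalar ones through this identity.\<close>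

lemma K_sigma_component:
  assumes r: "represents T u w" and t: "t \<in> {0..T}"
  shows "K_sigma H \<sigma> u t $ i = S i (w i) t"
proof -
  have c: "continuous_on {0..T} (\<lambda>t. K_op H u t $ i)" for i
  proof -
    have "continuous_on {0..T} (\<lambda>t. c_const H * kop (H - 1/2) (w i) t)"
      using r by (intro continuous_intros diffusion_coefficient.kop_cont[OF dc]) (simp add: represents_def)
    then show ?thesis by (rule continuous_on_eq) (simp add: K_op_component[OF r])
  qed
  have "K_sigma H \<sigma> u t = (\<chi> i. \<sigma> t $ i $ i * K_op H u t $ i - \<sigma> 0 $ i $ i * K_op H u 0 $ i - integral {0..t} (\<lambda>r. sd i r * K_op H u r $ i))"
    unfolding K_sigma_def
    by (rule young_integral_diagonal[OF diag diffusion_coefficient.s[OF dc] diffusion_coefficient.s'[OF dc] c]) (use t in auto)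
  moreover have "K_op H u 0 = 0" by (simp add: K_op_def)
  moreover have "integral {0..t} (\<lambda>r. sd i r * K_op H u r $ i) = c_const H * integral {0..t} (\<lambda>r. sd i r * kop (H - 1/2) (w i) r)"
  proof -
    have "integral {0..t} (\<lambda>r. sd i r * K_op H u r $ i) = integral {0..t} (\<lambda>r. c_const H * (sd i r * kop (H - 1/2) (w i) r))"
      by (rule integral_cong) (use t in \<open>auto simp: K_op_component[OF r]\<close>)
    then show ?thesis by simp
  qed
  ultimately show ?thesis by (simp add: Sop_def K_op_component[OF r t] algebra_simps)
qed

lemma K_sigma_diff:
  assumes "represents T u w" "represents T u' w'" "t \<in> {0..T}"
  shows "K_sigma H \<sigma> (\<lambda>x. u x - u' x) t = K_sigma H \<sigma> u t - K_sigma H \<sigma> u' t"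
proof -
  have "S i (\<lambda>x. w i x - w' i x) t = S i (w i) t - S i (w' i) t" for i
    using assms by (intro diffusion_coefficient.Sop_diff[OF dc]) (auto simp: represents_def)
  then show ?thesis
    using K_sigma_component[OF represents_diff[OF assms(1,2)] assms(3)] K_sigma_component[OF assms(1,3)]
      K_sigma_component[OF assms(2,3)] by (simp add: vec_eq_iff)
qed

text \<open>The witness is assembled from the Borel components rather than taken as the pointwise
  difference, so that its membership in \<open>L2\<close> comes from
  \<open>L2_of_components\<close>.\<close>

lemma L2_diff:
  assumes "u \<in> L2 T" "u' \<in> L2 T"
  shows "\<exists>v\<in>L2 T. \<forall>t\<in>{0..T}. K_sigma H \<sigma> v t = K_sigma H \<sigma> u t - K_sigma H \<sigma> u' t"
proof -
  obtain w w' where w: "represents T u w" "represents T u' w'" using L2_represents assms by blast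
  have "sq_int T (\<lambda>x. w i x - w' i x)" for i using represents_diff[OF w] by (simp add: represents_def)
  note v = L2_of_components[of T "\<lambda>i x. w i x - w' i x", OF this]
  have "K_sigma H \<sigma> (\<lambda>t. \<chi> i. w i t - w' i t) t = K_sigma H \<sigma> u t - K_sigma H \<sigma> u' t" if "t \<in> {0..T}" for t
    using K_sigma_component[OF v(2) that] K_sigma_component[OF represents_diff[OF w] that] K_sigma_diff[OF w that]
    by (simp add: vec_eq_iff)
  then show ?thesis using v(1) by blast
qed

text \<open>Injectivity in the form suited to \<open>K_sigma_inv\<close>: whichever preimage of 0 is
  selected, its energy is 0.\<close>

lemma K_sigma_zero:
  assumes u: "u \<in> L2 T" and z: "\<And>t. t \<in> {0..T} \<Longrightarrow> K_sigma H \<sigma> u t = 0"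
  shows "integral {0..T} (\<lambda>t. (norm (u t))^2) = 0"
proof -
  obtain w where w: "represents T u w" using L2_represents[OF u] by blast
  have "l2 (w i) = 0" for i
  proof -
    have "AE x in lborel. w i x = 0"
    proof (rule diffusion_coefficient.Sop_inj[OF dc])
      show "sq_int T (w i)" using w by (simp add: represents_def)
      show "S i (w i) t = 0" if "t \<in> {0..T}" for t using K_sigma_component[OF w that, of i] z[OF that] by simp
    qed
    then have ae: "AE x in lborel. (w i x)^2 = 0" by eventually_elim simp
    have "(LINT x|lborel. (w i x)^2) = 0" by (rule integral_eq_zero_AE[OF ae])
    then show ?thesis by (simp add: l2_def)
  qed
  then show ?thesis by (simp add: represents_norm_integral[OF w])
qed

lemma K_sigma_bound:
  obtains C where "0 \<le> C" "\<And>u t. u \<in> L2 T \<Longrightarrow> t \<in> {0..T} \<Longrightarrow>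
    norm (K_sigma H \<sigma> u t) \<le> C * sqrt (integral {0..T} (\<lambda>t. (norm (u t))^2))"
proof -
  have "\<exists>C\<ge>0. \<forall>w t. sq_int T w \<longrightarrow> t \<in> {0..T} \<longrightarrow> \<bar>S i w t\<bar> \<le> C * l2 w" for i
    using diffusion_coefficient.Sop_bound[OF dc[of i]] by metis
  then obtain C where C: "\<And>i. 0 \<le> C i" "\<And>i w t. sq_int T w \<Longrightarrow> t \<in> {0..T} \<Longrightarrow> \<bar>S i w t\<bar> \<le> C i * l2 w"
    by metis
  show ?thesis
  proof (rule that[of "\<Sum>i\<in>UNIV. C i"])
    show "0 \<le> (\<Sum>i\<in>UNIV. C i)" using C(1) by (simp add: sum_nonneg)
    fix u :: "real \<Rightarrow> real^'n" and t assume u: "u \<in> L2 T" and t: "t \<in> {0..T}"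
    obtain w where w: "represents T u w" using L2_represents[OF u] by blast
    define N where "N = sqrt (\<Sum>i\<in>UNIV. (l2 (w i))^2)"
    have lN: "l2 (w i) \<le> N" for i
    proof -
      have "(l2 (w i))^2 \<le> (\<Sum>i\<in>UNIV. (l2 (w i))^2)" by (rule member_le_sum) auto
      then show ?thesis unfolding N_def by (rule real_le_rsqrt)
    qed
    have "norm (K_sigma H \<sigma> u t) \<le> (\<Sum>i\<in>UNIV. \<bar>K_sigma H \<sigma> u t $ i\<bar>)" by (rule norm_le_l1_cart)
    also have "\<dots> \<le> (\<Sum>i\<in>UNIV. C i * N)"
    proof (rule sum_mono)
      fix i
      have "\<bar>K_sigma H \<sigma> u t $ i\<bar> \<le> C i * l2 (w i)"
        unfolding K_sigma_component[OF w t] using w t by (intro C(2)) (auto simp: represents_def)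
      also have "\<dots> \<le> C i * N" using lN C(1) by (intro mult_left_mono) auto
      finally show "\<bar>K_sigma H \<sigma> u t $ i\<bar> \<le> C i * N" .
    qed
    also have "\<dots> = (\<Sum>i\<in>UNIV. C i) * N" by (simp add: sum_distrib_right)
    finally show "norm (K_sigma H \<sigma> u t) \<le> (\<Sum>i\<in>UNIV. C i) * sqrt (integral {0..T} (\<lambda>t. (norm (u t))^2))"
      by (simp add: represents_norm_integral[OF w] N_def)
  qed
qed

text \<open>For \<open>H \<le> 1/2\<close> every continuous drift can be inverted; for \<open>H > 1/2\<close> the fractional derivative
  of order \<open>H - 1/2\<close> needs some regularity, here a square integrable weak derivative.\<close>

definition regular :: "(real \<Rightarrow> real^'n) \<Rightarrow> bool" where
  "regular \<phi> \<longleftrightarrow> continuous_on {0..T} \<phi> \<and>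
     (1/2 < H \<longrightarrow> (\<forall>i. \<exists>v. sq_int T v \<and> (\<forall>t\<in>{0..T}. \<phi> t $ i = \<phi> 0 $ i + RL 1 v t)))"

text \<open>Every admissible path has the regularity that \<open>integral_in_H_space\<close> asks of
  an integrand; it only remains to carry it through the drift, which \<open>drift_AC\<close>
  does.\<close>

lemma regular_H_space:
  assumes h: "(\<lambda>t. \<phi> t - x0) \<in> H_space T H \<sigma>"
  shows "regular \<phi>"
proof -
  obtain u where u: "u \<in> L2 T" "\<And>t. t \<in> {0..T} \<Longrightarrow> \<phi> t - x0 = K_sigma H \<sigma> u t"
    using h by (auto simp: H_space_def)
  obtain w where w: "represents T u w" using L2_represents[OF u(1)] by blast
  have sq: "sq_int T (w i)" for i using w by (simp add: represents_def)
  have \<phi>: "\<phi> t $ i = x0 $ i + S i (w i) t" if "t \<in> {0..T}" for t i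
    using u(2)[OF that] K_sigma_component[OF w that, of i] by (simp add: algebra_simps vec_eq_iff)
  have "continuous_on {0..T} (\<lambda>t. \<phi> t $ i)" for i
  proof -
    have "continuous_on {0..T} (\<lambda>t. x0 $ i + S i (w i) t)"
      by (intro continuous_intros diffusion_coefficient.Sop_cont[OF dc] sq)
    then show ?thesis by (rule continuous_on_eq) (simp add: \<phi>)
  qed
  then have "continuous_on {0..T} (\<lambda>t. \<chi> i. \<phi> t $ i)" by (intro continuous_on_vec_lambda)
  then have c: "continuous_on {0..T} \<phi>" by simp
  have "\<exists>v. sq_int T v \<and> (\<forall>t\<in>{0..T}. \<phi> t $ i = \<phi> 0 $ i + RL 1 v t)" if H2: "1/2 < H" for i
  proof -
    have "\<exists>v. sq_int T v \<and> (\<forall>t\<in>{0..T}. S i (w i) t = RL 1 v t)"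
      using diffusion_coefficient.Sop_AC[OF dc sq H2] by metis
    then obtain v where v: "sq_int T v" "\<forall>t\<in>{0..T}. S i (w i) t = RL 1 v t" by blast
    have "RL 1 v 0 = 0" by (simp add: RL_def)
    then have "\<phi> 0 $ i = x0 $ i" using \<phi>[of 0 i] v(2) T by auto
    then have "\<forall>t\<in>{0..T}. \<phi> t $ i = \<phi> 0 $ i + RL 1 v t" using \<phi> v(2) by simp
    then show ?thesis using v(1) by blast
  qed
  with c show ?thesis by (simp add: regular_def)
qed

lemma integral_in_H_space:
  assumes h: "regular h"
  shows "(\<lambda>t. integral {0..t} h) \<in> H_space T H \<sigma>"
proof -
  have c: "continuous_on {0..T} (\<lambda>t. h t $ i)" for i
    using h by (auto simp: regular_def intro!: continuous_intros)
  have "\<exists>w. sq_int T w \<and> (\<forall>t\<in>{0..T}. S i w t = integral {0..t} (\<lambda>t. h t $ i))" for i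
  proof -
    have a: "\<exists>v. sq_int T v \<and> (\<forall>t\<in>{0..T}. h t $ i = h 0 $ i + RL 1 v t)" if "1/2 < H"
      using h that by (auto simp: regular_def)
    show ?thesis using diffusion_coefficient.Sop_surj[OF dc c a] by metis
  qed
  then obtain w where w: "\<And>i. sq_int T (w i)" "\<And>i. \<forall>t\<in>{0..T}. S i (w i) t = integral {0..t} (\<lambda>t. h t $ i)" by metis
  note v = L2_of_components[of T w, OF w(1)]
  have "integral {0..t} h = K_sigma H \<sigma> (\<lambda>t. \<chi> i. w i t) t" if t: "t \<in> {0..T}" for t
  proof -
    have "h integrable_on {0..t}"
      using h t by (intro integrable_continuous_real) (auto simp: regular_def elim: continuous_on_subset)
    then have "integral {0..t} (\<lambda>t. h t $ i) = integral {0..t} h $ i" for i by simp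
    then show ?thesis using K_sigma_component[OF v(2) t] w(2) t by (simp add: vec_eq_iff)
  qed
  then show ?thesis using v(1) by (auto simp: H_space_def)
qed

end

section \<open>The drift and the minimizers\<close>

lemma bounded_continuous_bound:
  assumes "bounded_continuous T f"
  shows "\<exists>M\<ge>0. \<forall>t\<in>{0..T}. \<forall>x. norm (f t x) \<le> M"
proof -
  have "bounded ((\<lambda>(t, x). f t x) ` ({0..T} \<times> UNIV))" using assms by (simp add: bounded_continuous_def)
  then obtain M where "\<forall>y\<in>(\<lambda>(t, x). f t x) ` ({0..T} \<times> UNIV). norm y \<le> M" unfolding bounded_iff by blast
  then have "norm (f t x) \<le> max 0 M" if "t \<in> {0..T}" for t x using that by (auto simp: le_max_iff_disj)
  then show ?thesis by (intro exI[of _ "max 0 M"]) auto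
qed

lemma bounded_continuous_compose:
  assumes f: "bounded_continuous T f" and \<phi>: "continuous_on {0..T} \<phi>"
  shows "continuous_on {0..T} (\<lambda>t. f t (\<phi> t))"
proof -
  have c: "continuous_on ({0..T} \<times> UNIV) (\<lambda>(t, x). f t x)" using f by (simp add: bounded_continuous_def)
  have "continuous_on {0..T} (\<lambda>t. (\<lambda>(t, x). f t x) (t, \<phi> t))"
    by (rule continuous_on_compose2[OF c]) (auto intro!: continuous_intros \<phi>)
  then show ?thesis by simp
qed

lemma bounded_continuous_near_path:
  fixes f :: "real \<Rightarrow> 'a::real_normed_vector \<Rightarrow> 'b::real_normed_vector"
  assumes f: "bounded_continuous T f" and x: "x \<in> {0..T}" and e: "0 < e"
  shows "\<exists>d>0. \<forall>t\<in>{0..T}. \<forall>p. \<bar>t - x\<bar> < d \<longrightarrow> norm (p - q) < d \<longrightarrow> norm (f t p - f x q) \<le> e"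
proof -
  have "continuous_on ({0..T} \<times> UNIV) (\<lambda>(t, x). f t x)" using f by (simp add: bounded_continuous_def)
  then obtain d where d: "0 < d" "\<And>z. z \<in> {0..T} \<times> UNIV \<Longrightarrow> dist z (x, q) < d \<Longrightarrow> dist ((\<lambda>(t, x). f t x) z) (f x q) < e"
    using x e unfolding continuous_on_iff by (metis (no_types, lifting) UNIV_I case_prod_conv mem_Sigma_iff)
  have "norm (f t p - f x q) \<le> e" if "t \<in> {0..T}" "\<bar>t - x\<bar> < d / 2" "norm (p - q) < d / 2" for t p
  proof -
    have "dist (t, p) (x, q) \<le> dist t x + dist p q"
      unfolding dist_Pair_Pair by (rule sqrt_sum_squares_le_sum) auto
    also have "\<dots> < d" using that by (auto simp: dist_real_def dist_norm)
    finally show ?thesis using d(2)[of "(t, p)"] that by (auto simp: dist_norm)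
  qed
  then show ?thesis using d(1) by (intro exI[of _ "d / 2"]) auto
qed

lemma sq_int_sum:
  assumes "finite A" "\<And>i. i \<in> A \<Longrightarrow> sq_int T (f i)"
  shows "sq_int T (\<lambda>x. \<Sum>i\<in>A. f i x)"
  using assms
proof (induction A rule: finite_induct)
  case empty
  then show ?case by (simp add: sq_int_def)
next
  case (insert a A)
  then show ?case by (auto intro!: sq_int_add)
qed

locale drift =
  fixes T :: real and b bt :: "real \<Rightarrow> real^'n \<Rightarrow> real^'n"
    and D1 :: "real \<Rightarrow> real^'n \<Rightarrow> ((real^'n) \<Rightarrow>\<^sub>L (real^'n))"
    and D2 :: "real \<Rightarrow> real^'n \<Rightarrow> ((real^'n) \<Rightarrow>\<^sub>L ((real^'n) \<Rightarrow>\<^sub>L (real^'n)))"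
  assumes T: "0 < T"
    and bt: "\<And>t x. t \<in> {0..T} \<Longrightarrow> ((\<lambda>s. b s x) has_vector_derivative bt t x) (at t within {0..T})"
    and D1: "\<And>t x. t \<in> {0..T} \<Longrightarrow> (b t has_derivative blinfun_apply (D1 t x)) (at x)"
    and D2: "\<And>t x. t \<in> {0..T} \<Longrightarrow> (D1 t has_derivative blinfun_apply (D2 t x)) (at x)"
    and bc: "bounded_continuous T b" "bounded_continuous T bt" "bounded_continuous T D1" "bounded_continuous T D2"
begin

lemma b_Lipschitz: "\<exists>L>0. \<forall>t\<in>{0..T}. \<forall>x y. norm (b t x - b t y) \<le> L * norm (x - y)"
proof -
  obtain M where M: "0 \<le> M" "\<forall>t\<in>{0..T}. \<forall>x. norm (D1 t x) \<le> M" using bounded_continuous_bound[OF bc(3)] by blast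
  \<comment> \<open>The added 1 makes the constant strictly positive, as the rate in
    \<open>Gronwall_integral\<close> has to be.\<close>
  have "norm (b t x - b t y) \<le> (M + 1) * norm (x - y)" if t: "t \<in> {0..T}" for t x y
  proof (rule differentiable_bound[where S=UNIV])
    show "onorm (blinfun_apply (D1 t z)) \<le> M + 1" for z
      using M(2) t by (metis norm_blinfun.rep_eq add_increasing2 zero_le_one)
  qed (use D1[OF t] in auto)
  then show ?thesis using M(1) by (intro exI[of _ "M + 1"]) auto
qed

lemma divergence_eq:
  assumes "t \<in> {0..T}"
  shows "divergence (b t) x = (\<Sum>i\<in>UNIV. D1 t x (axis i 1) $ i)"
  unfolding divergence_def frechet_derivative_at[OF D1[OF assms], symmetric] ..

text \<open>The divergence is the trace of \<open>D1\<close>. A bound on \<open>D2\<close> makes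
  \<open>D1\<close> Lipschitz in operator norm, and each of the n diagonal entries is dominated by
  that norm.\<close>

lemma divergence_Lipschitz: "\<exists>L\<ge>0. \<forall>t\<in>{0..T}. \<forall>x y. \<bar>divergence (b t) x - divergence (b t) y\<bar> \<le> L * norm (x - y)"
proof -
  obtain M where M: "0 \<le> M" "\<forall>t\<in>{0..T}. \<forall>x. norm (D2 t x) \<le> M" using bounded_continuous_bound[OF bc(4)] by blast
  have "\<bar>divergence (b t) x - divergence (b t) y\<bar> \<le> (real CARD('n) * M) * norm (x - y)" if t: "t \<in> {0..T}" for t x y
  proof -
    have D: "norm (D1 t x - D1 t y) \<le> M * norm (x - y)"
    proof (rule differentiable_bound[where S=UNIV])
      show "onorm (blinfun_apply (D2 t z)) \<le> M" for z
        using M(2) t by (metis norm_blinfun.rep_eq)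
    qed (use D2[OF t] in auto)
    have "\<bar>(D1 t x - D1 t y) (axis i 1) $ i\<bar> \<le> M * norm (x - y)" for i
    proof -
      have "\<bar>(D1 t x - D1 t y) (axis i 1) $ i\<bar> \<le> norm ((D1 t x - D1 t y) (axis i 1))" by (rule component_le_norm_cart)
      also have "\<dots> \<le> norm (D1 t x - D1 t y) * norm (axis i (1::real))" by (rule norm_blinfun)
      finally show ?thesis using D by (simp add: norm_axis_1)
    qed
    note c = this
    have "divergence (b t) x - divergence (b t) y = (\<Sum>i\<in>UNIV. (D1 t x - D1 t y) (axis i 1) $ i)"
      by (simp add: divergence_eq[OF t] blinfun.diff_left sum_subtractf)
    also have "\<bar>\<dots>\<bar> \<le> (\<Sum>i\<in>UNIV. \<bar>(D1 t x - D1 t y) (axis i 1) $ i\<bar>)" by (rule sum_abs)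
    also have "\<dots> \<le> (\<Sum>i\<in>(UNIV::'n set). M * norm (x - y))" by (intro sum_mono c)
    finally show ?thesis by simp
  qed
  then show ?thesis using M(1) by (intro exI[of _ "real CARD('n) * M"]) auto
qed

lemma divergence_path_integrable:
  assumes "continuous_on {0..T} \<phi>"
  shows "(\<lambda>t. divergence (b t) (\<phi> t)) integrable_on {0..T}"
proof -
  have "continuous_on {0..T} (\<lambda>t. \<Sum>i\<in>UNIV. D1 t (\<phi> t) (axis i 1) $ i)"
    by (intro continuous_intros bounded_continuous_compose[OF bc(3) assms])
  then have "(\<lambda>t. \<Sum>i\<in>UNIV. D1 t (\<phi> t) (axis i 1) $ i) integrable_on {0..T}" by (rule integrable_continuous_real)
  then show ?thesis by (rule integrable_eq) (simp add: divergence_eq)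
qed

text \<open>Continuity of the partial derivatives gives strict differentiability at (x, \<phi> x),
  uniformly for both moving points. The increment is taken first in time with the space variable at
  \<phi> y, then in space with time at z. This is the hypothesis \<open>strict\<close> of
  \<open>has_integral_chain\<close>.\<close>

lemma strict_along_path:
  assumes \<phi>: "continuous_on {0..T} \<phi>" and x: "x \<in> {0..T}" and e: "0 < e"
  shows "\<exists>r>0. \<forall>y\<in>{0..T}. \<forall>z\<in>{0..T}. \<bar>y - x\<bar> < r \<longrightarrow> \<bar>z - x\<bar> < r \<longrightarrow>
    norm (b y (\<phi> y) - b z (\<phi> z) - ((y - z) *\<^sub>R bt x (\<phi> x) + D1 x (\<phi> x) (\<phi> y - \<phi> z))) \<le> e * norm ((y, \<phi> y) - (z, \<phi> z))"
proof -
  \<comment> \<open>The time and the space increment each cost 3 \<eta>: 2 \<eta> for the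
    linearisation and \<eta> for moving its base point to (x, \<phi> x). Both increments are bounded
    by the norm of the joint one.\<close>
  define \<eta> where "\<eta> = e / 6"
  have \<eta>: "0 < \<eta>" using e by (simp add: \<eta>_def)
  obtain d1 where d1: "0 < d1" "\<And>t p. t \<in> {0..T} \<Longrightarrow> \<bar>t - x\<bar> < d1 \<Longrightarrow> norm (p - \<phi> x) < d1 \<Longrightarrow> norm (bt t p - bt x (\<phi> x)) \<le> \<eta>"
    using bounded_continuous_near_path[OF bc(2) x \<eta>, of "\<phi> x"] by blast
  obtain d2 where d2: "0 < d2" "\<And>t p. t \<in> {0..T} \<Longrightarrow> \<bar>t - x\<bar> < d2 \<Longrightarrow> norm (p - \<phi> x) < d2 \<Longrightarrow> norm (D1 t p - D1 x (\<phi> x)) \<le> \<eta>"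
    using bounded_continuous_near_path[OF bc(3) x \<eta>, of "\<phi> x"] by blast
  define d where "d = min d1 d2"
  have d: "0 < d" using d1 d2 by (simp add: d_def)
  obtain r0 where r0: "0 < r0" "\<And>y. y \<in> {0..T} \<Longrightarrow> dist y x < r0 \<Longrightarrow> dist (\<phi> y) (\<phi> x) < d"
    using \<phi> x d unfolding continuous_on_iff by metis
  have "norm (b y (\<phi> y) - b z (\<phi> z) - ((y - z) *\<^sub>R bt x (\<phi> x) + D1 x (\<phi> x) (\<phi> y - \<phi> z))) \<le> e * norm ((y, \<phi> y) - (z, \<phi> z))"
    if y: "y \<in> {0..T}" and z: "z \<in> {0..T}" and yx: "\<bar>y - x\<bar> < min r0 d" and zx: "\<bar>z - x\<bar> < min r0 d" for y z
  proof -
    have py: "norm (\<phi> y - \<phi> x) < d" and pz: "norm (\<phi> z - \<phi> x) < d"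
      using r0(2)[OF y] r0(2)[OF z] yx zx by (auto simp: dist_real_def dist_norm)
    define S where "S = {s \<in> {0..T}. \<bar>s - x\<bar> < d}"
    have S: "convex S"
    proof -
      have "S = {0..T} \<inter> {x - d<..<x + d}" by (auto simp: S_def abs_less_iff)
      then show ?thesis by (simp add: convex_Int)
    qed
    have in_S: "y \<in> S" "z \<in> S" "x \<in> S" using y z x yx zx d by (auto simp: S_def)
    have A: "norm (b y (\<phi> y) - b z (\<phi> y) - (y - z) *\<^sub>R bt x (\<phi> y)) \<le> norm (y - z) * (2 * \<eta>)"
    proof (rule vector_differentiable_bound_linearization[where S=S and f'="\<lambda>s. bt s (\<phi> y)" and f="\<lambda>s. b s (\<phi> y)"])
      fix s assume s: "s \<in> S"
      show "((\<lambda>s. b s (\<phi> y)) has_vector_derivative bt s (\<phi> y)) (at s within S)"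
        using bt[of s "\<phi> y"] s by (auto intro: has_vector_derivative_within_subset simp: S_def)
      have "norm (bt s (\<phi> y) - bt x (\<phi> x)) \<le> \<eta>" "norm (bt x (\<phi> y) - bt x (\<phi> x)) \<le> \<eta>"
        using d1 s x py by (auto simp: S_def d_def)
      then show "norm (bt s (\<phi> y) - bt x (\<phi> y)) \<le> 2 * \<eta>"
        using norm_triangle_ineq4[of "bt s (\<phi> y) - bt x (\<phi> x)" "bt x (\<phi> y) - bt x (\<phi> x)"] by simp
    qed (use in_S S in \<open>auto simp: convex_contains_segment\<close>)
    have A': "norm ((y - z) *\<^sub>R bt x (\<phi> y) - (y - z) *\<^sub>R bt x (\<phi> x)) \<le> norm (y - z) * \<eta>"
      using d1(2)[OF x, of "\<phi> y"] d1(1) py unfolding scaleR_diff_right[symmetric]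
      by (auto simp: d_def intro!: mult_left_mono)
    have B: "norm (b z (\<phi> y) - b z (\<phi> z) - D1 z (\<phi> x) (\<phi> y - \<phi> z)) \<le> norm (\<phi> y - \<phi> z) * (2 * \<eta>)"
    proof (rule differentiable_bound_linearization[where S="ball (\<phi> x) d" and f'="\<lambda>p. blinfun_apply (D1 z p)"])
      fix t :: real assume t: "t \<in> {0..1}"
      have "\<phi> z + t *\<^sub>R (\<phi> y - \<phi> z) = (1 - t) *\<^sub>R \<phi> z + t *\<^sub>R \<phi> y" by (simp add: algebra_simps)
      also have "\<dots> \<in> ball (\<phi> x) d"
        using py pz t by (intro convexD[OF convex_ball]) (auto simp: dist_norm norm_minus_commute)
      finally show "\<phi> z + t *\<^sub>R (\<phi> y - \<phi> z) \<in> ball (\<phi> x) d" .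
    next
      fix p assume p: "p \<in> ball (\<phi> x) d"
      show "(b z has_derivative blinfun_apply (D1 z p)) (at p within ball (\<phi> x) d)"
        using D1[OF z] by (rule has_derivative_at_withinI)
      have p': "norm (p - \<phi> x) < d" using p by (simp add: dist_norm norm_minus_commute)
      have "norm (D1 z p - D1 x (\<phi> x)) \<le> \<eta>" "norm (D1 z (\<phi> x) - D1 x (\<phi> x)) \<le> \<eta>"
        using d2 zx z p' by (auto simp: d_def)
      then have "norm (D1 z p - D1 z (\<phi> x)) \<le> 2 * \<eta>"
        using norm_triangle_ineq4[of "D1 z p - D1 x (\<phi> x)" "D1 z (\<phi> x) - D1 x (\<phi> x)"] by simp
      moreover have "blinfun_apply (D1 z p) - blinfun_apply (D1 z (\<phi> x)) = blinfun_apply (D1 z p - D1 z (\<phi> x))"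
        by (auto simp: fun_eq_iff blinfun.diff_left)
      ultimately show "onorm (blinfun_apply (D1 z p) - blinfun_apply (D1 z (\<phi> x))) \<le> 2 * \<eta>"
        by (simp add: norm_blinfun.rep_eq)
    qed (use d in auto)
    have B': "norm (D1 z (\<phi> x) (\<phi> y - \<phi> z) - D1 x (\<phi> x) (\<phi> y - \<phi> z)) \<le> norm (\<phi> y - \<phi> z) * \<eta>"
    proof -
      have "norm (D1 z (\<phi> x) - D1 x (\<phi> x)) \<le> \<eta>" using d2 zx z by (auto simp: d_def)
      then have "norm (D1 z (\<phi> x) - D1 x (\<phi> x)) * norm (\<phi> y - \<phi> z) \<le> \<eta> * norm (\<phi> y - \<phi> z)"
        by (intro mult_right_mono) auto
      then show ?thesis
        using norm_blinfun[of "D1 z (\<phi> x) - D1 x (\<phi> x)" "\<phi> y - \<phi> z"] by (simp add: blinfun.diff_left mult.commute)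
    qed
    define N where "N = norm ((y, \<phi> y) - (z, \<phi> z))"
    have N: "norm (y - z) \<le> N" "norm (\<phi> y - \<phi> z) \<le> N"
      using norm_fst_le[of "y - z" "\<phi> y - \<phi> z"] norm_snd_le[of "\<phi> y - \<phi> z" "y - z"] by (auto simp: N_def)
    let ?a = "b y (\<phi> y) - b z (\<phi> y) - (y - z) *\<^sub>R bt x (\<phi> y)"
    let ?a' = "(y - z) *\<^sub>R bt x (\<phi> y) - (y - z) *\<^sub>R bt x (\<phi> x)"
    let ?b = "b z (\<phi> y) - b z (\<phi> z) - D1 z (\<phi> x) (\<phi> y - \<phi> z)"
    let ?b' = "D1 z (\<phi> x) (\<phi> y - \<phi> z) - D1 x (\<phi> x) (\<phi> y - \<phi> z)"
    have e: "b y (\<phi> y) - b z (\<phi> z) - ((y - z) *\<^sub>R bt x (\<phi> x) + D1 x (\<phi> x) (\<phi> y - \<phi> z)) = (?a + ?a') + (?b + ?b')"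
      by simp
    have "norm ((?a + ?a') + (?b + ?b')) \<le> (norm ?a + norm ?a') + (norm ?b + norm ?b')"
      by (intro order_trans[OF norm_triangle_ineq] add_mono norm_triangle_ineq)
    also have "\<dots> \<le> (norm (y - z) * (2 * \<eta>) + norm (y - z) * \<eta>) + (norm (\<phi> y - \<phi> z) * (2 * \<eta>) + norm (\<phi> y - \<phi> z) * \<eta>)"
      by (intro add_mono A A' B B')
    also have "\<dots> = 3 * \<eta> * norm (y - z) + 3 * \<eta> * norm (\<phi> y - \<phi> z)" by (simp add: algebra_simps)
    also have "\<dots> \<le> 3 * \<eta> * N + 3 * \<eta> * N" using N \<eta> by (intro add_mono mult_left_mono) auto
    also have "\<dots> = e * N" by (simp add: \<eta>_def)
    finally show ?thesis unfolding e N_def .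
  qed
  then show ?thesis using r0(1) d by (intro exI[of _ "min r0 d"]) auto
qed

text \<open>The chain rule along t \<mapsto> (t, \<phi> t). The derivative is the time derivative of
  b plus \<open>D1\<close> applied to the weak derivative of \<phi>; it is square integrable because
  the coefficients are continuous along the path.\<close>

lemma drift_AC:
  assumes \<phi>: "continuous_on {0..T} \<phi>" and v: "\<And>j. sq_int T (v j)"
    and \<phi>v: "\<And>j t. t \<in> {0..T} \<Longrightarrow> \<phi> t $ j = \<phi> 0 $ j + RL 1 (v j) t"
  shows "\<exists>q. sq_int T q \<and> (\<forall>t\<in>{0..T}. b t (\<phi> t) $ i = b 0 (\<phi> 0) $ i + RL 1 q t)"
proof -
  define L where "L x p = fst p * bt x (\<phi> x) $ i + D1 x (\<phi> x) (snd p) $ i" for x and p :: "real \<times> (real^'n)"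
  \<comment> \<open>The weak derivative of \<phi> is given by components, so the velocity is
    expanded in basis vectors; linearity of \<open>L x\<close> then gives \<open>q\<close>.\<close>
  define \<psi>' where "\<psi>' x = 1 *\<^sub>R (1::real, 0::real^'n) + (\<Sum>j\<in>UNIV. v j x *\<^sub>R (0::real, axis j 1))" for x
  define q where "q x = ind T x * bt x (\<phi> x) $ i + (\<Sum>j\<in>UNIV. D1 x (\<phi> x) (axis j 1) $ i * v j x)" for x
  obtain M1 where M1: "0 \<le> M1" "\<forall>t\<in>{0..T}. \<forall>x. norm (bt t x) \<le> M1" using bounded_continuous_bound[OF bc(2)] by blast
  obtain M2 where M2: "0 \<le> M2" "\<forall>t\<in>{0..T}. \<forall>x. norm (D1 t x) \<le> M2" using bounded_continuous_bound[OF bc(3)] by blast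
  have q: "sq_int T q"
    unfolding q_def
    by (intro sq_int_add sq_int_continuous sq_int_sum sq_int_mult_continuous v continuous_intros
        bounded_continuous_compose[OF bc(2) \<phi>] bounded_continuous_compose[OF bc(3) \<phi>]) auto
  have lin: "linear (L x)" for x
    unfolding L_def by (intro linearI) (auto simp: blinfun.add_right blinfun.scaleR_right algebra_simps)
  have Lq: "L x (\<psi>' x) = q x" if "x \<in> {0<..<T}" for x
  proof -
    have "L x (\<psi>' x) = L x (1, 0) + (\<Sum>j\<in>UNIV. v j x * L x (0, axis j 1))"
      unfolding \<psi>'_def by (simp only: linear_add[OF lin] linear_sum[OF lin] linear_cmul[OF lin] real_scaleR_def mult_1_left)
    then show ?thesis using that by (simp add: L_def q_def blinfun.zero_right mult.commute)
  qed
  have "b t (\<phi> t) $ i = b 0 (\<phi> 0) $ i + RL 1 q t" if t: "t \<in> {0..T}" for t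
  proof -
    have "((\<lambda>x. L x (\<psi>' x)) has_integral b t (\<phi> t) $ i - b 0 (\<phi> 0) $ i) {0..t}"
    proof (rule has_integral_chain[where \<psi>="\<lambda>t. (t, \<phi> t)" and M="M1 + M2" and h="\<lambda>t. b t (\<phi> t) $ i"])
      show "0 \<le> t" using t by simp
      fix s assume s: "s \<in> {0..t}"
      have "(v j has_integral (\<phi> s $ j - \<phi> 0 $ j)) {0..s}" for j
        using RL_1_eq_integral(1)[OF sq_int_integrable[OF v], of s j] \<phi>v[of s j] s t by simp
      then have "(\<psi>' has_integral s *\<^sub>R (1::real, 0::real^'n) + (\<Sum>j\<in>UNIV. (\<phi> s $ j - \<phi> 0 $ j) *\<^sub>R (0::real, axis j 1))) {0..s}"
        unfolding \<psi>'_def[abs_def] using has_integral_const_real[of "1::real" 0 s] s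
        by (intro has_integral_add has_integral_sum has_integral_scaleR_left) auto
      moreover have "s *\<^sub>R (1::real, 0::real^'n) + (\<Sum>j\<in>UNIV. (\<phi> s $ j - \<phi> 0 $ j) *\<^sub>R (0::real, axis j 1)) = (s, \<phi> s) - (0, \<phi> 0)"
        using basis_expansion[of "\<phi> s - \<phi> 0"]
        by (simp add: prod_eq_iff fst_sum snd_sum scalar_mult_eq_scaleR)
      ultimately show "(\<psi>' has_integral (s, \<phi> s) - (0, \<phi> 0)) {0..s}" by simp
    next
      have "v j absolutely_integrable_on {0..t}" for j
        using sq_int_abs_integrable[OF v] by (rule set_integrable_subset) (use t in auto)
      then have "(\<lambda>x. \<Sum>j\<in>UNIV. v j x *\<^sub>R (0::real, axis j (1::real) :: real^'n)) absolutely_integrable_on {0..t}"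
        by (intro absolutely_integrable_sum absolutely_integrable_scaleR_right) auto
      moreover have "(\<lambda>x. 1 *\<^sub>R (1::real, 0::real^'n)) absolutely_integrable_on {0..t}"
        by (intro absolutely_integrable_continuous_real continuous_on_const)
      ultimately show "\<psi>' absolutely_integrable_on {0..t}"
        unfolding \<psi>'_def[abs_def] by (intro set_integral_add)
    next
      fix x show "linear (L x)" by (rule lin)
    next
      fix x p assume x: "x \<in> {0..t}"
      then have x: "x \<in> {0..T}" using t by auto
      have "\<bar>L x p\<bar> \<le> \<bar>fst p\<bar> * \<bar>bt x (\<phi> x) $ i\<bar> + \<bar>D1 x (\<phi> x) (snd p) $ i\<bar>"
        unfolding L_def abs_mult[symmetric] by (rule abs_triangle_ineq)
      also have "\<dots> \<le> norm p * M1 + M2 * norm p"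
      proof (intro add_mono mult_mono)
        show "\<bar>fst p\<bar> \<le> norm p" using norm_fst_le[of "fst p" "snd p"] by simp
        show "\<bar>bt x (\<phi> x) $ i\<bar> \<le> M1" using component_le_norm_cart order_trans M1(2) x by blast
        have "\<bar>D1 x (\<phi> x) (snd p) $ i\<bar> \<le> norm (D1 x (\<phi> x) (snd p))" by (rule component_le_norm_cart)
        also have "\<dots> \<le> norm (D1 x (\<phi> x)) * norm (snd p)" by (rule norm_blinfun)
        also have "\<dots> \<le> M2 * norm p"
          using M2 x norm_snd_le[of "snd p" "fst p"] by (intro mult_mono) auto
        finally show "\<bar>D1 x (\<phi> x) (snd p) $ i\<bar> \<le> M2 * norm p" .
      qed (use M1 in auto)
      finally show "\<bar>L x p\<bar> \<le> (M1 + M2) * norm p" by (simp add: algebra_simps)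
    next
      fix x e :: real assume x: "x \<in> {0..t}" and e: "0 < e"
      then have x': "x \<in> {0..T}" using t by auto
      obtain r where r: "0 < r" "\<And>y z. y \<in> {0..T} \<Longrightarrow> z \<in> {0..T} \<Longrightarrow> \<bar>y - x\<bar> < r \<Longrightarrow> \<bar>z - x\<bar> < r \<Longrightarrow>
        norm (b y (\<phi> y) - b z (\<phi> z) - ((y - z) *\<^sub>R bt x (\<phi> x) + D1 x (\<phi> x) (\<phi> y - \<phi> z))) \<le> e * norm ((y, \<phi> y) - (z, \<phi> z))"
        using strict_along_path[OF \<phi> x' e] by blast
      have "\<bar>b y (\<phi> y) $ i - b z (\<phi> z) $ i - L x ((y, \<phi> y) - (z, \<phi> z))\<bar> \<le> e * norm ((y, \<phi> y) - (z, \<phi> z))"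
        if "y \<in> {0..t}" "z \<in> {0..t}" "\<bar>y - x\<bar> < r" "\<bar>z - x\<bar> < r" for y z
      proof -
        have "b y (\<phi> y) $ i - b z (\<phi> z) $ i - L x ((y, \<phi> y) - (z, \<phi> z)) =
          (b y (\<phi> y) - b z (\<phi> z) - ((y - z) *\<^sub>R bt x (\<phi> x) + D1 x (\<phi> x) (\<phi> y - \<phi> z))) $ i"
          by (simp add: L_def)
        also have "\<bar>\<dots>\<bar> \<le> norm (b y (\<phi> y) - b z (\<phi> z) - ((y - z) *\<^sub>R bt x (\<phi> x) + D1 x (\<phi> x) (\<phi> y - \<phi> z)))"
          by (rule component_le_norm_cart)
        also have "\<dots> \<le> e * norm ((y, \<phi> y) - (z, \<phi> z))" using r(2)[of y z] that t by auto
        finally show ?thesis .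
      qed
      then show "\<exists>r>0. \<forall>y\<in>{0..t}. \<forall>z\<in>{0..t}. \<bar>y - x\<bar> < r \<longrightarrow> \<bar>z - x\<bar> < r \<longrightarrow>
        \<bar>b y (\<phi> y) $ i - b z (\<phi> z) $ i - L x ((y, \<phi> y) - (z, \<phi> z))\<bar> \<le> e * norm ((y, \<phi> y) - (z, \<phi> z))"
        using r(1) by blast
    qed
    then have "(q has_integral b t (\<phi> t) $ i - b 0 (\<phi> 0) $ i) {0..t}"
      by (rule has_integral_spike_finite[where S="{0, T}", rotated 2]) (use t Lq in auto)
    moreover have "(q has_integral RL 1 q t) {0..t}"
      using RL_1_eq_integral(1)[OF sq_int_integrable[OF q], of t] t by simp
    ultimately have "b t (\<phi> t) $ i - b 0 (\<phi> 0) $ i = RL 1 q t" by (rule has_integral_unique)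
    then show ?thesis by simp
  qed
  with q show ?thesis by blast
qed

end

section \<open>The limiting path as a competitor, and comparison with the minimizers\<close>

lemma Cb13_drift:
  assumes "Cb13 T b" "0 < T"
  shows "\<exists>bt D1 D2. drift T b bt D1 D2"
  using assms unfolding Cb13_def drift_def by blast

lemma admissible_sigma_diffusion_matrix:
  assumes \<sigma>: "admissible_sigma T \<sigma>" and "0 < H" "H < 1" "0 < T"
  shows "\<exists>sd m. diffusion_matrix H T \<sigma> sd m"
proof -
  have "\<forall>i. \<exists>s' m. diffusion_coefficient H T (\<lambda>t. \<sigma> t $ i $ i) s' m"
  proof
    fix i
    have "C1_on_interval T (\<lambda>t. \<sigma> t $ i $ i)" using \<sigma> by (simp add: admissible_sigma_def)
    then obtain s' where "continuous_on {0..T} s'"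
      "\<forall>t\<in>{0..T}. ((\<lambda>t. \<sigma> t $ i $ i) has_real_derivative s' t) (at t within {0..T})"
      unfolding C1_on_interval_def by blast
    moreover have "\<exists>m M. 0 < m \<and> (\<forall>t\<in>{0..T}. m \<le> \<sigma> t $ i $ i \<and> \<sigma> t $ i $ i \<le> M)"
      using \<sigma> by (simp add: admissible_sigma_def)
    then obtain m M where "0 < m" "\<forall>t\<in>{0..T}. m \<le> \<sigma> t $ i $ i \<and> \<sigma> t $ i $ i \<le> M" by blast
    ultimately show "\<exists>s' m. diffusion_coefficient H T (\<lambda>t. \<sigma> t $ i $ i) s' m"
      using assms by (intro exI[of _ s'] exI[of _ m]) (auto simp: diffusion_coefficient_def)
  qed
  then obtain sd m where "\<And>i. diffusion_coefficient H T (\<lambda>t. \<sigma> t $ i $ i) (sd i) (m i)" by metis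
  moreover have "\<forall>t\<in>{0..T}. \<forall>i j. i \<noteq> j \<longrightarrow> \<sigma> t $ i $ j = 0" using \<sigma> by (simp add: admissible_sigma_def)
  ultimately have "diffusion_matrix H T \<sigma> sd m" by (auto simp: diffusion_matrix_def)
  then show ?thesis by blast
qed

locale driven_ode = diffusion_matrix H T \<sigma> sd m + drift T b bt D1 D2
  for H T and \<sigma> :: "real \<Rightarrow> real^'n^'n" and sd m and b :: "real \<Rightarrow> real^'n \<Rightarrow> real^'n" and bt D1 D2 +
  fixes x0 :: "real^'n" and X :: "real \<Rightarrow> real^'n"
  assumes X0: "X 0 = x0"
    and X: "\<And>t. t \<in> {0..T} \<Longrightarrow> (X has_vector_derivative b t (X t)) (at t within {0..T})"
begin

lemma regular_drift:
  assumes \<phi>: "regular \<phi>"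
  shows "regular (\<lambda>t. b t (\<phi> t))"
proof -
  have c: "continuous_on {0..T} \<phi>" using \<phi> by (simp add: regular_def)
  have "\<exists>q. sq_int T q \<and> (\<forall>t\<in>{0..T}. b t (\<phi> t) $ i = b 0 (\<phi> 0) $ i + RL 1 q t)" if H2: "1/2 < H" for i
  proof -
    have "\<forall>j. \<exists>v. sq_int T v \<and> (\<forall>t\<in>{0..T}. \<phi> t $ j = \<phi> 0 $ j + RL 1 v t)" using \<phi> H2 by (simp add: regular_def)
    then obtain v where v: "\<forall>j. sq_int T (v j) \<and> (\<forall>t\<in>{0..T}. \<phi> t $ j = \<phi> 0 $ j + RL 1 (v j) t)"
      by (rule exE[OF choice]) (rule that)
    show ?thesis by (rule drift_AC[OF c, where v=v]) (use v in blast)+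
  qed
  with bounded_continuous_compose[OF bc(1) c] show ?thesis by (simp add: regular_def)
qed

lemma X_continuous: "continuous_on {0..T} X"
  by (auto simp: continuous_on_eq_continuous_within intro!: has_vector_derivative_continuous[OF X])

lemma bX_continuous: "continuous_on {0..T} (\<lambda>t. b t (X t))"
  using bounded_continuous_compose[OF bc(1) X_continuous] .

lemma X_integral: 
  assumes t: "t \<in> {0..T}"
  shows "X t - x0 = integral {0..t} (\<lambda>s. b s (X s))"
proof -
  have "((\<lambda>s. b s (X s)) has_integral X t - X 0) {0..t}"
    using t by (intro fundamental_theorem_of_calculus) (auto intro: has_vector_derivative_within_subset[OF X])
  then show ?thesis by (simp add: X0 integral_unique)
qed

lemma regular_X: "regular X"
proof -
  have "\<exists>v. sq_int T v \<and> (\<forall>t\<in>{0..T}. X t $ i = X 0 $ i + RL 1 v t)" for i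
  proof -
    define v where "v s = ind T s * b s (X s) $ i" for s
    have v: "sq_int T v" unfolding v_def by (intro sq_int_continuous continuous_intros bX_continuous)
    have "X t $ i = X 0 $ i + RL 1 v t" if t: "t \<in> {0..T}" for t
    proof -
      have "RL 1 v t = integral {0..t} v" using sq_int_integrable[OF v] t by (intro RL_1_eq_integral) auto
      also have "\<dots> = integral {0..t} (\<lambda>s. b s (X s) $ i)"
        by (rule integral_spike[of "{0, T}"]) (use t in \<open>auto simp: v_def\<close>)
      also have "\<dots> = integral {0..t} (\<lambda>s. b s (X s)) $ i"
        using continuous_on_subset[OF bX_continuous, of "{0..t}"] t
        by (intro integral_component_eq_cart integrable_continuous_real) auto
      also have "\<dots> = X t $ i - X 0 $ i" unfolding X_integral[OF t, symmetric] by (simp add: X0)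
      finally show ?thesis by simp
    qed
    with v show ?thesis by blast
  qed
  then show ?thesis using X_continuous by (simp add: regular_def)
qed

lemma H_space_cong:
  assumes "h \<in> H_space T H \<sigma>" "\<And>t. t \<in> {0..T} \<Longrightarrow> h' t = h t"
  shows "h' \<in> H_space T H \<sigma>"
  using assms by (auto simp: H_space_def)

text \<open>Minimality is exploited only through comparison with \<open>X\<close>, so
  \<open>X\<close> has to be a competitor.\<close>

lemma X_free: "X \<in> free_endpoint_space T H \<sigma> x0"
proof -
  have "(\<lambda>t. integral {0..t} (\<lambda>s. b s (X s))) \<in> H_space T H \<sigma>"
    by (intro integral_in_H_space regular_drift regular_X)
  then show ?thesis unfolding free_endpoint_space_def
    by (auto intro: H_space_cong simp: X_integral)
qed

lemma K_sigma_inv_spec: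
  assumes "h \<in> H_space T H \<sigma>"
  shows "K_sigma_inv T H \<sigma> h \<in> L2 T" "\<And>t. t \<in> {0..T} \<Longrightarrow> K_sigma H \<sigma> (K_sigma_inv T H \<sigma> h) t = h t"
proof -
  have "\<exists>u. u \<in> L2 T \<and> (\<forall>t\<in>{0..T}. K_sigma H \<sigma> u t = h t)" using assms by (force simp: H_space_def)
  from someI_ex[OF this] show "K_sigma_inv T H \<sigma> h \<in> L2 T" "\<And>t. t \<in> {0..T} \<Longrightarrow> K_sigma H \<sigma> (K_sigma_inv T H \<sigma> h) t = h t"
    unfolding K_sigma_inv_def by auto
qed

definition energy :: "(real \<Rightarrow> real^'n) \<Rightarrow> real" where
  "energy \<phi> = integral {0..T} (\<lambda>t. (norm (K_sigma_inv T H \<sigma> (\<lambda>r. \<phi> r - x0 - integral {0..r} (\<lambda>s. b s (\<phi> s))) t))^2)"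

lemma J_eq: "J_functional T H b \<sigma> x0 \<epsilon> \<phi> =
    1 / (2 * \<epsilon>) * energy \<phi> + d_const H / 2 * integral {0..T} (\<lambda>t. divergence (b t) (\<phi> t))"
  by (simp add: J_functional_def energy_def)

text \<open>An integrand that is not integrable has integral 0 by default, so the sign is known for
  every path, admissible or not.\<close>

lemma energy_nonneg: "0 \<le> energy \<phi>"
  unfolding energy_def
  by (cases "(\<lambda>t. (norm (K_sigma_inv T H \<sigma> (\<lambda>r. \<phi> r - x0 - integral {0..r} (\<lambda>s. b s (\<phi> s))) t))^2) integrable_on {0..T}")
    (auto intro: integral_nonneg simp: not_integrable_integral)

lemma energy_X: "energy X = 0"
proof -
  define h where "h = (\<lambda>r. X r - x0 - integral {0..r} (\<lambda>s. b s (X s)))"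
  have z: "h t = 0" if "t \<in> {0..T}" for t using X_integral[OF that] by (simp add: h_def)
  \<comment> \<open>The residual of \<open>X\<close> is 0 on [0,T], and 0 is the primitive of the
    regular function 0; this places the residual in the range, where \<open>K_sigma_inv\<close> is
    specified.\<close>
  have "(\<lambda>t. integral {0..t} (\<lambda>s. 0::real^'n)) \<in> H_space T H \<sigma>"
  proof (rule integral_in_H_space)
    have "sq_int T (\<lambda>x. 0)" by (simp add: sq_int_def)
    moreover have "RL 1 (\<lambda>x. 0) t = 0" for t by (simp add: RL_def)
    ultimately show "regular (\<lambda>s. 0::real^'n)" unfolding regular_def by auto
  qed
  then have h: "h \<in> H_space T H \<sigma>" by (rule H_space_cong) (simp add: z)
  have "integral {0..T} (\<lambda>t. (norm (K_sigma_inv T H \<sigma> h t))^2) = 0"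
    using K_sigma_inv_spec[OF h] z by (intro K_sigma_zero) auto
  then show ?thesis by (simp add: energy_def h_def)
qed

lemma residual_in_H_space:
  assumes \<phi>: "\<phi> \<in> free_endpoint_space T H \<sigma> x0"
  shows "(\<lambda>r. \<phi> r - x0 - integral {0..r} (\<lambda>s. b s (\<phi> s))) \<in> H_space T H \<sigma>"
proof -
  have h1: "(\<lambda>t. \<phi> t - x0) \<in> H_space T H \<sigma>" using \<phi> by (simp add: free_endpoint_space_def)
  have h2: "(\<lambda>t. integral {0..t} (\<lambda>s. b s (\<phi> s))) \<in> H_space T H \<sigma>"
    by (intro integral_in_H_space regular_drift regular_H_space[OF h1])
  obtain u u' where u: "u \<in> L2 T" "\<forall>t\<in>{0..T}. \<phi> t - x0 = K_sigma H \<sigma> u t"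
    "u' \<in> L2 T" "\<forall>t\<in>{0..T}. integral {0..t} (\<lambda>s. b s (\<phi> s)) = K_sigma H \<sigma> u' t"
    using h1 h2 unfolding H_space_def by blast
  obtain v where "v \<in> L2 T" "\<forall>t\<in>{0..T}. K_sigma H \<sigma> v t = K_sigma H \<sigma> u t - K_sigma H \<sigma> u' t"
    using L2_diff[OF u(1,3)] by blast
  then show ?thesis using u unfolding H_space_def by (intro CollectI bexI[of _ v]) auto
qed

lemma path_distance_bound:
  obtains C where "0 \<le> C" "\<And>\<phi> t. \<phi> \<in> free_endpoint_space T H \<sigma> x0 \<Longrightarrow> t \<in> {0..T} \<Longrightarrow>
    norm (\<phi> t - X t) \<le> C * sqrt (energy \<phi>)"
proof -
  obtain K where K: "0 \<le> K" "\<And>u t. u \<in> L2 T \<Longrightarrow> t \<in> {0..T} \<Longrightarrow>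
    norm (K_sigma H \<sigma> u t) \<le> K * sqrt (integral {0..T} (\<lambda>t. (norm (u t))^2))" using K_sigma_bound by blast
  obtain L where L: "0 < L" "\<And>t x y. t \<in> {0..T} \<Longrightarrow> norm (b t x - b t y) \<le> L * norm (x - y)" using b_Lipschitz by blast
  show ?thesis
  proof (rule that[of "2 * K * exp (2 * L * T)"])
    show "0 \<le> 2 * K * exp (2 * L * T)" using K by simp
    fix \<phi> t assume \<phi>: "\<phi> \<in> free_endpoint_space T H \<sigma> x0" and t: "t \<in> {0..T}"
    have c: "continuous_on {0..T} \<phi>"
      using regular_H_space[of \<phi> x0] \<phi> by (simp add: free_endpoint_space_def regular_def)
    have cb: "continuous_on {0..T} (\<lambda>t. b t (\<phi> t))" using bounded_continuous_compose[OF bc(1) c] .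
    define h where "h = (\<lambda>r. \<phi> r - x0 - integral {0..r} (\<lambda>s. b s (\<phi> s)))"
    note u = K_sigma_inv_spec[OF residual_in_H_space[OF \<phi>], folded h_def]
    have "norm (\<phi> t - X t) \<le> 2 * (K * sqrt (energy \<phi>)) * exp (2 * L * T)"
    proof (rule Gronwall_integral[OF _ _ L(1) _ t])
      show "continuous_on {0..T} (\<lambda>t. norm (\<phi> t - X t))" by (intro continuous_intros c X_continuous)
      show "0 \<le> K * sqrt (energy \<phi>)" using K energy_nonneg by simp
      fix t assume t: "t \<in> {0..T}"
      have sub: "continuous_on {0..t} f" if "continuous_on {0..T} f" for f :: "real \<Rightarrow> real^'n"
        using that t by (auto elim: continuous_on_subset)
      have i: "(\<lambda>s. b s (\<phi> s)) integrable_on {0..t}" "(\<lambda>s. b s (X s)) integrable_on {0..t}"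
        by (intro integrable_continuous_real sub cb bX_continuous)+
      have "\<phi> t - X t = h t + integral {0..t} (\<lambda>s. b s (\<phi> s) - b s (X s))"
        using X_integral[OF t] by (simp add: h_def Henstock_Kurzweil_Integration.integral_diff[OF i] algebra_simps)
      then have "norm (\<phi> t - X t) \<le> norm (h t) + norm (integral {0..t} (\<lambda>s. b s (\<phi> s) - b s (X s)))"
        by (simp add: norm_triangle_ineq)
      also have "norm (h t) \<le> K * sqrt (energy \<phi>)"
        using K(2)[OF u(1) t] u(2)[OF t] by (simp add: energy_def h_def)
      also have "norm (integral {0..t} (\<lambda>s. b s (\<phi> s) - b s (X s))) \<le> integral {0..t} (\<lambda>s. L * norm (\<phi> s - X s))"
      proof (rule integral_norm_bound_integral)
        show "(\<lambda>s. b s (\<phi> s) - b s (X s)) integrable_on {0..t}" using i by (intro integrable_diff)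
        show "(\<lambda>s. L * norm (\<phi> s - X s)) integrable_on {0..t}"
          by (intro integrable_continuous_real continuous_intros sub c X_continuous)
        show "norm (b s (\<phi> s) - b s (X s)) \<le> L * norm (\<phi> s - X s)" if "s \<in> {0..t}" for s
          using that t by (intro L(2)) auto
      qed
      finally show "norm (\<phi> t - X t) \<le> K * sqrt (energy \<phi>) + L * integral {0..t} (\<lambda>s. norm (\<phi> s - X s))" by simp
    qed
    then show "norm (\<phi> t - X t) \<le> 2 * K * exp (2 * L * T) * sqrt (energy \<phi>)" by (simp add: mult_ac)
  qed
qed

text \<open>Stated for all paths of the larger, free space that do no worse than \<open>X\<close>.
  This covers both endpoint conditions with one constant.\<close>

lemma minimizer_distance:
  "\<exists>C>0. \<forall>\<epsilon>>0. \<forall>\<phi>. \<phi> \<in> free_endpoint_space T H \<sigma> x0 \<longrightarrow>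
     J_functional T H b \<sigma> x0 \<epsilon> \<phi> \<le> J_functional T H b \<sigma> x0 \<epsilon> X \<longrightarrow> (\<forall>t\<in>{0..T}. norm (\<phi> t - X t) \<le> C * \<epsilon>)"
proof -
  obtain C where C: "0 \<le> C" "\<And>\<phi> t. \<phi> \<in> free_endpoint_space T H \<sigma> x0 \<Longrightarrow> t \<in> {0..T} \<Longrightarrow>
    norm (\<phi> t - X t) \<le> C * sqrt (energy \<phi>)" using path_distance_bound by blast
  obtain L where L: "0 \<le> L" "\<And>t x y. t \<in> {0..T} \<Longrightarrow> \<bar>divergence (b t) x - divergence (b t) y\<bar> \<le> L * norm (x - y)"
    using divergence_Lipschitz by blast
  define K where "K = \<bar>d_const H\<bar> * L * C * T"
  have K: "0 \<le> K" using L C T by (simp add: K_def)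
  have "norm (\<phi> t - X t) \<le> (C * K + 1) * \<epsilon>"
    if e: "0 < \<epsilon>" and \<phi>: "\<phi> \<in> free_endpoint_space T H \<sigma> x0"
      and J: "J_functional T H b \<sigma> x0 \<epsilon> \<phi> \<le> J_functional T H b \<sigma> x0 \<epsilon> X" and t: "t \<in> {0..T}" for \<epsilon> \<phi> t
  proof -
    define N where "N = sqrt (energy \<phi>)"
    have N: "0 \<le> N" "energy \<phi> = N^2" using energy_nonneg by (auto simp: N_def)
    have c: "continuous_on {0..T} \<phi>"
      using regular_H_space[of \<phi> x0] \<phi> by (simp add: free_endpoint_space_def regular_def)
    let ?d = "\<lambda>\<phi>. integral {0..T} (\<lambda>t. divergence (b t) (\<phi> t))"
    note i = divergence_path_integrable[OF X_continuous] divergence_path_integrable[OF c]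
    have "\<bar>?d X - ?d \<phi>\<bar> = norm (integral {0..T} (\<lambda>t. divergence (b t) (X t) - divergence (b t) (\<phi> t)))"
      using i by (simp add: Henstock_Kurzweil_Integration.integral_diff)
    also have "\<dots> \<le> L * (C * N) * measure lborel {0..T}"
    proof (rule has_integral_bound_real[OF _ finite.emptyI integrable_integral[OF integrable_diff[OF i]]])
      show "0 \<le> L * (C * N)" using L C N by simp
      fix t assume "t \<in> {0..T} - {}"
      then have t: "t \<in> {0..T}" by simp
      have "\<bar>divergence (b t) (X t) - divergence (b t) (\<phi> t)\<bar> \<le> L * norm (X t - \<phi> t)" by (rule L(2)[OF t])
      also have "\<dots> \<le> L * (C * N)"
        using C(2)[OF \<phi> t] L(1) unfolding N_def by (intro mult_left_mono) (auto simp: norm_minus_commute)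
      finally show "norm (divergence (b t) (X t) - divergence (b t) (\<phi> t)) \<le> L * (C * N)" by simp
    qed
    finally have d: "\<bar>?d X - ?d \<phi>\<bar> \<le> L * (C * N) * T" using T by simp
    \<comment> \<open>The comparison multiplied by 2, with the energy of \<open>X\<close> dropped
      because it is 0.\<close>
    have "N^2 / \<epsilon> \<le> d_const H * (?d X - ?d \<phi>)"
      using J unfolding J_eq energy_X N(2) by (simp add: right_diff_distrib)
    also have "\<dots> \<le> \<bar>d_const H\<bar> * \<bar>?d X - ?d \<phi>\<bar>" unfolding abs_mult[symmetric] by (rule abs_ge_self)
    also have "\<dots> \<le> \<bar>d_const H\<bar> * (L * (C * N) * T)" using d by (intro mult_left_mono) auto
    also have "\<dots> = K * N" by (simp add: K_def)
    finally have NK: "N * N \<le> (K * \<epsilon>) * N" using e by (simp add: field_simps power2_eq_square)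
    have "N \<le> K * \<epsilon>"
    \<comment> \<open>Cancelling one factor N is what improves the rate from sqrt \<epsilon> to
      \<epsilon>.\<close>
    proof (cases "N = 0")
      case False
      then show ?thesis using NK N(1) mult_right_le_imp_le[of N N "K * \<epsilon>"] by simp
    qed (use K e in simp)
    then have "C * N \<le> C * (K * \<epsilon>)" using C(1) by (rule mult_left_mono)
    also have "\<dots> \<le> (C * K + 1) * \<epsilon>" using e by (simp add: algebra_simps)
    finally show ?thesis using C(2)[OF \<phi> t] by (simp add: N_def)
  qed
  \<comment> \<open>\<open>C * K\<close> may be 0; the added 1 provides the strictly positive
    constant.\<close>
  moreover have "0 < C * K + 1" using C(1) K by (simp add: add_nonneg_pos)
  ultimately show ?thesis by blast
qed

end

theorem theorem4p12:
  fixes H T :: real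
    and b :: "real \<Rightarrow> real^'n \<Rightarrow> real^'n"
    and \<sigma> :: "real \<Rightarrow> real^'n^'n"
    and x0 :: "real^'n"
    and X :: "real \<Rightarrow> real^'n"
    and \<A> :: "(real \<Rightarrow> real^'n) set"
  assumes "1/4 < H" "H < 1" "0 < T"
    and "Cb13 T b"
    and "admissible_sigma T \<sigma>"
    and "X 0 = x0"
    and "\<And>t. t \<in> {0..T} \<Longrightarrow> (X has_vector_derivative b t (X t)) (at t within {0..T})"
    and "\<A> = fixed_endpoint_space T H \<sigma> x0 (X T) \<or> \<A> = free_endpoint_space T H \<sigma> x0"
  shows "\<exists>C>0. \<forall>\<epsilon>>0. \<forall>\<phi>.
           is_arg_min (J_functional T H b \<sigma> x0 \<epsilon>) (\<lambda>\<psi>. \<psi> \<in> \<A>) \<phi> \<longrightarrow>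
           sup_norm T (\<lambda>t. \<phi> t - X t) \<le> ereal (C * \<epsilon>)"
proof -
  obtain bt D1 D2 where drift: "drift T b bt D1 D2" using Cb13_drift[OF assms(4,3)] by blast
  have "0 < H" using assms(1) by simp
  then obtain sd m where sigma: "diffusion_matrix H T \<sigma> sd m"
    using admissible_sigma_diffusion_matrix[OF assms(5) _ assms(2,3)] by blast
  interpret driven_ode H T \<sigma> sd m b bt D1 D2 x0 X
    using drift sigma assms(6,7) by (simp add: driven_ode_def driven_ode_axioms_def)
  obtain C where C: "0 < C" "\<And>\<epsilon> \<phi> t. 0 < \<epsilon> \<Longrightarrow> \<phi> \<in> free_endpoint_space T H \<sigma> x0 \<Longrightarrow>
      J_functional T H b \<sigma> x0 \<epsilon> \<phi> \<le> J_functional T H b \<sigma> x0 \<epsilon> X \<Longrightarrow> t \<in> {0..T} \<Longrightarrow> norm (\<phi> t - X t) \<le> C * \<epsilon>"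
    using minimizer_distance by blast
  \<comment> \<open>In the fixed-endpoint case the prescribed end value is \<open>X T\<close>, so
    \<open>X\<close> is admissible there as well.\<close>
  have A: "X \<in> \<A>" "\<A> \<subseteq> free_endpoint_space T H \<sigma> x0"
    using assms(8) X_free by (auto simp: fixed_endpoint_space_def)
  have "sup_norm T (\<lambda>t. \<phi> t - X t) \<le> ereal (C * \<epsilon>)"
    if e: "0 < \<epsilon>" and min: "is_arg_min (J_functional T H b \<sigma> x0 \<epsilon>) (\<lambda>\<psi>. \<psi> \<in> \<A>) \<phi>" for \<epsilon> \<phi>
  proof -
    have "\<phi> \<in> \<A>" "\<not> J_functional T H b \<sigma> x0 \<epsilon> X < J_functional T H b \<sigma> x0 \<epsilon> \<phi>"
      using min A(1) by (auto simp: is_arg_min_def)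
    then have "norm (\<phi> t - X t) \<le> C * \<epsilon>" if "t \<in> {0..T}" for t
      using A(2) that by (intro C(2)[OF e]) auto
    then show ?thesis unfolding sup_norm_def by (intro SUP_least) simp
  qed
  then show ?thesis using C(1) by blast
qed

end
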